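(* Let $n = 2^k$ for some integer $k \geq 1$. Then the hypercube graph $Q_n$ admits an orientable Hamiltonian embedding, i.e. an embedding of $Q_n$ on an orientable surface in which the boundary of every face is a Hamiltonian cycle of $Q_n$.
   Context: The $n$-dimensional hypercube $Q_n$ has vertex set $\{0,1\}^n$, two vertices being adjacent iff they differ in exactly one coordinate. An embedding of a graph on a surface (a compact connected 2-manifold) places vertices as distinct points and edges as simple arcs between their endpoints, with no arc passing through other vertices and no two arcs meeting at an interior point. A Hamiltonian embedding of a 2-connected graph $G$ is an embedding in which the cycle bounding each face is a Hamiltonian cycle of $G$; it is orientable if the surface is orientable. *)

theory Defs
  imports "HOL-Complex_Analysis.Complex_Analysis" "HOL-Library.FuncSet"
begin

section \<open>Graphs, Hamiltonian cycles and hypercubes\<close>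

text \<open>A simple graph is given by its vertex set and its set of edges, an edge being a
  two-element set of vertices.  The vertex set \<open>{0,1}\<^sup>n\<close> consists of functions on \<open>{..<n}\<close>;
  they are extensional, so that equality of vertices is equality of coordinates.\<close>

definition hypercube_verts :: "nat \<Rightarrow> (nat \<Rightarrow> nat) set" where
  "hypercube_verts n = ({..<n} \<rightarrow>\<^sub>E {0, 1})"

definition hypercube_edges :: "nat \<Rightarrow> (nat \<Rightarrow> nat) set set" where
  "hypercube_edges n =
     {{x, y} | x y. x \<in> hypercube_verts n \<and> y \<in> hypercube_verts n \<and>
                    card {i. i < n \<and> x i \<noteq> y i} = 1}"

definition cycle_edges :: "'v list \<Rightarrow> 'v set set" where
  "cycle_edges vs = {{vs ! i, vs ! (Suc i mod length vs)} | i. i < length vs}"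

definition hamiltonian_cycle :: "'v set \<Rightarrow> 'v set set \<Rightarrow> 'v list \<Rightarrow> bool" where
  "hamiltonian_cycle V E vs \<longleftrightarrow>
     distinct vs \<and> length vs \<ge> 3 \<and> set vs = V \<and> cycle_edges vs \<subseteq> E"

section \<open>Surfaces and orientability\<close>

text \<open>The plane is \<^typ>\<open>complex\<close>.  Charts take values in open subsets of it, so surfaces have
  no boundary.\<close>

definition chart :: "'a topology \<Rightarrow> 'a set \<Rightarrow> ('a \<Rightarrow> complex) \<Rightarrow> bool" where
  "chart X U \<phi> \<longleftrightarrow>
     openin X U \<and> open (\<phi> ` U) \<and>
     homeomorphic_map (subtopology X U) (top_of_set (\<phi> ` U)) \<phi>"

definition atlas :: "'a topology \<Rightarrow> ('a set \<times> ('a \<Rightarrow> complex)) set \<Rightarrow> bool" where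
  "atlas X A \<longleftrightarrow>
     (\<forall>(U, \<phi>) \<in> A. chart X U \<phi>) \<and> (\<Union>(U, \<phi>) \<in> A. U) = topspace X"

definition surface :: "'a topology \<Rightarrow> bool" where
  "surface X \<longleftrightarrow>
     topspace X \<noteq> {} \<and> compact_space X \<and> connected_space X \<and>
     Hausdorff_space X \<and> second_countable X \<and> (\<exists>A. atlas X A)"

text \<open>A homeomorphism between open subsets of the plane preserves orientation if its local
  degree at each point is 1, that is, if the image of each counterclockwise circle bounding a
  closed disc in the domain winds exactly once, counterclockwise, about the image of the centre.
  No differentiability is required; \<^const>\<open>winding_number\<close> is defined for continuous paths.\<close>

definition orientation_preserving_on :: "complex set \<Rightarrow> (complex \<Rightarrow> complex) \<Rightarrow> bool" where
  "orientation_preserving_on S f \<longleftrightarrow>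
     (\<forall>z r. 0 < r \<and> cball z r \<subseteq> S \<longrightarrow> winding_number (f \<circ> circlepath z r) (f z) = 1)"

definition oriented_atlas :: "'a topology \<Rightarrow> ('a set \<times> ('a \<Rightarrow> complex)) set \<Rightarrow> bool" where
  "oriented_atlas X A \<longleftrightarrow>
     atlas X A \<and>
     (\<forall>(U, \<phi>) \<in> A. \<forall>(V, \<psi>) \<in> A.
        orientation_preserving_on (\<phi> ` (U \<inter> V)) (\<psi> \<circ> inv_into U \<phi>))"

definition orientable_surface :: "'a topology \<Rightarrow> bool" where
  "orientable_surface X \<longleftrightarrow> surface X \<and> (\<exists>A. oriented_atlas X A)"

section \<open>Embeddings of graphs on surfaces\<close>

text \<open>The vertex \<open>v\<close> is placed at the point \<open>p v\<close>, and the edge \<open>e\<close> is the simple arc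
  \<open>\<gamma> e\<close>, parametrised by \<open>{0..1}\<close> in either direction.\<close>

definition graph_embedding ::
  "'v set \<Rightarrow> 'v set set \<Rightarrow> 'a topology \<Rightarrow> ('v \<Rightarrow> 'a) \<Rightarrow> ('v set \<Rightarrow> real \<Rightarrow> 'a) \<Rightarrow> bool" where
  "graph_embedding V E X p \<gamma> \<longleftrightarrow>
     p ` V \<subseteq> topspace X \<and> inj_on p V \<and>
     (\<forall>e \<in> E. pathin X (\<gamma> e) \<and> inj_on (\<gamma> e) {0..1} \<and>
              {\<gamma> e 0, \<gamma> e 1} = p ` e \<and>
              \<gamma> e ` {0<..<1} \<inter> p ` V = {}) \<and>
     (\<forall>e \<in> E. \<forall>e' \<in> E. e \<noteq> e' \<longrightarrow> \<gamma> e ` {0<..<1} \<inter> \<gamma> e' ` {0<..<1} = {})"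

definition graph_image ::
  "'v set \<Rightarrow> 'v set set \<Rightarrow> ('v \<Rightarrow> 'a) \<Rightarrow> ('v set \<Rightarrow> real \<Rightarrow> 'a) \<Rightarrow> 'a set" where
  "graph_image V E p \<gamma> = p ` V \<union> (\<Union>e \<in> E. \<gamma> e ` {0..1})"

definition faces ::
  "'v set \<Rightarrow> 'v set set \<Rightarrow> 'a topology \<Rightarrow> ('v \<Rightarrow> 'a) \<Rightarrow> ('v set \<Rightarrow> real \<Rightarrow> 'a) \<Rightarrow> 'a set set" where
  "faces V E X p \<gamma> =
     connected_components_of (subtopology X (topspace X - graph_image V E p \<gamma>))"

definition hamiltonian_embedding ::
  "'v set \<Rightarrow> 'v set set \<Rightarrow> 'a topology \<Rightarrow> ('v \<Rightarrow> 'a) \<Rightarrow> ('v set \<Rightarrow> real \<Rightarrow> 'a) \<Rightarrow> bool" where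
  "hamiltonian_embedding V E X p \<gamma> \<longleftrightarrow>
     graph_embedding V E X p \<gamma> \<and>
     (\<forall>F \<in> faces V E X p \<gamma>. \<exists>vs. hamiltonian_cycle V E vs \<and>
        X frontier_of F = graph_image (set vs) (cycle_edges vs) p \<gamma>)"

text \<open>An existential quantifier over surfaces must name a type of points.  Every surface has the
  cardinality of the continuum and so is homeomorphic to a space whose points are taken from
  \<^typ>\<open>nat \<times> complex\<close>; the topology on those points is arbitrary, so nothing is lost.\<close>

type_synonym point = "nat \<times> complex"

end

(* Suppose a bipartite n-regular graph is the union of perfect matchings mu_0, ..., mu_(n-1) such
   that each mu_i together with mu_(i+1) (indices modulo n) is a Hamiltonian cycle.  Rotating
   around black vertices in the order 0, ..., n-1 and around white vertices in the opposite order
   gives an orientable embedding whose faces are exactly these n cycles.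

   For Q_2 take the two pairs of parallel edges.  From matchings of Q_n one gets matchings of
   Q_2n = Q_n x Q_n: P_i uses mu_i in rows of black index and mu_(i+1) in rows of white index,
   and Q_j does the same with columns.  P_i together with Q_j is a family of closed staircases.
   Letting P_i use mu_(i+1) in one further black row y0 makes each staircase come back shifted by
   two, so that all staircases merge into one Hamiltonian cycle; hence the order
   P_0, Q_0, P_1, Q_1, ... works for Q_2n.

   The surface is a branched covering of the Riemann sphere.  Black vertices lie over 0, white
   vertices over infinity, edges of colour j over the ray of argument 2 pi j / n, and each face
   covers the sector between two consecutive rays, branched over one point of that sector.  In
   the coordinates z at black vertices, 1/z at white vertices and an M-th root at the branch
   points, all transition maps are holomorphic, which gives the orientation. *)

theory Submission
  imports Defs
begin

section \<open>Surfaces glued holomorphically from plane charts\<close>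

text \<open>If no row were exceptional, a double step of the staircase would act on pairs of black
  vertices as a pair of cyclic permutations of the same order \<open>M\<close>, the number of black
  vertices, and so would have \<open>M\<close> closed orbits. Omitting one row shift per round turns
  a round into the inverse row shift, which is transitive. On the surface, orientation is measured
  by winding numbers of transition maps, so these must be under control. With the complex
  coordinates only two kinds of transition occur: inversion between adjacent vertices and a branch
  of an \<open>M\<close>-th root between a vertex and a face. A face cycle has \<open>2 * M\<close>
  vertices of alternating colour, and walking along it means turning \<open>M\<close> times around
  the branch point, half a turn per vertex. The branch points are \<open>n\<close>-th roots of -1, a
  set invariant under inversion, so one slit plane serves both colours. Seen in a sector, the black
  slit and the white slit are opposite halves of the real axis, which makes charts of cyclically
  consecutive vertices overlap exactly in a half sector.\<close>

lemma orientation_preserving_holomorphic: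
  assumes S: "open S" and f: "f holomorphic_on S" and inj: "inj_on f S"
  shows "orientation_preserving_on S f"
  unfolding orientation_preserving_on_def
proof (intro allI impI, elim conjE)
  fix z :: complex and r :: real
  assume r: "0 < r" and sub: "cball z r \<subseteq> S"
  \<comment> \<open>By compactness a slightly larger open disc still lies in \<open>S\<close>; being
    convex, it admits the logarithm used below.\<close>
  obtain e where e: "e > 0" "(\<Union>x\<in>cball z r. ball x e) \<subseteq> S"
    using compact_subset_open_imp_ball_epsilon_subset[OF _ S sub] by auto
  define B where "B = ball z (r + e)"
  have BS: "B \<subseteq> S"
  proof
    fix w assume w: "w \<in> B"
    show "w \<in> S"
    proof (cases "w \<in> cball z r")
      case True then show ?thesis using sub by auto
    next
      case False
      define d where "d = norm (w - z)"
      have d: "r < d" "d < r + e"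
        using False w by (auto simp: d_def B_def dist_norm norm_minus_commute)
      \<comment> \<open>The radial projection of \<open>w\<close> to the circle.\<close>
      define x where "x = z + of_real (r/d) * (w - z)"
      have "norm (x - z) = r" using d r by (simp add: x_def norm_mult norm_divide d_def[symmetric])
      then have x: "x \<in> cball z r" by (simp add: dist_norm norm_minus_commute)
      have "x - w = of_real (r/d - 1) * (w - z)" by (simp add: x_def algebra_simps)
      then have "norm (x - w) = \<bar>r/d - 1\<bar> * d" by (simp only: norm_mult norm_of_real d_def)
      also have "\<dots> = d - r" using d r by (simp add: abs_if field_simps)
      finally have "w \<in> ball x e" using d by (simp add: dist_norm)
      with x e show ?thesis by blast
    qed
  qed
  have zB: "z \<in> B" using r e by (simp add: B_def)
  have B: "open B" "convex B" by (auto simp: B_def)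
  \<comment> \<open>The difference quotient, continued by the derivative at \<open>z\<close>, has no
    zero because \<open>f\<close> is injective; hence it is an exponential on the disc.\<close>
  define g where "g = (\<lambda>w. if w = z then deriv f z else (f w - f z) / (w - z))"
  have g: "g holomorphic_on B"
    unfolding g_def by (rule pole_lemma_open) (use f BS B holomorphic_on_subset in auto)
  have "g w \<noteq> 0" if "w \<in> B" for w
    using holomorphic_injective_imp_regular[OF f S inj] inj_onD[OF inj, of w z] that zB BS
    by (auto simp: g_def)
  then obtain h where h: "h holomorphic_on B" "\<And>w. w \<in> B \<Longrightarrow> exp (h w) = g w"
    using holomorphic_logarithm_exists[OF B(2,1) g _ zB] by blast
  have fg: "f w - f z = (w - z) * g w" for w by (auto simp: g_def)
  \<comment> \<open>A continuous logarithm of the image curve relative to \<open>f z\<close>. The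
    summand \<open>h\<close> returns to its initial value, so the total increment is that of the
    circle.\<close>
  define p where "p = (\<lambda>t. of_real (ln r) + 2 * of_real pi * \<i> * of_real t + h (circlepath z r t))"
  have cp: "circlepath z r t = z + r * exp (2 * of_real pi * \<i> * of_real t)" for t
    by (simp add: circlepath)
  have inB: "circlepath z r t \<in> B" for t
    using r e by (simp add: cp B_def dist_norm norm_mult)
  have "path p"
    unfolding p_def path_def
  proof (intro continuous_intros)
    have "continuous_on {0..1} (circlepath z r)" using path_circlepath path_def by blast
    then show "continuous_on {0..1} (\<lambda>t. h (circlepath z r t))"
      by (rule continuous_on_compose2[OF holomorphic_on_imp_continuous_on[OF h(1)]]) (use inB in auto)
  qed
  have "(f \<circ> circlepath z r) t - f z = (exp \<circ> p) t" for t
  proof -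
    have "(f \<circ> circlepath z r) t - f z = r * exp (2 * of_real pi * \<i> * of_real t) * exp (h (circlepath z r t))"
      unfolding o_def fg h(2)[OF inB] by (simp add: cp)
    also have "\<dots> = (exp \<circ> p) t"
      using r exp_of_real[of "ln r", where 'a=complex] by (simp add: p_def exp_add)
    finally show ?thesis .
  qed
  then have "winding_number (f \<circ> circlepath z r) (f z) = winding_number (exp \<circ> p) 0"
    by (subst winding_number_offset) (simp add: o_def)
  also have "\<dots> = (pathfinish p - pathstart p) / (2 * of_real pi * \<i>)"
    by (rule winding_number_compose_exp) fact
  also have "pathfinish p - pathstart p = 2 * of_real pi * \<i>"
    using pathfinish_circlepath[of z r] pathstart_circlepath[of z r]
    by (simp add: p_def pathfinish_def pathstart_def)
  finally show "winding_number (f \<circ> circlepath z r) (f z) = 1" by (simp add: o_def)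
qed

text \<open>The discs that are tested lie inside \<open>S\<close>, so values on \<open>S\<close>
  decide. Transition maps written with \<open>inv_into\<close> agree with holomorphic maps only
  there.\<close>

lemma orientation_preserving_on_cong:
  assumes eq: "\<And>x. x \<in> S \<Longrightarrow> f x = g x" and g: "orientation_preserving_on S g"
  shows "orientation_preserving_on S f"
  unfolding orientation_preserving_on_def
proof (intro allI impI, elim conjE)
  fix z :: complex and r :: real
  assume r: "0 < r" and sub: "cball z r \<subseteq> S"
  have "circlepath z r t \<in> S" for t
    using r sub by (intro subsetD[OF sub]) (simp add: circlepath dist_norm norm_mult)
  then have "f \<circ> circlepath z r = g \<circ> circlepath z r" using eq by auto
  moreover have "f z = g z" using eq sub r by (simp add: subset_iff)
  ultimately show "winding_number (f \<circ> circlepath z r) (f z) = 1"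
    using g r sub unfolding orientation_preserving_on_def by metis
qed

section \<open>Surfaces glued from finitely many plane domains\<close>

text \<open>The maps \<open>q a\<close> parametrise the charts, and chart points are glued exactly
  if their values coincide, so no quotient type appears. By \<open>glue\<close> each gluing relation
  is the graph of a holomorphic map on an open set; by \<open>closed_glue\<close> it is closed in
  the product of the two domains, which is what separates points.\<close>

locale holomorphic_gluing =
  fixes I :: "'c set" and D :: "'c \<Rightarrow> complex set" and q :: "'c \<Rightarrow> complex \<Rightarrow> 'p"
  assumes finite_I: "finite I"
    and open_D: "a \<in> I \<Longrightarrow> open (D a)"
    and inj_q: "a \<in> I \<Longrightarrow> inj_on (q a) (D a)"
    and glue: "a \<in> I \<Longrightarrow> b \<in> I \<Longrightarrow>
      \<exists>S F. open S \<and> F holomorphic_on S \<and>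
        (\<forall>x y. (x \<in> D a \<and> y \<in> D b \<and> q a x = q b y) \<longleftrightarrow> x \<in> S \<and> y = F x)"
    and closed_glue: "a \<in> I \<Longrightarrow> b \<in> I \<Longrightarrow> x \<in> D a \<Longrightarrow> y \<in> D b \<Longrightarrow>
      (\<And>k::nat. X k \<in> D a \<and> Y k \<in> D b \<and> q a (X k) = q b (Y k)) \<Longrightarrow>
      X \<longlonglongrightarrow> x \<Longrightarrow> Y \<longlonglongrightarrow> y \<Longrightarrow> q a x = q b y"
begin

definition points :: "'p set" where "points = (\<Union>a\<in>I. q a ` D a)"

text \<open>The final topology on \<open>points\<close> for the maps \<open>q a\<close>.\<close>

definition glued :: "'p topology" where
  "glued = topology (\<lambda>S. S \<subseteq> points \<and> (\<forall>a\<in>I. open {x \<in> D a. q a x \<in> S}))"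

lemma openin_glued: "openin glued S \<longleftrightarrow> S \<subseteq> points \<and> (\<forall>a\<in>I. open {x \<in> D a. q a x \<in> S})"
proof -
  have "istopology (\<lambda>S. S \<subseteq> points \<and> (\<forall>a\<in>I. open {x \<in> D a. q a x \<in> S}))"
    unfolding istopology_def
  proof (intro conjI allI impI ballI; (elim conjE)?)
    fix S T a assume "\<forall>a\<in>I. open {x \<in> D a. q a x \<in> S}" "\<forall>a\<in>I. open {x \<in> D a. q a x \<in> T}" "a \<in> I"
    then have "open ({x \<in> D a. q a x \<in> S} \<inter> {x \<in> D a. q a x \<in> T})" by auto
    also have "{x \<in> D a. q a x \<in> S} \<inter> {x \<in> D a. q a x \<in> T} = {x \<in> D a. q a x \<in> S \<inter> T}" by auto
    finally show "open {x \<in> D a. q a x \<in> S \<inter> T}" .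
  next
    fix K a assume *: "\<forall>S\<in>K. S \<subseteq> points \<and> (\<forall>a\<in>I. open {x \<in> D a. q a x \<in> S})" "a \<in> I"
    then have "open (\<Union>S\<in>K. {x \<in> D a. q a x \<in> S})" by auto
    also have "(\<Union>S\<in>K. {x \<in> D a. q a x \<in> S}) = {x \<in> D a. q a x \<in> \<Union> K}" by auto
    finally show "open {x \<in> D a. q a x \<in> \<Union> K}" .
  qed auto
  then show ?thesis by (simp add: glued_def topology_inverse')
qed

lemma topspace_glued [simp]: "topspace glued = points"
proof (rule antisym)
  show "topspace glued \<subseteq> points" using openin_glued openin_topspace by blast
  have "{x \<in> D a. q a x \<in> points} = D a" if "a \<in> I" for a using that by (auto simp: points_def)
  then have "openin glued points" unfolding openin_glued using open_D by auto
  then show "points \<subseteq> topspace glued" by (rule openin_subset)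
qed

lemma transition:
  assumes "a \<in> I" "b \<in> I"
  obtains S F where "open S" "F holomorphic_on S" "S = {x \<in> D a. q a x \<in> q b ` D b}"
    "\<And>x. x \<in> S \<Longrightarrow> F x \<in> D b \<and> q b (F x) = q a x" "inj_on F S"
proof -
  obtain S F where S: "open S" "F holomorphic_on S"
    and SF: "\<And>x y. (x \<in> D a \<and> y \<in> D b \<and> q a x = q b y) \<longleftrightarrow> x \<in> S \<and> y = F x"
    using glue[OF assms] by blast
  show ?thesis
  proof (rule that[OF S])
    show "S = {x \<in> D a. q a x \<in> q b ` D b}" using SF by blast
    show "F x \<in> D b \<and> q b (F x) = q a x" if "x \<in> S" for x using SF[of x "F x"] that by auto
    show "inj_on F S"
      using SF inj_q[OF assms(1)] unfolding inj_on_def by metis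
  qed
qed

text \<open>Seen from another chart, the image of \<open>A\<close> is the preimage of
  \<open>A\<close> under a transition map, which is continuous on an open set.\<close>

lemma openin_chart_image:
  assumes a: "a \<in> I" and A: "open A" "A \<subseteq> D a"
  shows "openin glued (q a ` A)"
  unfolding openin_glued
proof (intro conjI ballI)
  show "q a ` A \<subseteq> points" using a A by (auto simp: points_def)
  fix b assume b: "b \<in> I"
  obtain S F where S: "open S" "F holomorphic_on S" "S = {x \<in> D b. q b x \<in> q a ` D a}"
    and F: "\<And>x. x \<in> S \<Longrightarrow> F x \<in> D a \<and> q a (F x) = q b x" "inj_on F S"
    by (rule transition[OF b a]) blast
  have "{x \<in> D b. q b x \<in> q a ` A} = {x \<in> S. F x \<in> A}"
  proof (rule set_eqI)
    fix x
    show "x \<in> {x \<in> D b. q b x \<in> q a ` A} \<longleftrightarrow> x \<in> {x \<in> S. F x \<in> A}"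
    proof (cases "x \<in> S")
      case True
      have "q b x \<in> q a ` A \<longleftrightarrow> F x \<in> A"
        using F(1)[OF True] inj_on_image_mem_iff[OF inj_q[OF a] _ A(2), of "F x"] by simp
      then show ?thesis using True S(3) by simp
    next
      case False
      then show ?thesis using S(3) A(2) by blast
    qed
  qed
  then show "open {x \<in> D b. q b x \<in> q a ` A}"
    using continuous_open_preimage[OF holomorphic_on_imp_continuous_on[OF S(2)] S(1) A(1)]
    by (simp add: Int_def vimage_def)
qed

lemma continuous_chart_inv:
  assumes a: "a \<in> I" shows "continuous_map (top_of_set (D a)) glued (q a)"
  unfolding continuous_map_def
proof (intro conjI allI impI)
  show "q a \<in> topspace (top_of_set (D a)) \<rightarrow> topspace glued" using a by (auto simp: points_def)
  fix S assume "openin glued S"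
  then have "open {x \<in> D a. q a x \<in> S}" using a by (simp add: openin_glued)
  then show "openin (top_of_set (D a)) {x \<in> topspace (top_of_set (D a)). q a x \<in> S}"
    using open_D[OF a] by (simp add: openin_open_eq)
qed

lemma continuous_into_glued:
  assumes a: "a \<in> I" and f: "continuous_on T f" "f ` T \<subseteq> D a"
  shows "continuous_map (top_of_set T) glued (\<lambda>t. q a (f t))"
proof -
  have "continuous_map (top_of_set T) (top_of_set (D a)) f" using f by auto
  from continuous_map_compose[OF this continuous_chart_inv[OF a]] show ?thesis by (simp add: o_def)
qed

lemma chart_glued:
  assumes a: "a \<in> I"
  shows "chart glued (q a ` D a) (inv_into (D a) (q a))"
    and "inv_into (D a) (q a) ` q a ` D a = D a"
proof -
  let ?U = "q a ` D a" and ?f = "inv_into (D a) (q a)"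
  show im: "?f ` ?U = D a" using inv_into_image_cancel[OF inj_q[OF a]] by auto
  have op: "openin glued ?U" by (rule openin_chart_image[OF a open_D[OF a]]) simp
  have ts: "topspace (subtopology glued ?U) = ?U" using openin_subset[OF op] by auto
  have "homeomorphic_maps (subtopology glued ?U) (top_of_set (D a)) ?f (q a)"
    unfolding homeomorphic_maps_def
  proof (intro conjI)
    show "continuous_map (subtopology glued ?U) (top_of_set (D a)) ?f"
      unfolding continuous_map_def
    proof (intro conjI allI impI)
      show "?f \<in> topspace (subtopology glued ?U) \<rightarrow> topspace (top_of_set (D a))"
        unfolding ts using im by auto
      fix A assume "openin (top_of_set (D a)) A"
      then have A: "open A" "A \<subseteq> D a" using open_D[OF a] by (auto simp: openin_open_eq)
      have "{x \<in> topspace (subtopology glued ?U). ?f x \<in> A} = q a ` A"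
        unfolding ts using A inj_q[OF a] by auto
      then show "openin (subtopology glued ?U) {x \<in> topspace (subtopology glued ?U). ?f x \<in> A}"
        using openin_chart_image[OF a A] image_mono[OF A(2), of "q a"]
        unfolding openin_subtopology by (metis inf.absorb1)
    qed
    show "continuous_map (top_of_set (D a)) (subtopology glued ?U) (q a)"
      using continuous_chart_inv[OF a] by (auto simp: continuous_map_in_subtopology)
    show "\<forall>x\<in>topspace (subtopology glued ?U). q a (?f x) = x" unfolding ts by (auto simp: f_inv_into_f)
    show "\<forall>y\<in>topspace (top_of_set (D a)). ?f (q a y) = y" using inj_q[OF a] by auto
  qed
  then show "chart glued ?U ?f"
    unfolding chart_def im using op open_D[OF a] homeomorphic_maps_imp_map by blast
qed

text \<open>On each overlap the transition map built from \<open>inv_into\<close> coincides with the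
  injective holomorphic map supplied by \<open>transition\<close>.\<close>

lemma oriented_atlas_glued:
  "oriented_atlas glued ((\<lambda>a. (q a ` D a, inv_into (D a) (q a))) ` I)" (is "oriented_atlas _ ?A")
proof -
  have "orientation_preserving_on (inv_into (D a) (q a) ` (q a ` D a \<inter> q b ` D b))
          (inv_into (D b) (q b) \<circ> inv_into (q a ` D a) (inv_into (D a) (q a)))"
    if a: "a \<in> I" and b: "b \<in> I" for a b
  proof -
    obtain S F where S: "open S" "F holomorphic_on S" "S = {x \<in> D a. q a x \<in> q b ` D b}"
      and F: "\<And>x. x \<in> S \<Longrightarrow> F x \<in> D b \<and> q b (F x) = q a x" "inj_on F S"
      by (rule transition[OF a b]) blast
    have SS: "inv_into (D a) (q a) ` (q a ` D a \<inter> q b ` D b) = S"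
    proof (intro equalityI subsetI)
      fix x assume "x \<in> inv_into (D a) (q a) ` (q a ` D a \<inter> q b ` D b)"
      then obtain y where "y \<in> D a" "q a y \<in> q b ` D b" "x = inv_into (D a) (q a) (q a y)" by blast
      then show "x \<in> S" using S(3) inj_q[OF a] by simp
    next
      fix x assume "x \<in> S"
      then have x: "x \<in> D a" "q a x \<in> q b ` D b" using S(3) by auto
      then have "x = inv_into (D a) (q a) (q a x)" using inj_q[OF a] by simp
      with x show "x \<in> inv_into (D a) (q a) ` (q a ` D a \<inter> q b ` D b)" by blast
    qed
    have inj: "inj_on (inv_into (D a) (q a)) (q a ` D a)" by (simp add: inj_on_inv_into)
    have *: "inv_into (q a ` D a) (inv_into (D a) (q a)) x = q a x" if "x \<in> D a" for x
    proof (rule inv_into_f_eq[OF inj])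
      show "inv_into (D a) (q a) (q a x) = x" using that inj_q[OF a] by simp
    qed (use that in auto)
    show ?thesis unfolding SS
    proof (rule orientation_preserving_on_cong[OF _ orientation_preserving_holomorphic[OF S(1,2) F(2)]])
      fix x assume x: "x \<in> S"
      have "q a x = q b (F x)" "F x \<in> D b" using F(1)[OF x] by auto
      then show "(inv_into (D b) (q b) \<circ> inv_into (q a ` D a) (inv_into (D a) (q a))) x = F x"
        using x S(3) inj_q[OF b] by (simp add: *)
    qed
  qed
  moreover have "atlas glued ?A"
    unfolding atlas_def using chart_glued(1) by (auto simp: points_def)
  ultimately show ?thesis unfolding oriented_atlas_def by auto
qed

text \<open>If the discs of radius \<open>1 / Suc k\<close> around the two chart points were never
  disjoint after gluing, glued pairs would converge to the two points, and
  \<open>closed_glue\<close> would identify them.\<close>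

lemma Hausdorff_space_glued: "Hausdorff_space glued"
  unfolding Hausdorff_space_def
proof (intro allI impI, elim conjE)
  fix p p' assume "p \<in> topspace glued" "p' \<in> topspace glued" and ne: "p \<noteq> p'"
  then obtain a x b y where a: "a \<in> I" "x \<in> D a" "p = q a x" and b: "b \<in> I" "y \<in> D b" "p' = q b y"
    by (auto simp: points_def)
  have "\<exists>k::nat. \<forall>x' y'. x' \<in> D a \<inter> ball x (1 / Suc k) \<longrightarrow> y' \<in> D b \<inter> ball y (1 / Suc k) \<longrightarrow> q a x' \<noteq> q b y'"
  proof (rule ccontr)
    assume "\<not> ?thesis"
    then have "\<forall>k::nat. \<exists>x' y'. x' \<in> D a \<inter> ball x (1 / Suc k) \<and> y' \<in> D b \<inter> ball y (1 / Suc k) \<and> q a x' = q b y'"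
      by blast
    then obtain X Y where XY: "\<And>k. X k \<in> D a \<inter> ball x (1 / Suc k)" "\<And>k. Y k \<in> D b \<inter> ball y (1 / Suc k)"
      "\<And>k. q a (X k) = q b (Y k)" by metis
    have lim: "Z \<longlonglongrightarrow> z" if "\<And>k. Z k \<in> ball z (1 / Suc k)" for Z and z :: complex
    proof (rule metric_tendsto_imp_tendsto[OF LIMSEQ_inverse_real_of_nat])
      show "\<forall>\<^sub>F k in sequentially. dist (Z k) z \<le> dist (inverse (real (Suc k))) 0"
        using that by (intro always_eventually allI less_imp_le)
          (simp add: dist_commute inverse_eq_divide)
    qed
    have "q a x = q b y"
      by (rule closed_glue[OF a(1) b(1) a(2) b(2), of X Y]) (use XY in \<open>auto intro!: lim\<close>)
    then show False using ne a b by simp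
  qed
  then obtain k :: nat where k: "\<And>x' y'. x' \<in> D a \<inter> ball x (1 / Suc k) \<Longrightarrow> y' \<in> D b \<inter> ball y (1 / Suc k) \<Longrightarrow> q a x' \<noteq> q b y'"
    by blast
  let ?U = "q a ` (D a \<inter> ball x (1 / Suc k))" and ?V = "q b ` (D b \<inter> ball y (1 / Suc k))"
  have "openin glued ?U" "openin glued ?V"
    using a b open_D by (auto intro!: openin_chart_image)
  moreover have "p \<in> ?U" "p' \<in> ?V" using a b by auto
  moreover have "disjnt ?U ?V" using k by (auto simp: disjnt_def)
  ultimately show "\<exists>U V. openin glued U \<and> openin glued V \<and> p \<in> U \<and> p' \<in> V \<and> disjnt U V" by blast
qed

lemma second_countable_glued: "second_countable glued"
proof -
  obtain B :: "complex set set" where B: "countable B" "\<And>C. C \<in> B \<Longrightarrow> open C"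
    "\<And>S. open S \<Longrightarrow> \<exists>U. U \<subseteq> B \<and> S = \<Union>U"
    using univ_second_countable by blast
  define BB where "BB = (\<lambda>(a, C). q a ` (D a \<inter> C)) ` (I \<times> B)"
  have "countable BB" unfolding BB_def using B finite_I by (intro countable_image countable_SIGMA) (auto intro: countable_finite)
  moreover have "openin glued V" if "V \<in> BB" for V
    using that B open_D unfolding BB_def by (auto intro!: openin_chart_image)
  moreover have "\<exists>V\<in>BB. p \<in> V \<and> V \<subseteq> S" if S: "openin glued S" "p \<in> S" for S p
  proof -
    obtain a x where a: "a \<in> I" "x \<in> D a" "p = q a x"
      using S openin_subset[OF S(1)] by (auto simp: points_def)
    have "open {x \<in> D a. q a x \<in> S}" using S a by (simp add: openin_glued)
    then obtain U where U: "U \<subseteq> B" "{x \<in> D a. q a x \<in> S} = \<Union>U" using B(3) by meson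
    have "x \<in> \<Union>U" unfolding U(2)[symmetric] using a S by simp
    then obtain C where C: "C \<in> U" "x \<in> C" by (rule UnionE)
    show ?thesis
    proof (intro bexI conjI)
      show "q a ` (D a \<inter> C) \<in> BB" using C U(1) a by (auto simp: BB_def)
      show "p \<in> q a ` (D a \<inter> C)" using a C by simp
      show "q a ` (D a \<inter> C) \<subseteq> S" using C U(2) by auto
    qed
  qed
  ultimately show ?thesis unfolding second_countable_def by (intro exI[of _ BB]) simp
qed

text \<open>The chart domains are open, so compact pieces \<open>K a\<close> have to be exhibited
  whose images still cover everything.\<close>

lemma compact_space_glued:
  assumes K: "\<And>a. a \<in> I \<Longrightarrow> compact (K a) \<and> K a \<subseteq> D a" and cover: "points \<subseteq> (\<Union>a\<in>I. q a ` K a)"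
  shows "compact_space glued"
proof -
  have "compactin glued (q a ` K a)" if "a \<in> I" for a
    by (rule image_compactin[OF _ continuous_chart_inv[OF that]])
      (use K that in \<open>auto simp: compactin_subtopology\<close>)
  then have "compactin glued (\<Union>a\<in>I. q a ` K a)" using finite_I by (intro compactin_Union) auto
  moreover have "(\<Union>a\<in>I. q a ` K a) \<subseteq> points"
    unfolding points_def by (rule UN_mono) (use K in auto)
  then have "(\<Union>a\<in>I. q a ` K a) = points" using cover by (rule antisym)
  ultimately show ?thesis by (simp add: compact_space_def)
qed

lemma connectedin_chart_image:
  assumes "a \<in> I" "connected (D a)" shows "connectedin glued (q a ` D a)"
  by (rule connectedin_continuous_map_image[OF continuous_chart_inv[OF assms(1)]])
    (use assms(2) in \<open>simp add: connectedin_subtopology\<close>)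

text \<open>Chart images are open, so membership in a closure can be decided in any one chart around
  the point. This reduces frontiers of faces to limits in the plane.\<close>

lemma closure_of_chart_iff:
  assumes a: "a \<in> I" and x: "x \<in> D a"
  shows "q a x \<in> glued closure_of S \<longleftrightarrow> x \<in> closure {y \<in> D a. q a y \<in> S}"
proof
  assume L: "q a x \<in> glued closure_of S"
  show "x \<in> closure {y \<in> D a. q a y \<in> S}"
  proof (rule ccontr)
    assume "x \<notin> closure {y \<in> D a. q a y \<in> S}"
    define N where "N = q a ` (D a - closure {y \<in> D a. q a y \<in> S})"
    have "openin glued N"
      unfolding N_def by (rule openin_chart_image[OF a open_Diff[OF open_D[OF a] closed_closure] Diff_subset])
    moreover have "q a x \<in> N"
      unfolding N_def by (rule imageI) (rule DiffI[OF x \<open>x \<notin> closure _\<close>])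
    ultimately obtain p where "p \<in> S" "p \<in> N"
      using L unfolding in_closure_of by blast
    then obtain y where "y \<in> D a" "y \<notin> closure {y \<in> D a. q a y \<in> S}" "q a y \<in> S"
      by (auto simp: N_def)
    then have "y \<in> {y \<in> D a. q a y \<in> S}" by simp
    then have "y \<in> closure {y \<in> D a. q a y \<in> S}" by (rule subsetD[OF closure_subset])
    then show False using \<open>y \<notin> closure _\<close> by contradiction
  qed
next
  assume R: "x \<in> closure {y \<in> D a. q a y \<in> S}"
  show "q a x \<in> glued closure_of S"
    unfolding in_closure_of
  proof (intro conjI allI impI; (elim conjE)?)
    show "q a x \<in> topspace glued" using a x by (auto simp: points_def)
    fix T assume T: "q a x \<in> T" "openin glued T"
    have "open {y \<in> D a. q a y \<in> T}" using T a by (simp add: openin_glued)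
    then have "{y \<in> D a. q a y \<in> S} \<inter> {y \<in> D a. q a y \<in> T} \<noteq> {}"
      using R T(1) x open_Int_closure_eq_empty[of "{y \<in> D a. q a y \<in> T}" "{y \<in> D a. q a y \<in> S}"] by auto
    then show "\<exists>p. p \<in> S \<and> p \<in> T" by blast
  qed
qed

lemma orientable_surface_glued:
  assumes "points \<noteq> {}" "connected_space glued" "compact_space glued"
  shows "orientable_surface glued"
proof -
  have "atlas glued ((\<lambda>a. (q a ` D a, inv_into (D a) (q a))) ` I)"
    using oriented_atlas_glued unfolding oriented_atlas_def by (rule conjunct1)
  then have "surface glued"
    using assms Hausdorff_space_glued second_countable_glued
    unfolding surface_def topspace_glued by blast
  then show ?thesis
    using oriented_atlas_glued unfolding orientable_surface_def by blast
qed

end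

section \<open>Cyclic one-factorizations of hypercubes\<close>

text \<open>Up to the least period of \<open>b\<close> all iterates are distinct, and reachability
  makes them exhaust \<open>B\<close>; the least period is therefore \<open>card B\<close>.\<close>

lemma single_orbit:
  fixes f :: "'v \<Rightarrow> 'v"
  assumes fin: "finite B" and closed: "f ` B \<subseteq> B"
    and orbit: "\<And>x y. x \<in> B \<Longrightarrow> y \<in> B \<Longrightarrow> \<exists>k. (f ^^ k) x = y" and b: "b \<in> B"
  shows "bij_betw (\<lambda>k. (f ^^ k) b) {..<card B} B" and "(f ^^ card B) b = b"
proof -
  have cl: "(f ^^ k) b \<in> B" for k by (induction k) (use b closed in auto)
  have "f b \<in> B" using cl[of 1] by simp
  from orbit[OF this b] obtain k where "(f ^^ k) (f b) = b" by blast
  then have ex: "\<exists>p>0. (f ^^ p) b = b" by (intro exI[of _ "Suc k"]) (simp add: funpow_swap1)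
  define p where "p = (LEAST p. 0 < p \<and> (f ^^ p) b = b)"
  have p: "p > 0" "(f ^^ p) b = b" using LeastI_ex[OF ex] by (auto simp: p_def)
  have least: "(f ^^ k) b \<noteq> b" if "0 < k" "k < p" for k
    using not_less_Least[of k "\<lambda>p. 0 < p \<and> (f ^^ p) b = b"] that by (auto simp: p_def)
  have inj: "inj_on (\<lambda>k. (f ^^ k) b) {..<p}"
  proof (rule linorder_inj_onI)
    fix i j assume ij: "i < j" "i \<in> {..<p}" "j \<in> {..<p}"
    show "(f ^^ i) b \<noteq> (f ^^ j) b"
    proof
      assume eq: "(f ^^ i) b = (f ^^ j) b"
      have "(f ^^ (p - j + i)) b = (f ^^ (p - j)) ((f ^^ i) b)" by (simp add: funpow_add)
      also have "\<dots> = (f ^^ (p - j + j)) b" by (simp only: eq funpow_add o_apply)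
      also have "\<dots> = b" using p ij by simp
      finally have "(f ^^ (p - j + i)) b = b" .
      moreover have "0 < p - j + i" "p - j + i < p" using ij by auto
      ultimately show False using least[of "p - j + i"] by simp
    qed
  qed auto
  have "(\<lambda>k. (f ^^ k) b) ` {..<p} = B"
  proof (intro equalityI subsetI)
    fix x assume "x \<in> B"
    with orbit[OF b] obtain k where "(f ^^ k) b = x" by blast
    then have "(f ^^ (k mod p)) b = x" using funpow_mod_eq[OF p(2), of k] by simp
    then show "x \<in> (\<lambda>k. (f ^^ k) b) ` {..<p}" using p by (intro image_eqI[of _ _ "k mod p"]) auto
  qed (use cl in auto)
  with inj have bij: "bij_betw (\<lambda>k. (f ^^ k) b) {..<p} B" by (simp add: bij_betw_def)
  then have "card B = p" using bij_betw_same_card by fastforce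
  then show "bij_betw (\<lambda>k. (f ^^ k) b) {..<card B} B" "(f ^^ card B) b = b" using bij p by auto
qed

section \<open>Bipartite graphs with a cyclic sequence of matchings\<close>

text \<open>The condition \<open>orbit\<close> encodes Hamiltonicity: two steps along the
  alternating cycle of consecutive matchings lead from black to black, and a single orbit on the
  black vertices means a single cycle. This form passes to products and along bijections without any
  lists.\<close>

locale cyclic_factorization =
  fixes V :: "'v set" and black :: "'v \<Rightarrow> bool" and \<mu> :: "nat \<Rightarrow> 'v \<Rightarrow> 'v" and n :: nat
  assumes n2: "n \<ge> 2" and fin: "finite V" and nonempty: "V \<noteq> {}"
    and mem: "i < n \<Longrightarrow> v \<in> V \<Longrightarrow> \<mu> i v \<in> V"
    and invol: "i < n \<Longrightarrow> v \<in> V \<Longrightarrow> \<mu> i (\<mu> i v) = v"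
    and colour: "i < n \<Longrightarrow> v \<in> V \<Longrightarrow> black (\<mu> i v) \<longleftrightarrow> \<not> black v"
    and proper: "i < n \<Longrightarrow> j < n \<Longrightarrow> v \<in> V \<Longrightarrow> \<mu> i v = \<mu> j v \<Longrightarrow> i = j"
    and orbit: "i < n \<Longrightarrow> v \<in> V \<Longrightarrow> black v \<Longrightarrow> w \<in> V \<Longrightarrow> black w \<Longrightarrow>
      \<exists>k. ((\<mu> (Suc i mod n) \<circ> \<mu> i) ^^ k) v = w"
begin

definition edges :: "'v set set" where "edges = {{v, \<mu> i v} | v i. v \<in> V \<and> i < n}"

definition blacks where "blacks = {v \<in> V. black v}"

lemma Suc_mod_less: "Suc i mod n < n" using n2 by simp

lemma ex_black: "\<exists>b. b \<in> blacks"
proof -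
  obtain v where "v \<in> V" using nonempty by blast
  then have "v \<in> blacks \<or> \<mu> 0 v \<in> blacks" using mem[of 0 v] colour[of 0 v] n2 by (auto simp: blacks_def)
  then show ?thesis by blast
qed

lemma finite_blacks: "finite blacks" using fin by (simp add: blacks_def)

definition rot :: "nat \<Rightarrow> nat \<Rightarrow> 'v \<Rightarrow> 'v" where "rot i j = \<mu> j \<circ> \<mu> i"

lemma rot_apply: "rot i j v = \<mu> j (\<mu> i v)" by (simp add: rot_def)

lemma rot_mem: "i < n \<Longrightarrow> j < n \<Longrightarrow> b \<in> blacks \<Longrightarrow> rot i j b \<in> blacks"
  by (simp add: rot_apply blacks_def mem colour)

lemma rot_funpow_mem: "i < n \<Longrightarrow> j < n \<Longrightarrow> b \<in> blacks \<Longrightarrow> (rot i j ^^ k) b \<in> blacks"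
  by (induction k) (auto intro: rot_mem)

lemma rot_orbit: "i < n \<Longrightarrow> v \<in> blacks \<Longrightarrow> w \<in> blacks \<Longrightarrow> \<exists>k. (rot i (Suc i mod n) ^^ k) v = w"
  unfolding rot_def blacks_def using orbit by blast

lemma rot_bij:
  assumes "i < n" "b \<in> blacks"
  shows "bij_betw (\<lambda>k. (rot i (Suc i mod n) ^^ k) b) {..<card blacks} blacks"
    and "(rot i (Suc i mod n) ^^ card blacks) b = b"
proof -
  have *: "rot i (Suc i mod n) ` blacks \<subseteq> blacks" using assms(1) rot_mem Suc_mod_less by auto
  note ** = rot_orbit[OF assms(1)]
  show "bij_betw (\<lambda>k. (rot i (Suc i mod n) ^^ k) b) {..<card blacks} blacks"
    by (rule single_orbit(1)[OF finite_blacks * ** assms(2)])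
  show "(rot i (Suc i mod n) ^^ card blacks) b = b"
    by (rule single_orbit(2)[OF finite_blacks * ** assms(2)])
qed

lemma rot_inverse: "i < n \<Longrightarrow> j < n \<Longrightarrow> b \<in> blacks \<Longrightarrow> rot j i (rot i j b) = b"
  by (simp add: rot_apply blacks_def mem invol)

lemma rot_inverse_funpow:
  assumes "i < n" "j < n" "b \<in> blacks"
  shows "(rot j i ^^ k) ((rot i j ^^ k) b) = b"
proof (induction k)
  case (Suc k)
  have "(rot j i ^^ Suc k) ((rot i j ^^ Suc k) b) = (rot j i ^^ k) (rot j i (rot i j ((rot i j ^^ k) b)))"
    unfolding funpow_Suc_right[of k "rot j i"] by simp
  then show ?case using rot_inverse[OF assms(1,2) rot_funpow_mem[OF assms]] Suc by simp
qed simp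

text \<open>Exchanging the two matchings inverts the rotation, and a finite walk can be read
  backwards.\<close>

lemma rot_reverse_orbit:
  assumes "i < n" "v \<in> blacks" "w \<in> blacks"
  shows "\<exists>k. (rot (Suc i mod n) i ^^ k) v = w"
proof -
  obtain k where "(rot i (Suc i mod n) ^^ k) w = v" using rot_orbit assms by blast
  then show ?thesis using rot_inverse_funpow[OF assms(1) Suc_mod_less assms(3), of k] by metis
qed

text \<open>Distinct matchings disagree at every vertex, so a double step moves \<open>b\<close>.
  This guarantees face cycles of length at least four.\<close>

lemma card_blacks_ge_2: "card blacks \<ge> 2"
proof -
  obtain b where b: "b \<in> blacks" using ex_black by blast
  have "\<mu> 1 (\<mu> 0 b) \<in> blacks" using rot_mem[of 0 1 b] b n2 by (auto simp: rot_apply)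
  moreover have "\<mu> 1 (\<mu> 0 b) \<noteq> b"
  proof
    assume "\<mu> 1 (\<mu> 0 b) = b"
    then have "\<mu> 0 (\<mu> 0 b) = \<mu> 1 (\<mu> 0 b)" using invol[of 0 b] b n2 by (simp add: blacks_def)
    then show False using proper[of 0 1 "\<mu> 0 b"] mem[of 0 b] b n2 by (simp add: blacks_def)
  qed
  ultimately have "card {b, \<mu> 1 (\<mu> 0 b)} = 2" "{b, \<mu> 1 (\<mu> 0 b)} \<subseteq> blacks" using b by auto
  then show ?thesis using card_mono[OF finite_blacks] by metis
qed

text \<open>Serves to carry a factorization from pairs of vertices to the vertices of the doubled
  hypercube.\<close>

lemma transport:
  assumes f: "bij_betw f V W"
  shows "cyclic_factorization W (black \<circ> inv_into V f) (\<lambda>i. f \<circ> \<mu> i \<circ> inv_into V f) n"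
proof -
  let ?g = "inv_into V f"
  have inj: "inj_on f V" and im: "f ` V = W" using f by (auto simp: bij_betw_def)
  have gm: "?g w \<in> V" and fg: "f (?g w) = w" if "w \<in> W" for w
    using that im by (auto intro: inv_into_into f_inv_into_f)
  have gf: "?g (f v) = v" if "v \<in> V" for v using that inj by simp
  have fm: "f v \<in> W" if "v \<in> V" for v using that im by auto
  show ?thesis
  proof
    show "n \<ge> 2" by (rule n2)
    show "finite W" "W \<noteq> {}" using im fin nonempty by auto
    show "i = j" if "i < n" "j < n" "w \<in> W" "(f \<circ> \<mu> i \<circ> ?g) w = (f \<circ> \<mu> j \<circ> ?g) w" for i j w
    proof -
      have "\<mu> i (?g w) = \<mu> j (?g w)" using that inj gm mem by (auto simp: inj_on_def)
      then show ?thesis using proper that gm by blast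
    qed
    show "\<exists>k. ((f \<circ> \<mu> (Suc i mod n) \<circ> ?g \<circ> (f \<circ> \<mu> i \<circ> ?g)) ^^ k) v = w"
      if i: "i < n" and v: "v \<in> W" "(black \<circ> ?g) v" and w: "w \<in> W" "(black \<circ> ?g) w" for i v w
    proof -
      define F where "F = f \<circ> \<mu> (Suc i mod n) \<circ> ?g \<circ> (f \<circ> \<mu> i \<circ> ?g)"
      have F: "F u = f (\<mu> (Suc i mod n) (?g (f (\<mu> i (?g u)))))" for u by (simp add: F_def)
      have b: "?g v \<in> blacks" "?g w \<in> blacks" using v w gm by (auto simp: blacks_def)
      obtain k where k: "(rot i (Suc i mod n) ^^ k) (?g v) = ?g w" using rot_orbit[OF i b] by blast
      have "(F ^^ k) v = f ((rot i (Suc i mod n) ^^ k) (?g v))" for k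
      proof (induction k)
        case (Suc k)
        have "(rot i (Suc i mod n) ^^ k) (?g v) \<in> V"
          using rot_funpow_mem[OF i Suc_mod_less b(1)] by (auto simp: blacks_def)
        then have "F (f ((rot i (Suc i mod n) ^^ k) (?g v))) = f (rot i (Suc i mod n) ((rot i (Suc i mod n) ^^ k) (?g v)))"
          unfolding F rot_apply using i Suc_mod_less by (simp add: gf mem)
        then show ?case using Suc by simp
      qed (use v fg in auto)
      then have "(F ^^ k) v = w" using k w fg by simp
      then show ?thesis unfolding F_def by blast
    qed
  qed (use gm fg gf fm mem invol colour in auto)
qed

end

section \<open>The square of a factorization\<close>

text \<open>The row \<open>y\<^sub>0\<close> breaks the symmetry: along it \<open>row_match i\<close> uses the other matching of the
  pair \<open>\<mu> i\<close>, \<open>\<mu> (Suc i mod n)\<close>, which turns the family of closed staircases formed by a row and a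
  column matching into one spiral.\<close>

locale factorization_square = cyclic_factorization +
  fixes y0 :: 'a
  assumes y0: "y0 \<in> blacks"
begin

definition row_match :: "nat \<Rightarrow> 'a \<times> 'a \<Rightarrow> 'a \<times> 'a" where
  "row_match i = (\<lambda>(x, y). (\<mu> (if black y \<and> y \<noteq> y0 then i else Suc i mod n) x, y))"

text \<open>The matching depends on the colour of the fixed coordinate, which changes with every row
  move. Successive column moves thus alternate between two consecutive matchings and progress along
  a Hamiltonian cycle instead of going back and forth.\<close>

definition col_match :: "nat \<Rightarrow> 'a \<times> 'a \<Rightarrow> 'a \<times> 'a" where
  "col_match j = (\<lambda>(x, y). (x, \<mu> (if black x then j else Suc j mod n) y))"

definition sq_black :: "'a \<times> 'a \<Rightarrow> bool" where
  "sq_black = (\<lambda>(x, y). black x = black y)"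

definition sq_match :: "nat \<Rightarrow> 'a \<times> 'a \<Rightarrow> 'a \<times> 'a" where
  "sq_match k = (if even k then row_match (k div 2) else col_match (k div 2))"

context
  fixes i j assumes ij: "i < n" "j < n"
begin

definition step where "step = col_match j \<circ> row_match i"
definition r where "r = rot i (Suc i mod n)"
definition s where "s = rot (Suc j mod n) j"

definition reach where "reach p p' \<longleftrightarrow> (\<exists>k. (step ^^ k) p = p')"

lemma reach_refl: "reach p p" unfolding reach_def by (intro exI[of _ 0]) simp

lemma reach_trans: assumes "reach p p'" "reach p' p''" shows "reach p p''"
proof -
  obtain k l where "(step ^^ k) p = p'" "(step ^^ l) p' = p''" using assms by (auto simp: reach_def)
  then have "(step ^^ (l + k)) p = p''" by (simp add: funpow_add)
  then show ?thesis unfolding reach_def by blast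
qed

lemma reach_step: "reach p (step p)" unfolding reach_def by (intro exI[of _ 1]) simp

text \<open>Starting from two black coordinates, the row moves use \<open>i\<close> and, in the
  white row reached next, \<open>Suc i mod n\<close>; the column moves use
  \<open>Suc j mod n\<close> and then \<open>j\<close>. In the row \<open>y0\<close> both row moves
  use \<open>Suc i mod n\<close> and cancel.\<close>

lemma double_step:
  assumes "x \<in> blacks" "y \<in> blacks"
  shows "step (step (x, y)) = (if y = y0 then x else r x, s y)"
  using assms ij Suc_mod_less y0
  by (auto simp: step_def r_def s_def rot_apply row_match_def col_match_def blacks_def mem colour invol)

lemma reach_double: "x \<in> blacks \<Longrightarrow> y \<in> blacks \<Longrightarrow> reach (x, y) (if y = y0 then x else r x, s y)"
  using reach_trans[OF reach_step reach_step, of "(x, y)"] double_step by metis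

lemma r_mem: "x \<in> blacks \<Longrightarrow> (r ^^ k) x \<in> blacks"
  and s_mem: "x \<in> blacks \<Longrightarrow> (s ^^ k) x \<in> blacks"
  unfolding r_def s_def using rot_funpow_mem ij Suc_mod_less by blast+

lemma s_bij:
  assumes "y \<in> blacks"
  shows "bij_betw (\<lambda>k. (s ^^ k) y) {..<card blacks} blacks" "(s ^^ card blacks) y = y"
proof -
  have *: "s ` blacks \<subseteq> blacks" using s_mem[of _ 1] by auto
  have **: "\<exists>k. (s ^^ k) x = z" if "x \<in> blacks" "z \<in> blacks" for x z
    unfolding s_def by (rule rot_reverse_orbit[OF ij(2) that])
  show "bij_betw (\<lambda>k. (s ^^ k) y) {..<card blacks} blacks"
    by (rule single_orbit(1)[OF finite_blacks * ** assms])
  show "(s ^^ card blacks) y = y"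
    by (rule single_orbit(2)[OF finite_blacks * ** assms])
qed

lemma s_ne:
  assumes "0 < k" "k < card blacks" shows "(s ^^ k) y0 \<noteq> y0"
proof
  assume "(s ^^ k) y0 = y0"
  then have "k = 0"
    using inj_onD[OF bij_betw_imp_inj_on[OF s_bij(1)[OF y0]], of k 0] assms by auto
  then show False using assms by simp
qed

text \<open>The double step made in the row \<open>y0\<close> leaves \<open>x\<close> alone, and the
  following \<open>k\<close> each apply \<open>r\<close>, since \<open>s\<close> brings the walk
  back to \<open>y0\<close> only after \<open>card blacks\<close> double steps.\<close>

lemma reach_row: "x \<in> blacks \<Longrightarrow> k < card blacks \<Longrightarrow> reach (x, y0) ((r ^^ k) x, (s ^^ Suc k) y0)"
proof (induction k)
  case 0
  then show ?case using reach_double[OF _ y0, of x] by simp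
next
  case (Suc k)
  have "reach ((r ^^ k) x, (s ^^ Suc k) y0) (if (s ^^ Suc k) y0 = y0 then (r ^^ k) x else r ((r ^^ k) x), s ((s ^^ Suc k) y0))"
    by (rule reach_double[OF r_mem s_mem]) (use Suc.prems y0 in auto)
  moreover have "(s ^^ Suc k) y0 \<noteq> y0" using s_ne[of "Suc k"] Suc.prems by simp
  ultimately have "reach ((r ^^ k) x, (s ^^ Suc k) y0) ((r ^^ Suc k) x, (s ^^ Suc (Suc k)) y0)" by simp
  moreover have "reach (x, y0) ((r ^^ k) x, (s ^^ Suc k) y0)" using Suc by simp
  ultimately show ?case using reach_trans by blast
qed

text \<open>A round of \<open>card blacks\<close> double steps applies \<open>r\<close> once less
  than its period, so it acts as the inverse of \<open>r\<close>. This is the effect for which the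
  row \<open>y0\<close> was singled out.\<close>

lemma reach_back:
  assumes x: "x \<in> blacks" shows "reach (r x, y0) (x, y0)"
proof -
  obtain c where c: "card blacks = Suc c" using card_blacks_ge_2 by (cases "card blacks") auto
  have "reach (r x, y0) ((r ^^ c) (r x), (s ^^ card blacks) y0)"
    using reach_row[OF r_mem[OF x, of 1], of c] c by simp
  moreover have "(r ^^ c) (r x) = (r ^^ card blacks) x"
    unfolding c funpow_Suc_right by simp
  moreover have "(r ^^ card blacks) x = x" unfolding r_def by (rule rot_bij(2)[OF ij(1) x])
  ultimately show ?thesis using s_bij(2)[OF y0] by simp
qed

lemma reach_same_row:
  assumes x: "x \<in> blacks" "x' \<in> blacks" shows "reach (x, y0) (x', y0)"
proof -
  obtain k where k: "(r ^^ k) x' = x" unfolding r_def using rot_orbit[OF ij(1) x(2,1)] by blast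
  have "reach ((r ^^ k) x', y0) (x', y0)" for k
  proof (induction k)
    case (Suc k)
    have "reach ((r ^^ Suc k) x', y0) ((r ^^ k) x', y0)"
      using reach_back[OF r_mem[OF x(2)], of k] by simp
    then show ?case using Suc reach_trans by blast
  qed (simp add: reach_refl)
  then show ?thesis using k by blast
qed

text \<open>Within the row \<open>y0\<close> the walk can reach any black \<open>x''\<close>; it is
  chosen so that the shifts by \<open>r\<close> collected on the way up to \<open>y\<close> end in
  \<open>x'\<close>.\<close>

lemma reach_from_row:
  assumes x: "x \<in> blacks" "x' \<in> blacks" and y: "y \<in> blacks" shows "reach (x, y0) (x', y)"
proof -
  have "s y0 \<in> blacks" using s_mem[OF y0, of 1] by simp
  then have "y \<in> (\<lambda>k. (s ^^ k) (s y0)) ` {..<card blacks}"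
    using bij_betw_imp_surj_on[OF s_bij(1)] y by blast
  then obtain k where k: "k < card blacks" "(s ^^ k) (s y0) = y" by auto
  define x'' where "x'' = (rot (Suc i mod n) i ^^ k) x'"
  have x'': "x'' \<in> blacks" "(r ^^ k) x'' = x'"
    using rot_funpow_mem[OF Suc_mod_less ij(1) x(2)] rot_inverse_funpow[OF Suc_mod_less ij(1) x(2)]
    by (auto simp: x''_def r_def)
  have "(s ^^ Suc k) y0 = y" using k unfolding funpow_Suc_right by simp
  then have "reach (x'', y0) (x', y)" using reach_row[OF x''(1) k(1)] x'' by simp
  then show ?thesis using reach_same_row[OF x(1) x''(1)] reach_trans by blast
qed

lemma reach_to_row:
  assumes x: "x \<in> blacks" and y: "y \<in> blacks" shows "\<exists>x'\<in>blacks. reach (x, y) (x', y0)"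
proof -
  obtain k where k: "(s ^^ k) y = y0" unfolding s_def using rot_reverse_orbit[OF ij(2) y y0] by blast
  have "\<exists>x'\<in>blacks. reach (x, y) (x', (s ^^ k) y)" for k
  proof (induction k)
    case 0 then show ?case using x reach_refl by auto
  next
    case (Suc k)
    then obtain x' where x': "x' \<in> blacks" "reach (x, y) (x', (s ^^ k) y)" by blast
    define x'' where "x'' = (if (s ^^ k) y = y0 then x' else r x')"
    have "x'' \<in> blacks" using x'(1) r_mem[OF x'(1), of 1] by (simp add: x''_def)
    moreover have "reach (x, y) (x'', (s ^^ Suc k) y)"
      using reach_trans[OF x'(2) reach_double[OF x'(1) s_mem[OF y]]] by (simp add: x''_def)
    ultimately show ?case by blast
  qed
  then show ?thesis using k by metis
qed

text \<open>The colour class also contains pairs of two white vertices. Each of these is one step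
  away from a pair of black ones, both forwards and backwards.\<close>

lemma reach_blacks:
  assumes p: "p \<in> V \<times> V" "sq_black p"
  shows "\<exists>x\<in>blacks. \<exists>y\<in>blacks. reach (x, y) p" "\<exists>x\<in>blacks. \<exists>y\<in>blacks. reach p (x, y)"
proof -
  obtain x y where xy: "p = (x, y)" "x \<in> V" "y \<in> V" "black x = black y" using p by (auto simp: sq_black_def)
  show "\<exists>x\<in>blacks. \<exists>y\<in>blacks. reach (x, y) p"
  proof (cases "black x")
    case True then show ?thesis using xy reach_refl by (auto simp: blacks_def)
  next
    case False
    define y' where "y' = \<mu> (Suc j mod n) y"
    define x' where "x' = \<mu> (if y' = y0 then Suc i mod n else i) x"
    have b: "x' \<in> blacks" "y' \<in> blacks" "\<mu> (Suc j mod n) y' = y"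
      using False xy ij Suc_mod_less by (auto simp: x'_def y'_def blacks_def mem colour invol)
    then have "step (x', y') = p"
      using False xy ij Suc_mod_less
      by (auto simp: step_def row_match_def col_match_def blacks_def x'_def mem colour invol)
    then show ?thesis using reach_step b by metis
  qed
  show "\<exists>x\<in>blacks. \<exists>y\<in>blacks. reach p (x, y)"
  proof (cases "black x")
    case True then show ?thesis using xy reach_refl by (auto simp: blacks_def)
  next
    case False
    have "step p = (\<mu> (Suc i mod n) x, \<mu> j y)"
      using False xy ij Suc_mod_less y0 by (auto simp: step_def row_match_def col_match_def colour)
    moreover have "\<mu> (Suc i mod n) x \<in> blacks" "\<mu> j y \<in> blacks"
      using False xy ij Suc_mod_less by (auto simp: blacks_def mem colour)
    ultimately show ?thesis using reach_step by metis
  qed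
qed

lemma step_orbit:
  assumes "p \<in> V \<times> V" "sq_black p" "p' \<in> V \<times> V" "sq_black p'"
  shows "\<exists>k. (step ^^ k) p = p'"
proof -
  obtain x y where xy: "x \<in> blacks" "y \<in> blacks" "reach p (x, y)" using reach_blacks(2) assms by blast
  obtain u v where uv: "u \<in> blacks" "v \<in> blacks" "reach (u, v) p'" using reach_blacks(1) assms by blast
  obtain x' where x': "x' \<in> blacks" "reach (x, y) (x', y0)" using reach_to_row[OF xy(1,2)] by blast
  have "reach p p'"
    by (rule reach_trans[OF xy(3) reach_trans[OF x'(2) reach_trans[OF reach_from_row[OF x'(1) uv(1,2)] uv(3)]]])
  then show ?thesis by (simp add: reach_def)
qed

text \<open>Both matchings are involutions, so this composition is the inverse of
  \<open>step\<close>. It covers a column matching followed by a row matching.\<close>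

lemma reverse_step_orbit:
  assumes p: "p \<in> V \<times> V" "sq_black p" and p': "p' \<in> V \<times> V" "sq_black p'"
  shows "\<exists>k. ((row_match i \<circ> col_match j) ^^ k) p = p'"
proof -
  define unstep where "unstep = row_match i \<circ> col_match j"
  have *: "unstep (step p) = p \<and> step p \<in> V \<times> V" if "p \<in> V \<times> V" for p
    using that ij Suc_mod_less by (cases p) (auto simp: unstep_def step_def row_match_def col_match_def mem invol)
  obtain k where k: "(step ^^ k) p' = p" using step_orbit p p' by blast
  have m: "(step ^^ k) p' \<in> V \<times> V" for k
    by (induction k) (use p' * in auto)
  have "(unstep ^^ k) ((step ^^ k) p') = p'" for k
  proof (induction k)
    case (Suc k)
    have "(unstep ^^ Suc k) ((step ^^ Suc k) p') = (unstep ^^ k) (unstep (step ((step ^^ k) p')))"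
      unfolding funpow_Suc_right[of k unstep] by simp
    then show ?case using *[OF m[of k]] Suc by simp
  qed simp
  then show ?thesis using k unfolding unstep_def by metis
qed

end

lemma Suc_mod_inj: "i < n \<Longrightarrow> j < n \<Longrightarrow> Suc i mod n = Suc j mod n \<Longrightarrow> i = j"
  by (auto simp: mod_Suc split: if_splits)

lemma Suc_mod_surj: assumes "c < n" obtains i where "i < n" "Suc i mod n = c"
proof (cases c)
  case 0 then show ?thesis using n2 that[of "n - 1"] by simp
next
  case (Suc k) then show ?thesis using assms that[of k] by simp
qed

lemma cyclic_factorization_square: "cyclic_factorization (V \<times> V) sq_black sq_match (2 * n)"
proof
  show "2 \<le> 2 * n" using n2 by simp
  show "finite (V \<times> V)" "V \<times> V \<noteq> {}" using fin nonempty by auto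
  fix i p assume i: "i < 2 * n" and p: "p \<in> V \<times> V"
  have i2: "i div 2 < n" using i by simp
  obtain x y where xy: "p = (x, y)" "x \<in> V" "y \<in> V" using p by blast
  show "sq_match i p \<in> V \<times> V" "sq_match i (sq_match i p) = p" "sq_black (sq_match i p) = (\<not> sq_black p)"
    using i2 xy Suc_mod_less
    by (auto simp: sq_match_def row_match_def col_match_def sq_black_def mem invol colour)
  {
    fix j assume j: "j < 2 * n" and eq: "sq_match i p = sq_match j p"
    have j2: "j div 2 < n" using j by simp
    have ne: "\<mu> c v \<noteq> v" if "c < n" "v \<in> V" for c v using colour[OF that] by auto
    show "i = j"
    proof (cases "even i"; cases "even j")
      assume e: "even i" "even j"
      \<comment> \<open>The matching of the factor that is used in this row; as a function of
        \<open>k\<close> it is the identity or the cyclic shift, hence injective.\<close>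
      define c where "c k = (if black y \<and> y \<noteq> y0 then k else Suc k mod n)" for k
      have "\<mu> (c (i div 2)) x = \<mu> (c (j div 2)) x"
        using eq e xy by (simp add: sq_match_def row_match_def c_def)
      then have "c (i div 2) = c (j div 2)"
        using proper[OF _ _ xy(2)] i2 j2 Suc_mod_less by (simp add: c_def)
      then have "i div 2 = j div 2" using Suc_mod_inj[OF i2 j2] by (simp add: c_def split: if_splits)
      then show ?thesis using e by (metis dvd_mult_div_cancel)
    next
      assume e: "odd i" "odd j"
      define c where "c k = (if black x then k else Suc k mod n)" for k
      have "\<mu> (c (i div 2)) y = \<mu> (c (j div 2)) y"
        using eq e xy by (simp add: sq_match_def col_match_def c_def)
      then have "c (i div 2) = c (j div 2)"
        using proper[OF _ _ xy(3)] i2 j2 Suc_mod_less by (simp add: c_def)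
      then have "i div 2 = j div 2" using Suc_mod_inj[OF i2 j2] by (simp add: c_def split: if_splits)
      then show ?thesis using e by (metis odd_two_times_div_two_succ)
    next
      assume e: "even i" "odd j"
      then have "fst (sq_match i p) \<noteq> fst (sq_match j p)"
        using xy i2 Suc_mod_less ne by (simp add: sq_match_def row_match_def col_match_def)
      then show ?thesis using eq by simp
    next
      assume e: "odd i" "even j"
      then have "fst (sq_match i p) \<noteq> fst (sq_match j p)"
        using xy j2 Suc_mod_less ne[THEN not_sym] by (simp add: sq_match_def row_match_def col_match_def)
      then show ?thesis using eq by simp
    qed
  next
    fix p' assume b: "sq_black p" and p': "p' \<in> V \<times> V" "sq_black p'"
    \<comment> \<open>The successor of a column matching is the row matching with the cyclically
      next index, including the wrap from \<open>2 * n - 1\<close> to \<open>0\<close>.\<close>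
    have "Suc i mod (2 * n) div 2 = Suc (i div 2) mod n" if "odd i"
      using that i by (auto simp: mod_Suc elim!: oddE)
    moreover have "even (Suc i mod (2 * n)) = even (Suc i)" by (simp add: dvd_mod_iff)
    moreover have "Suc i mod (2 * n) = Suc i" if "even i" using that i by (auto elim!: evenE)
    ultimately show "\<exists>k. ((sq_match (Suc i mod (2 * n)) \<circ> sq_match i) ^^ k) p = p'"
      using step_orbit[OF i2 i2 p b p', unfolded step_def[OF i2 i2]] reverse_step_orbit[OF Suc_mod_less i2 p b p', of "i div 2"]
      by (cases "even i") (auto simp: sq_match_def)
  }
qed

text \<open>In a fixed row the index is either kept or cyclically shifted. Both are permutations of
  the colours, so every edge of the row is used; the same holds for columns.\<close>

lemma edges_square:
  assumes "p \<in> V \<times> V" "p' \<in> V \<times> V"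
  shows "(\<exists>k<2 * n. p' = sq_match k p) \<longleftrightarrow>
    (\<exists>c<n. p' = (\<mu> c (fst p), snd p)) \<or> (\<exists>c<n. p' = (fst p, \<mu> c (snd p)))" (is "?L \<longleftrightarrow> ?R")
proof
  assume ?L
  then obtain k where "k < 2 * n" "p' = sq_match k p" by blast
  define a where "a = (if black (snd p) \<and> snd p \<noteq> y0 then k div 2 else Suc (k div 2) mod n)"
  define b where "b = (if black (fst p) then k div 2 else Suc (k div 2) mod n)"
  have "k div 2 < n" using \<open>k < 2 * n\<close> by simp
  then have "a < n" "b < n" using Suc_mod_less by (auto simp: a_def b_def)
  moreover have "p' = (\<mu> a (fst p), snd p) \<or> p' = (fst p, \<mu> b (snd p))"
    using \<open>p' = sq_match k p\<close>
    by (simp add: sq_match_def row_match_def col_match_def a_def b_def case_prod_beta split: if_splits)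
  ultimately show ?R by blast
next
  have ex: "\<exists>k<n. c = (if P then k else Suc k mod n)" if c: "c < n" for c P
  proof (cases P)
    case True then show ?thesis using c by auto
  next
    case False
    obtain k where "k < n" "Suc k mod n = c" using Suc_mod_surj[OF c] .
    then show ?thesis using False by auto
  qed
  assume ?R
  then show ?L
  proof (elim disjE exE conjE)
    fix c assume c: "c < n" "p' = (\<mu> c (fst p), snd p)"
    obtain k where "k < n" "c = (if black (snd p) \<and> snd p \<noteq> y0 then k else Suc k mod n)" using ex[OF c(1)] by blast
    then show ?L using c by (intro exI[of _ "2 * k"]) (auto simp: sq_match_def row_match_def split: prod.splits)
  next
    fix c assume c: "c < n" "p' = (fst p, \<mu> c (snd p))"
    obtain k where "k < n" "c = (if black (fst p) then k else Suc k mod n)" using ex[OF c(1)] by blast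
    then show ?L using c by (intro exI[of _ "2 * k + 1"]) (auto simp: sq_match_def col_match_def split: prod.splits)
  qed
qed

end

section \<open>Positions on the Hamiltonian cycles\<close>

context cyclic_factorization
begin

abbreviation M :: nat where "M \<equiv> card blacks"

definition base :: 'v where "base = (SOME b. b \<in> blacks)"

lemma base: "base \<in> blacks" unfolding base_def using ex_black by (rule someI_ex)

text \<open>Position \<open>q\<close> on the Hamiltonian cycle formed by the matchings \<open>i\<close> and \<open>Suc i mod n\<close>;
  black vertices have odd positions, and the matching \<open>i\<close> leads from a black vertex to the next
  position.\<close>

definition cyc_vertex :: "nat \<Rightarrow> nat \<Rightarrow> 'v" where
  "cyc_vertex i q = (let b = (rot i (Suc i mod n) ^^ (q div 2)) base
     in if odd q then b else \<mu> (Suc i mod n) b)"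

definition pos :: "nat \<Rightarrow> 'v \<Rightarrow> nat" where
  "pos i v = inv_into {..<2 * M} (cyc_vertex i) v"

lemma cyc_vertex_mem: "i < n \<Longrightarrow> cyc_vertex i q \<in> V \<and> black (cyc_vertex i q) = odd q"
  using rot_funpow_mem[OF _ Suc_mod_less base, of i "q div 2" i] Suc_mod_less[of i]
  by (auto simp: cyc_vertex_def Let_def blacks_def mem colour)

lemma cyc_vertex_bij:
  assumes i: "i < n" shows "bij_betw (cyc_vertex i) {..<2 * M} V"
  unfolding bij_betw_def
proof
  let ?j = "Suc i mod n" and ?b = "\<lambda>k. (rot i (Suc i mod n) ^^ k) base"
  have b: "?b k \<in> V" "black (?b k)" for k
    using rot_funpow_mem[OF i Suc_mod_less base, of k i] by (auto simp: blacks_def)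
  have bij: "bij_betw ?b {..<M} blacks" by (rule rot_bij(1)[OF i base])
  show "inj_on (cyc_vertex i) {..<2 * M}"
  proof (rule inj_onI)
    fix q q' assume q: "q \<in> {..<2 * M}" "q' \<in> {..<2 * M}" and eq: "cyc_vertex i q = cyc_vertex i q'"
    have par: "even q = even q'"
      using cyc_vertex_mem[OF i, of q] cyc_vertex_mem[OF i, of q'] unfolding eq by auto
    have "?b (q div 2) = ?b (q' div 2)"
    proof (cases "even q")
      case True
      then have "\<mu> ?j (?b (q div 2)) = \<mu> ?j (?b (q' div 2))" using eq par by (simp add: cyc_vertex_def)
      then show ?thesis using invol[OF Suc_mod_less b(1)] by metis
    next
      case False then show ?thesis using eq par by (simp add: cyc_vertex_def)
    qed
    then have "q div 2 = q' div 2"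
      using inj_onD[OF bij_betw_imp_inj_on[OF bij], of "q div 2" "q' div 2"] q by auto
    then show "q = q'" using par by (metis dvd_mult_div_cancel odd_two_times_div_two_succ)
  qed
  show "cyc_vertex i ` {..<2 * M} = V"
  proof (intro equalityI subsetI)
    fix v assume v: "v \<in> V"
    define b' where "b' = (if black v then v else \<mu> ?j v)"
    have "b' \<in> blacks" using v Suc_mod_less by (auto simp: b'_def blacks_def mem colour)
    then have "b' \<in> ?b ` {..<M}" using bij_betw_imp_surj_on[OF bij] by simp
    then obtain k where k: "k < M" "?b k = b'" by blast
    have "cyc_vertex i (if black v then 2 * k + 1 else 2 * k) = v"
      using k(2) invol[OF Suc_mod_less v] by (auto simp: cyc_vertex_def b'_def)
    moreover have "(if black v then 2 * k + 1 else 2 * k) \<in> {..<2 * M}" using k by auto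
    ultimately show "v \<in> cyc_vertex i ` {..<2 * M}" by (rule image_eqI[OF sym])
  qed (use cyc_vertex_mem[OF i] in auto)
qed

lemma pos_less: "i < n \<Longrightarrow> v \<in> V \<Longrightarrow> pos i v < 2 * M"
  unfolding pos_def using inv_into_into[of v "cyc_vertex i" "{..<2 * M}"] cyc_vertex_bij[of i]
  by (auto simp: bij_betw_def)

lemma cyc_vertex_pos: "i < n \<Longrightarrow> v \<in> V \<Longrightarrow> cyc_vertex i (pos i v) = v"
  unfolding pos_def by (rule f_inv_into_f) (simp add: bij_betw_imp_surj_on[OF cyc_vertex_bij])

lemma pos_cyc_vertex: "i < n \<Longrightarrow> q < 2 * M \<Longrightarrow> pos i (cyc_vertex i q) = q"
  unfolding pos_def using cyc_vertex_bij[of i] by (auto simp: bij_betw_def)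

lemma pos_inj: "i < n \<Longrightarrow> v \<in> V \<Longrightarrow> w \<in> V \<Longrightarrow> pos i v = pos i w \<Longrightarrow> v = w"
  using cyc_vertex_pos by metis

lemma odd_pos: "i < n \<Longrightarrow> v \<in> V \<Longrightarrow> odd (pos i v) = black v"
  using cyc_vertex_mem[of i "pos i v"] cyc_vertex_pos[of i v] by simp

text \<open>Inside a pair of positions the step undoes the matching \<open>Suc i mod n\<close> in
  the definition; between pairs that matching cancels against the one in the rotation and leaves
  \<open>i\<close>. The cycle closes because the rotation has period \<open>M\<close>.\<close>

lemma cyc_vertex_next:
  assumes i: "i < n" and q: "q < 2 * M"
  shows "cyc_vertex i (Suc q mod (2 * M)) = (if odd q then \<mu> i (cyc_vertex i q) else \<mu> (Suc i mod n) (cyc_vertex i q))"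
proof -
  let ?j = "Suc i mod n" and ?b = "\<lambda>k. (rot i (Suc i mod n) ^^ k) base"
  have b: "?b k \<in> V" for k
    using rot_funpow_mem[OF i Suc_mod_less base, of k i] by (auto simp: blacks_def)
  show ?thesis
  proof (cases "odd q")
    case False
    then obtain k where "q = 2 * k" by blast
    then have "Suc q mod (2 * M) = Suc (2 * k)" using q by auto
    then show ?thesis using False \<open>q = 2 * k\<close> b invol[OF Suc_mod_less, of "?b k" i] by (simp add: cyc_vertex_def)
  next
    case True
    then obtain k where k: "q = 2 * k + 1" by (rule oddE)
    have "?b (Suc k mod M) = ?b (Suc k)"
      by (rule funpow_mod_eq[OF rot_bij(2)[OF i base]])
    moreover have "Suc q mod (2 * M) = 2 * (Suc k mod M)"
      using mult_mod_right[of 2 "Suc k" M] unfolding k by simp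
    moreover have "\<mu> ?j (?b (Suc k)) = \<mu> i (?b k)"
      using invol[OF Suc_mod_less mem[OF i b], of i k] rot_apply[of i ?j "?b k"] by simp
    ultimately show ?thesis using True k by (simp add: cyc_vertex_def)
  qed
qed

text \<open>The interface to the root branches: the two matchings lead from a black vertex to the
  two neighbouring positions. The second equation needs no reduction because black positions are
  odd, hence positive.\<close>

lemma pos_match:
  assumes i: "i < n" and b: "b \<in> blacks"
  shows "pos i (\<mu> i b) = Suc (pos i b) mod (2 * M)" and "Suc (pos i (\<mu> (Suc i mod n) b)) = pos i b"
proof -
  have bV: "b \<in> V" "black b" using b by (auto simp: blacks_def)
  have M: "0 < M" using card_blacks_ge_2 by simp
  have p: "pos i b < 2 * M" "odd (pos i b)" "cyc_vertex i (pos i b) = b"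
    using pos_less[OF i] odd_pos[OF i] cyc_vertex_pos[OF i] bV by auto
  have "cyc_vertex i (Suc (pos i b) mod (2 * M)) = \<mu> i b" using cyc_vertex_next[OF i p(1)] p by simp
  then show "pos i (\<mu> i b) = Suc (pos i b) mod (2 * M)"
    using pos_cyc_vertex[OF i, of "Suc (pos i b) mod (2 * M)"] M by simp
  obtain q where q: "pos i b = Suc q" "even q" using p(2) by (cases "pos i b") auto
  have "cyc_vertex i (Suc q mod (2 * M)) = \<mu> (Suc i mod n) (cyc_vertex i q)"
    using cyc_vertex_next[OF i, of q] q p(1) by simp
  then have "b = \<mu> (Suc i mod n) (cyc_vertex i q)" using q p(1,3) by simp
  then have "\<mu> (Suc i mod n) b = cyc_vertex i q"
    using invol[OF Suc_mod_less] cyc_vertex_mem[OF i] by simp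
  then show "Suc (pos i (\<mu> (Suc i mod n) b)) = pos i b"
    using pos_cyc_vertex[OF i, of q] q p(1) by simp
qed

definition face_cycle :: "nat \<Rightarrow> 'v list" where "face_cycle i = map (cyc_vertex i) [0..<2 * M]"

definition face_edges :: "nat \<Rightarrow> 'v set set" where
  "face_edges i = {{v, \<mu> j v} | v j. v \<in> V \<and> j \<in> {i, Suc i mod n}}"

lemma cycle_edges_face_cycle:
  assumes i: "i < n" shows "cycle_edges (face_cycle i) = face_edges i"
proof (intro equalityI subsetI)
  have M: "0 < M" using card_blacks_ge_2 by simp
  have nth: "face_cycle i ! q = cyc_vertex i q" if "q < 2 * M" for q using that by (simp add: face_cycle_def)
  have len: "length (face_cycle i) = 2 * M" by (simp add: face_cycle_def)
  {
    fix e assume "e \<in> cycle_edges (face_cycle i)"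
    then obtain q where "q < 2 * M" "e = {cyc_vertex i q, cyc_vertex i (Suc q mod (2 * M))}"
      using M by (auto simp: cycle_edges_def len nth)
    then show "e \<in> face_edges i"
      using cyc_vertex_next[OF i, of q] cyc_vertex_mem[OF i, of q] unfolding face_edges_def by auto
  next
    fix e assume "e \<in> face_edges i"
    then obtain v j where vj: "v \<in> V" "j \<in> {i, Suc i mod n}" "e = {v, \<mu> j v}" by (auto simp: face_edges_def)
    have j: "j < n" using vj i Suc_mod_less by auto
    define u' where "u' = (if black v then v else \<mu> j v)"
    have u': "u' \<in> V" "black u'" "e = {u', \<mu> j u'}"
      using vj j by (auto simp: u'_def mem colour invol)
    have *: "{cyc_vertex i q, cyc_vertex i (Suc q mod (2 * M))} \<in> cycle_edges (face_cycle i)" if "q < 2 * M" for q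
      using that M unfolding cycle_edges_def len by (auto simp: nth intro!: exI[of _ q])
    show "e \<in> cycle_edges (face_cycle i)"
    proof (cases "j = i")
      case True
      have "cyc_vertex i (Suc (pos i u') mod (2 * M)) = \<mu> i u'"
        using cyc_vertex_next[OF i pos_less[OF i u'(1)]] odd_pos[OF i u'(1)] cyc_vertex_pos[OF i u'(1)] u'(2) by simp
      then show ?thesis using *[OF pos_less[OF i u'(1)]] cyc_vertex_pos[OF i u'(1)] u'(3) True by simp
    next
      case False
      then have jj: "j = Suc i mod n" using vj by simp
      define w where "w = \<mu> j u'"
      have w: "w \<in> V" "\<not> black w" "e = {w, \<mu> j w}" using u' j by (auto simp: w_def mem colour invol)
      have "cyc_vertex i (Suc (pos i w) mod (2 * M)) = \<mu> j w"
        using cyc_vertex_next[OF i pos_less[OF i w(1)]] odd_pos[OF i w(1)] cyc_vertex_pos[OF i w(1)] w(2) jj by simp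
      then show ?thesis using *[OF pos_less[OF i w(1)]] cyc_vertex_pos[OF i w(1)] w(3) by simp
    qed
  }
qed

lemma hamiltonian_face_cycle:
  assumes i: "i < n" shows "hamiltonian_cycle V edges (face_cycle i)" and "set (face_cycle i) = V"
proof -
  have bij: "inj_on (cyc_vertex i) {..<2 * M}" "cyc_vertex i ` {..<2 * M} = V"
    using cyc_vertex_bij[OF i] by (auto simp: bij_betw_def)
  show s: "set (face_cycle i) = V" using bij(2) by (simp add: face_cycle_def lessThan_atLeast0)
  have "distinct (face_cycle i)" using bij(1) by (simp add: face_cycle_def distinct_map lessThan_atLeast0)
  moreover have "length (face_cycle i) \<ge> 3" using card_blacks_ge_2 by (simp add: face_cycle_def)
  moreover have "face_edges i \<subseteq> edges" using i Suc_mod_less unfolding face_edges_def edges_def by blast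
  ultimately show "hamiltonian_cycle V edges (face_cycle i)"
    unfolding hamiltonian_cycle_def cycle_edges_face_cycle[OF i] using s by simp
qed

end

section \<open>Factorizations of hypercubes\<close>

text \<open>Adjacency is expressed as distance one because distances add up when coordinate vectors
  are concatenated.\<close>

definition hamming :: "nat \<Rightarrow> (nat \<Rightarrow> nat) \<Rightarrow> (nat \<Rightarrow> nat) \<Rightarrow> nat" where
  "hamming n x y = card {i. i < n \<and> x i \<noteq> y i}"

lemma hamming_eq_0: "x \<in> hypercube_verts n \<Longrightarrow> y \<in> hypercube_verts n \<Longrightarrow> hamming n x y = 0 \<longleftrightarrow> x = y"
  unfolding hamming_def hypercube_verts_def using PiE_ext[of x "{..<n}" "\<lambda>_. {0, 1}" y] by auto

definition hypercube_factorization :: "nat \<Rightarrow> ((nat \<Rightarrow> nat) \<Rightarrow> bool) \<Rightarrow> (nat \<Rightarrow> (nat \<Rightarrow> nat) \<Rightarrow> nat \<Rightarrow> nat) \<Rightarrow> bool" where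
  "hypercube_factorization n black \<mu> \<longleftrightarrow>
     cyclic_factorization (hypercube_verts n) black \<mu> n \<and>
     (\<forall>x\<in>hypercube_verts n. \<forall>y\<in>hypercube_verts n. hamming n x y = 1 \<longleftrightarrow> (\<exists>i<n. y = \<mu> i x))"

lemma hypercube_edges_eq:
  assumes "hypercube_factorization n black \<mu>"
  shows "hypercube_edges n = cyclic_factorization.edges (hypercube_verts n) \<mu> n"
proof -
  interpret cyclic_factorization "hypercube_verts n" black \<mu> n
    using assms by (simp add: hypercube_factorization_def)
  have *: "hamming n x y = 1 \<longleftrightarrow> (\<exists>i<n. y = \<mu> i x)" if "x \<in> hypercube_verts n" "y \<in> hypercube_verts n" for x y
    using assms that by (simp add: hypercube_factorization_def)
  show ?thesis
  proof (intro equalityI subsetI)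
    fix e assume "e \<in> hypercube_edges n"
    then obtain x y where "e = {x, y}" "x \<in> hypercube_verts n" "y \<in> hypercube_verts n" "hamming n x y = 1"
      by (auto simp: hypercube_edges_def hamming_def)
    then show "e \<in> edges" using *[of x y] unfolding edges_def by blast
  next
    fix e assume "e \<in> edges"
    then obtain x i where e: "e = {x, \<mu> i x}" "x \<in> hypercube_verts n" "i < n" unfolding edges_def by blast
    then have "hamming n x (\<mu> i x) = 1" using * mem by blast
    then show "e \<in> hypercube_edges n" unfolding hypercube_edges_def hamming_def using e mem by blast
  qed
qed

text \<open>The two black vertices of the 4-cycle are opposite, and flipping both coordinates, in
  either order, exchanges them.\<close>

lemma square_factorization: "hypercube_factorization 2 (\<lambda>x. x 0 = x 1) (\<lambda>i x. x(i := 1 - x i))"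
proof -
  have two: "{..<2} = {0, 1::nat}" by auto
  have mem01: "x i = 0 \<or> x i = 1" if "x \<in> hypercube_verts 2" "i < 2" for x i
    using PiE_mem[of x "{..<2}" "\<lambda>_. {0, 1}" i] that by (auto simp: hypercube_verts_def)
  have ext: "x = y" if "x \<in> hypercube_verts 2" "y \<in> hypercube_verts 2" "x 0 = y 0" "x 1 = y 1" for x y
  proof (rule PiE_ext)
    show "x \<in> {..<2} \<rightarrow>\<^sub>E {0, 1}" "y \<in> {..<2} \<rightarrow>\<^sub>E {0, 1}" using that by (auto simp: hypercube_verts_def)
    show "x i = y i" if "i \<in> {..<2}" for i
    proof -
      have "i = 0 \<or> i = 1" using that by auto
      then show ?thesis using \<open>x 0 = y 0\<close> \<open>x 1 = y 1\<close> by (elim disjE) simp_all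
    qed
  qed
  have upd: "x(i := 1 - x i) \<in> hypercube_verts 2" if "x \<in> hypercube_verts 2" "i < 2" for x i
  proof -
    have "x \<in> {..<2} \<rightarrow>\<^sub>E {0, 1}" using that(1) by (simp add: hypercube_verts_def)
    moreover have "1 - x i \<in> {0, 1}" by auto
    ultimately have "x(i := 1 - x i) \<in> insert i {..<2} \<rightarrow>\<^sub>E {0, 1}" by (rule PiE_fun_upd[rotated])
    then show ?thesis using that(2) by (simp add: hypercube_verts_def insert_absorb del: insert_iff)
  qed
  have ham: "hamming 2 x y = (if x 0 \<noteq> y 0 then 1 else 0) + (if x 1 \<noteq> y 1 then 1 else 0)" for x y
  proof -
    have "hamming 2 x y = card {i \<in> {..<2}. x i \<noteq> y i}" by (simp add: hamming_def)
    also have "\<dots> = (\<Sum>i<2. if x i \<noteq> y i then 1 else 0)"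
      unfolding card_eq_sum by (rule sum.inter_filter) simp
    finally show ?thesis unfolding two by simp
  qed
  show ?thesis unfolding hypercube_factorization_def
  proof (intro conjI ballI)
    show "cyclic_factorization (hypercube_verts 2) (\<lambda>x. x 0 = x 1) (\<lambda>i x. x(i := 1 - x i)) 2"
    proof
      show "finite (hypercube_verts 2)" "hypercube_verts 2 \<noteq> {}"
        by (auto simp: hypercube_verts_def finite_PiE PiE_eq_empty_iff)
      fix i x assume i: "i < (2::nat)" and x: "x \<in> hypercube_verts 2"
      show "x(i := 1 - x i) \<in> hypercube_verts 2" by (rule upd[OF x i])
      show "(x(i := 1 - x i))(i := 1 - (x(i := 1 - x i)) i) = x" using mem01[OF x i] by (auto simp: fun_eq_iff)
      show "((x(i := 1 - x i)) 0 = (x(i := 1 - x i)) 1) = (x 0 \<noteq> x 1)"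
        using i mem01[OF x, of 0] mem01[OF x, of 1] by (auto simp: less_2_cases_iff)
      {
        fix j assume "j < (2::nat)" and "x(i := 1 - x i) = x(j := 1 - x j)"
        then have "(x(i := 1 - x i)) i = (x(j := 1 - x j)) i" by simp
        then show "i = j" using mem01[OF x i] by (auto split: if_splits)
      next
        fix w assume b: "x 0 = x 1" and w: "w \<in> hypercube_verts 2" "w 0 = w 1"
        define F where "F = (\<lambda>x. x(Suc i mod 2 := 1 - x (Suc i mod 2))) \<circ> (\<lambda>x::nat\<Rightarrow>nat. x(i := 1 - x i))"
        have "w = x \<or> w = F x"
        proof (cases "w 0 = x 0")
          case True then show ?thesis using ext[OF w(1) x] b w by simp
        next
          case False
          have Fx: "F x \<in> hypercube_verts 2" using upd[OF upd[OF x i], of "Suc i mod 2"] by (simp add: F_def)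
          have "F x 0 = 1 - x 0" "F x 1 = 1 - x 1" using i by (auto simp: F_def less_2_cases_iff)
          then have "w 0 = F x 0" "w 1 = F x 1"
            using False mem01[OF x, of 0] mem01[OF w(1), of 0] b w(2) by auto
          then show ?thesis using ext[OF w(1) Fx] by blast
        qed
        then have "(F ^^ 0) x = w \<or> (F ^^ 1) x = w" by auto
        then show "\<exists>k. (((\<lambda>x. x(Suc i mod 2 := 1 - x (Suc i mod 2))) \<circ> (\<lambda>x. x(i := 1 - x i))) ^^ k) x = w"
          unfolding F_def by blast
      }
    qed simp
    fix x y assume x: "x \<in> hypercube_verts 2" and y: "y \<in> hypercube_verts 2"
    have e: "y = x(i := 1 - x i) \<longleftrightarrow> y 0 = (x(i := 1 - x i)) 0 \<and> y 1 = (x(i := 1 - x i)) 1" if "i < 2" for i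
      using ext[OF y upd[OF x that]] by auto
    have "(\<exists>i<2. y = x(i := 1 - x i)) \<longleftrightarrow> y = x(0 := 1 - x 0) \<or> y = x(1 := 1 - x 1)"
      by (auto simp: less_2_cases_iff)
    also have "\<dots> \<longleftrightarrow> y 0 = 1 - x 0 \<and> y 1 = x 1 \<or> y 0 = x 0 \<and> y 1 = 1 - x 1"
      using e[of 0] e[of 1] by simp
    also have "\<dots> \<longleftrightarrow> hamming 2 x y = 1"
      using mem01[OF x, of 0] mem01[OF x, of 1] mem01[OF y, of 0] mem01[OF y, of 1]
      unfolding ham by auto
    finally show "hamming 2 x y = 1 \<longleftrightarrow> (\<exists>i<2. y = x(i := 1 - x i))" by blast
  qed
qed

definition join :: "nat \<Rightarrow> (nat \<Rightarrow> nat) \<times> (nat \<Rightarrow> nat) \<Rightarrow> nat \<Rightarrow> nat" where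
  "join n = (\<lambda>(x, y) i. if i < n then x i else y (i - n))"

lemma join_bij: "bij_betw (join n) (hypercube_verts n \<times> hypercube_verts n) (hypercube_verts (2 * n))"
  unfolding bij_betw_def
proof
  show "inj_on (join n) (hypercube_verts n \<times> hypercube_verts n)"
  proof (rule inj_onI, clarify)
    fix x y x' y' assume m: "x \<in> hypercube_verts n" "y \<in> hypercube_verts n" "x' \<in> hypercube_verts n" "y' \<in> hypercube_verts n"
      and eq: "join n (x, y) = join n (x', y')"
    have "x i = x' i" if "i < n" for i using fun_cong[OF eq, of i] that by (simp add: join_def)
    moreover have "y i = y' i" for i using fun_cong[OF eq, of "n + i"] by (simp add: join_def)
    ultimately show "x = x' \<and> y = y'" using m by (auto simp: hypercube_verts_def intro: PiE_ext)
  qed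
  show "join n ` (hypercube_verts n \<times> hypercube_verts n) = hypercube_verts (2 * n)"
  proof (intro equalityI subsetI)
    fix z assume z: "z \<in> hypercube_verts (2 * n)"
    \<comment> \<open>A shift is enough for the second half: \<open>z\<close> is
      \<open>undefined\<close> from \<open>2 * n\<close> on, so the shifted function is
      extensional.\<close>
    have "z = join n (restrict z {..<n}, \<lambda>i. z (n + i))" by (auto simp: join_def fun_eq_iff)
    moreover have "restrict z {..<n} \<in> hypercube_verts n" "(\<lambda>i. z (n + i)) \<in> hypercube_verts n"
      using z by (auto simp: hypercube_verts_def PiE_iff extensional_def)
    ultimately show "z \<in> join n ` (hypercube_verts n \<times> hypercube_verts n)" by blast
  next
    fix z assume "z \<in> join n ` (hypercube_verts n \<times> hypercube_verts n)"
    then obtain x y where z: "z = join n (x, y)" and x: "x \<in> hypercube_verts n" and y: "y \<in> hypercube_verts n" by blast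
    show "z \<in> hypercube_verts (2 * n)" unfolding hypercube_verts_def
    proof (rule PiE_I)
      fix i assume i: "i \<in> {..<2 * n}"
      show "z i \<in> {0, 1}"
      proof (cases "i < n")
        case True
        then show ?thesis using PiE_mem[OF x[unfolded hypercube_verts_def], of i] by (simp add: z join_def del: insert_iff)
      next
        case False
        then have "i - n \<in> {..<n}" using i by auto
        then show ?thesis
          using False PiE_mem[OF y[unfolded hypercube_verts_def], of "i - n"] by (simp add: z join_def del: insert_iff)
      qed
    next
      fix i assume "i \<notin> {..<2 * n}"
      then have "\<not> i < n" "i - n \<notin> {..<n}" by auto
      then show "z i = undefined"
        using PiE_arb[OF y[unfolded hypercube_verts_def]] by (simp add: z join_def)
    qed
  qed
qed

lemma hamming_join: "hamming (2 * n) (join n (x, y)) (join n (x', y')) = hamming n x x' + hamming n y y'"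
proof -
  have "{i. i < 2 * n \<and> join n (x, y) i \<noteq> join n (x', y') i}
      = {i. i < n \<and> x i \<noteq> x' i} \<union> (+) n ` {i. i < n \<and> y i \<noteq> y' i}" (is "?S = ?A \<union> ?B")
  proof (intro equalityI subsetI)
    fix i assume i: "i \<in> ?S"
    show "i \<in> ?A \<union> ?B"
    proof (cases "i < n")
      case True then show ?thesis using i by (simp add: join_def)
    next
      case False then show ?thesis using i by (intro UnI2 image_eqI[of _ _ "i - n"]) (auto simp: join_def)
    qed
  qed (auto simp: join_def)
  moreover have "card (?A \<union> ?B) = card ?A + card ?B" by (rule card_Un_disjoint) auto
  moreover have "card ?B = card {i. i < n \<and> y i \<noteq> y' i}" by (rule card_image) simp
  ultimately show ?thesis by (simp add: hamming_def)
qed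

lemma hypercube_factorization_double:
  assumes "hypercube_factorization n black \<mu>"
  shows "\<exists>black \<mu>. hypercube_factorization (2 * n) black \<mu>"
proof -
  interpret cyclic_factorization "hypercube_verts n" black \<mu> n
    using assms by (simp add: hypercube_factorization_def)
  have adj: "hamming n x y = 1 \<longleftrightarrow> (\<exists>i<n. y = \<mu> i x)" if "x \<in> hypercube_verts n" "y \<in> hypercube_verts n" for x y
    using assms that by (simp add: hypercube_factorization_def)
  interpret factorization_square "hypercube_verts n" black \<mu> n base
    by unfold_locales (rule base)
  interpret sq: cyclic_factorization "hypercube_verts n \<times> hypercube_verts n" sq_black sq_match "2 * n"
    by (rule cyclic_factorization_square)
  let ?J = "join n" and ?VV = "hypercube_verts n \<times> hypercube_verts n"
  let ?K = "inv_into ?VV ?J"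
  have K: "?K x \<in> ?VV" "?J (?K x) = x" if "x \<in> hypercube_verts (2 * n)" for x
    using that join_bij[of n] by (auto simp: bij_betw_def inv_into_into f_inv_into_f)
  have "hamming (2 * n) x y = 1 \<longleftrightarrow> (\<exists>k<2 * n. y = (?J \<circ> sq_match k \<circ> ?K) x)"
    if x: "x \<in> hypercube_verts (2 * n)" and y: "y \<in> hypercube_verts (2 * n)" for x y
  proof -
    obtain a b where ab: "?K x = (a, b)" "a \<in> hypercube_verts n" "b \<in> hypercube_verts n" using K[OF x] by auto
    obtain c d where cd: "?K y = (c, d)" "c \<in> hypercube_verts n" "d \<in> hypercube_verts n" using K[OF y] by auto
    have xy: "x = ?J (a, b)" "y = ?J (c, d)" using K(2)[OF x] K(2)[OF y] ab cd by auto
    have "hamming (2 * n) x y = 1 \<longleftrightarrow>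
        hamming n a c = 1 \<and> hamming n b d = 0 \<or> hamming n a c = 0 \<and> hamming n b d = 1"
      unfolding xy hamming_join by auto
    also have "\<dots> \<longleftrightarrow> (\<exists>i<n. (c, d) = (\<mu> i (fst (a, b)), snd (a, b))) \<or> (\<exists>i<n. (c, d) = (fst (a, b), \<mu> i (snd (a, b))))"
      using ab cd by (auto simp: adj[unfolded One_nat_def] hamming_eq_0)
    also have "\<dots> \<longleftrightarrow> (\<exists>k<2 * n. (c, d) = sq_match k (a, b))"
      using edges_square[of "(a, b)" "(c, d)"] ab cd by blast
    also have "\<dots> \<longleftrightarrow> (\<exists>k<2 * n. y = (?J \<circ> sq_match k \<circ> ?K) x)"
    proof -
      have "(c, d) = sq_match k (a, b) \<longleftrightarrow> ?J (c, d) = ?J (sq_match k (a, b))" if "k < 2 * n" for k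
        using inj_on_eq_iff[OF bij_betw_imp_inj_on[OF join_bij], of "(c, d)" n "sq_match k (a, b)"]
          sq.mem[OF that, of "(a, b)"] ab cd by blast
      then show ?thesis using ab(1) xy(2) by auto
    qed
    finally show ?thesis .
  qed
  then have "hypercube_factorization (2 * n) (sq_black \<circ> ?K) (\<lambda>k. ?J \<circ> sq_match k \<circ> ?K)"
    unfolding hypercube_factorization_def using sq.transport[OF join_bij] by blast
  then show ?thesis by blast
qed

lemma hypercube_factorization_exists:
  "\<exists>black \<mu>. hypercube_factorization (2 ^ Suc k) black \<mu>"
proof (induction k)
  case 0 then show ?case using square_factorization by auto
next
  case (Suc k)
  then show ?case using hypercube_factorization_double by (metis power_Suc)
qed

section \<open>Sectors and branches of roots\<close>

text \<open>Angles are measured in units of \<open>2 pi / n\<close>: the edges of colour \<open>j\<close> point in direction \<open>j\<close>,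
  and face \<open>i\<close> is centred on direction \<open>i + 1/2\<close>.\<close>

definition pt :: "nat \<Rightarrow> real \<Rightarrow> real \<Rightarrow> complex" where
  "pt n r x = rcis r (2 * pi * x / n)"

definition Sect :: "nat \<Rightarrow> complex set" where
  "Sect n = {u. 0 < Im (u * cis (pi / n)) \<and> Im (u * cis (- (pi / n))) < 0}"

definition turn :: "nat \<Rightarrow> real \<Rightarrow> complex \<Rightarrow> complex" where
  "turn n x z = z * pt n 1 (- x)"

definition wedge :: "nat \<Rightarrow> real \<Rightarrow> complex set" where
  "wedge n x = {z. turn n x z \<in> Sect n}"

text \<open>The plane cut along the \<open>n\<close> radial half-lines that start at the \<open>n\<close>-th roots of \<open>-1\<close>, which
  are the branch points.\<close>

definition slit :: "nat \<Rightarrow> complex set" where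
  "slit n = {z. \<not> (Im (z ^ n) = 0 \<and> Re (z ^ n) \<le> -1)}"

lemma pt_mult: "pt n r x * pt n s y = pt n (r * s) (x + y)"
  by (simp add: pt_def rcis_mult add_divide_distrib distrib_left)

lemma pt_0 [simp]: "pt n r 0 = of_real r" by (simp add: pt_def)

lemma norm_pt [simp]: "norm (pt n r x) = \<bar>r\<bar>" by (simp add: pt_def)

lemma pt_eq_0 [simp]: "pt n r x = 0 \<longleftrightarrow> r = 0" using norm_pt norm_eq_zero by (metis abs_eq_0)

lemma pt_inverse: "inverse (pt n r x) = pt n (1 / r) (- x)"
  by (simp add: pt_def rcis_inverse)

lemma turn_0 [simp]: "turn n x 0 = 0" by (simp add: turn_def)

lemma turn_pt: "turn n x (pt n r y) = pt n r (y - x)"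
  by (simp add: turn_def pt_mult)

lemma turn_inverse: "pt n 1 x * turn n x z = z"
  using pt_mult[of n 1 x 1 "-x"] by (simp add: turn_def mult.left_commute)

lemma no_int_between: "of_int a < (of_int m :: real) \<Longrightarrow> (of_int m :: real) < of_int (a + 1) \<Longrightarrow> False"
  unfolding of_int_less_iff by simp

context
  fixes n :: nat
  assumes n2: "n \<ge> 2"
begin

lemma pt_power: "pt n r x ^ n = rcis (r ^ n) (2 * pi * x)"
  using n2 by (simp add: pt_def DeMoivre2)

lemma pt_period: fixes x :: real shows "pt n r (x + of_int k * n) = pt n r x"
proof -
  have "2 * pi * (x + of_int k * n) / n = 2 * pi * x / n + 2 * pi * of_int k"
    using n2 by (simp add: field_simps)
  moreover have "cis (2 * pi * of_int k) = 1"
    by (simp add: complex_eq_iff cos_int_2pin sin_int_2pin)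
  ultimately show ?thesis by (simp add: pt_def rcis_def flip: cis_mult)
qed

lemma pt_eq_D:
  fixes x y :: real
  assumes "r > 0" "s > 0" and eq: "pt n r x = pt n s y"
  shows "r = s" and "\<exists>k::int. x = y + of_int k * n"
proof -
  have "\<bar>r\<bar> = \<bar>s\<bar>" using arg_cong[OF eq, of norm] by simp
  then show rs: "r = s" using assms(1,2) by simp
  then have "cis (2 * pi * x / n) = cis (2 * pi * y / n)" using eq assms by (simp add: pt_def rcis_def)
  then have "sin (2 * pi * x / n) = sin (2 * pi * y / n) \<and> cos (2 * pi * x / n) = cos (2 * pi * y / n)"
    by (simp add: complex_eq_iff)
  then obtain k :: int where "2 * pi * x / n = 2 * pi * y / n + 2 * pi * k"
    using sin_cos_eq_iff by blast
  then have "2 * pi * x = 2 * pi * (y + of_int k * n)" using n2 by (simp add: field_simps)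
  then have "x = y + of_int k * n" by simp
  then show "\<exists>k::int. x = y + of_int k * n" by blast
qed

lemma ex_pt:
  assumes "z \<noteq> 0" obtains r x :: real where "r > 0" "0 \<le> x" "x < real n" "z = pt n r x"
proof (rule that)
  show "norm z > 0" using assms by simp
  show "0 \<le> Arg2pi z * n / (2 * pi)" by (simp add: Arg2pi_ge_0)
  have "Arg2pi z * n < 2 * pi * n" using Arg2pi_lt_2pi[of z] n2 by simp
  then show "Arg2pi z * n / (2 * pi) < n" by (simp add: field_simps)
  have "2 * pi * (Arg2pi z * n / (2 * pi)) / n = Arg2pi z" using n2 by simp
  then show "z = pt n (norm z) (Arg2pi z * n / (2 * pi))"
    unfolding pt_def rcis_def using Arg2pi_eq[of z] by (simp add: cis_conv_exp)
qed

lemma Im_pt_pos: "r > 0 \<Longrightarrow> 0 < d \<Longrightarrow> d < 1/2 \<Longrightarrow> 0 < Im (pt n r d)"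
proof -
  assume a: "r > 0" "0 < d" "d < 1/2"
  have "2 * d < real n" using a n2 by linarith
  then have "pi * (2 * d) < pi * real n" by (rule mult_strict_left_mono) simp
  then have "2 * pi * d < pi * n" by simp
  then have "0 < sin (2 * pi * d / n)" using a n2 by (intro sin_gt_zero) (auto simp: field_simps)
  then show ?thesis using a by (simp add: pt_def)
qed

lemma Im_pt_neg: "r > 0 \<Longrightarrow> - (1/2) < d \<Longrightarrow> d < 0 \<Longrightarrow> Im (pt n r d) < 0"
  using Im_pt_pos[of r "- d"] by (simp add: pt_def)

text \<open>The defining pair of linear inequalities yields openness and convexity, the polar form
  serves computations. For \<open>n \<ge> 2\<close> the opening angle is at most \<open>pi\<close>,
  so a sector is an intersection of two half-planes.\<close>

lemma Sect_iff: "u \<in> Sect n \<longleftrightarrow> (\<exists>r>0. \<exists>d. \<bar>d\<bar> < 1/2 \<and> u = pt n r d)"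
proof
  assume u: "u \<in> Sect n"
  then have "u \<noteq> 0" by (auto simp: Sect_def)
  define t where "t = Arg u"
  have t: "- pi < t" "t \<le> pi" using mpi_less_Arg Arg_le_pi by (auto simp: t_def)
  have ueq: "u = rcis (norm u) t"
    using \<open>u \<noteq> 0\<close> Arg_eq by (simp add: t_def rcis_def cis_conv_exp)
  have im: "Im (u * cis a) = norm u * sin (t + a)" for a
    by (subst ueq) (simp add: rcis_def mult.assoc cis_mult)
  have s: "sin (t + pi / n) > 0" "sin (t - pi / n) < 0"
    using u \<open>u \<noteq> 0\<close> unfolding Sect_def mem_Collect_eq im
    by (auto simp: zero_less_mult_iff mult_less_0_iff)
  have pn: "pi / n > 0" "pi / n \<le> pi" using n2 by (auto simp: field_simps)
  have "t < pi / n"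
  proof (rule ccontr)
    assume "\<not> t < pi / n" then show False using s(2) t pn sin_ge_zero[of "t - pi / n"] by auto
  qed
  moreover have "- (pi / n) < t"
  proof (rule ccontr)
    assume "\<not> - (pi / n) < t"
    then have "sin (- (t + pi / n)) \<ge> 0" using t pn by (intro sin_ge_zero) auto
    then show False using s(1) by (simp only: sin_minus)
  qed
  ultimately have "\<bar>t * n / (2 * pi)\<bar> < 1/2" using n2 by (auto simp: abs_less_iff field_simps)
  moreover have "u = pt n (norm u) (t * n / (2 * pi))"
    by (subst ueq) (use n2 in \<open>simp add: pt_def\<close>)
  ultimately show "\<exists>r>0. \<exists>d. \<bar>d\<bar> < 1/2 \<and> u = pt n r d" using \<open>u \<noteq> 0\<close> zero_less_norm_iff by blast
next
  assume "\<exists>r>0. \<exists>d. \<bar>d\<bar> < 1/2 \<and> u = pt n r d"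
  then obtain r d where r: "r > 0" "\<bar>d\<bar> < 1/2" "u = pt n r d" by blast
  define t where "t = 2 * pi * d / n"
  have "\<bar>t\<bar> = 2 * pi * \<bar>d\<bar> / n" by (simp add: t_def abs_mult)
  also have "\<dots> < pi / n" using r n2 by (intro divide_strict_right_mono) auto
  finally have t: "- (pi / n) < t" "t < pi / n" by linarith+
  have pn: "pi / n \<le> pi / 2" using n2 by (intro divide_left_mono) auto
  have im: "Im (u * cis a) = r * sin (t + a)" for a
    unfolding r(3) pt_def t_def[symmetric] by (simp add: rcis_def mult.assoc cis_mult)
  have "sin (t + pi / n) > 0" by (rule sin_gt_zero) (use t pn pi_gt_zero in linarith)+
  moreover have "sin (pi / n - t) > 0" by (rule sin_gt_zero) (use t pn pi_gt_zero in linarith)+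
  then have "sin (t + - (pi / n)) < 0" using sin_minus[of "pi / n - t"] by simp
  ultimately show "u \<in> Sect n"
    unfolding Sect_def mem_Collect_eq im using r(1) by (simp add: mult_pos_neg)
qed

lemma open_Sect: "open (Sect n)"
  unfolding Sect_def by (intro open_Collect_conj open_Collect_less continuous_intros)

lemma convex_Sect: "convex (Sect n)"
proof (rule convexI)
  fix x y :: complex and u v :: real
  assume xy: "x \<in> Sect n" "y \<in> Sect n" and uv: "0 \<le> u" "0 \<le> v" "u + v = 1"
  define p where "p = cis (pi / n)"
  define m where "m = cis (- (pi / n))"
  have *: "Im ((u *\<^sub>R x + v *\<^sub>R y) * c) = u * Im (x * c) + v * Im (y * c)" for c
    by (simp add: algebra_simps)
  have pos: "0 < u * a + v * b" if "0 < a" "0 < b" for a b :: real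
  proof (cases "u = 0")
    case True then show ?thesis using that uv by simp
  next
    case False then show ?thesis using that uv by (intro add_pos_nonneg) auto
  qed
  have "0 < Im (x * p)" "0 < Im (y * p)" "0 < - Im (x * m)" "0 < - Im (y * m)"
    using xy unfolding Sect_def p_def m_def by simp_all
  then have "0 < u * Im (x * p) + v * Im (y * p)" "0 < u * (- Im (x * m)) + v * (- Im (y * m))"
    by (blast intro: pos)+
  then show "u *\<^sub>R x + v *\<^sub>R y \<in> Sect n"
    unfolding Sect_def mem_Collect_eq p_def[symmetric] m_def[symmetric] * by linarith
qed

lemma zero_notin_Sect: "0 \<notin> Sect n" by (simp add: Sect_def)

lemma of_real_Sect: "r > 0 \<Longrightarrow> of_real r \<in> Sect n"
  unfolding Sect_iff by (intro exI[of _ r] conjI exI[of _ 0]) auto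

lemma real_Sect: assumes "u \<in> Sect n" "Im u = 0" shows "u = of_real (Re u)" "Re u > 0"
proof -
  show "u = of_real (Re u)" using assms by (simp add: complex_eq_iff)
  obtain r d where r: "r > 0" "\<bar>d\<bar> < 1/2" "u = pt n r d" using assms unfolding Sect_iff by blast
  then have "d = 0" using Im_pt_pos[of r d] Im_pt_neg[of r d] assms(2) by (cases d "0::real" rule: linorder_cases) auto
  then show "Re u > 0" using r by simp
qed

lemma wedge_iff: "z \<in> wedge n x \<longleftrightarrow> (\<exists>r>0. \<exists>y. \<bar>y - x\<bar> < 1/2 \<and> z = pt n r y)"
proof
  assume "z \<in> wedge n x"
  then obtain r d where r: "r > 0" "\<bar>d\<bar> < 1/2" "turn n x z = pt n r d" unfolding wedge_def Sect_iff by blast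
  have "z = pt n r (x + d)" using turn_inverse[of n x z] r(3) by (simp add: pt_mult)
  then show "\<exists>r>0. \<exists>y. \<bar>y - x\<bar> < 1/2 \<and> z = pt n r y" using r by (intro exI[of _ r] conjI exI[of _ "x + d"]) auto
next
  assume "\<exists>r>0. \<exists>y. \<bar>y - x\<bar> < 1/2 \<and> z = pt n r y"
  then obtain r y where r: "r > 0" "\<bar>y - x\<bar> < 1/2" "z = pt n r y" by blast
  then show "z \<in> wedge n x" unfolding wedge_def Sect_iff mem_Collect_eq by (intro exI[of _ r] conjI exI[of _ "y - x"]) (auto simp: turn_pt)
qed

lemma wedgeI: "r > 0 \<Longrightarrow> \<bar>y - x\<bar> < 1/2 \<Longrightarrow> pt n r y \<in> wedge n x"
  unfolding wedge_iff by blast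

lemma wedge_inverse: "inverse z \<in> wedge n x \<longleftrightarrow> z \<in> wedge n (- x)"
proof -
  have *: "inverse z \<in> wedge n (- x)" if zw: "z \<in> wedge n x" for z x
  proof -
    obtain r y where r: "r > 0" "\<bar>y - x\<bar> < 1/2" "z = pt n r y" using zw unfolding wedge_iff by blast
    have "\<bar>- y - - x\<bar> < 1/2" using r(2) by linarith
    then show ?thesis unfolding r(3) pt_inverse using r(1) by (intro wedgeI) auto
  qed
  from *[of "inverse z" x] *[of z "- x"] show ?thesis by auto
qed

lemma open_wedge: "open (wedge n x)"
proof -
  have "continuous_on UNIV (turn n x)" unfolding turn_def[abs_def] by (intro continuous_intros)
  then have "open (turn n x -` Sect n)" using open_Sect by (simp add: open_vimage)
  then show ?thesis by (simp add: wedge_def vimage_def)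
qed

lemma zero_notin_wedge: "0 \<notin> wedge n x" by (simp add: wedge_def zero_notin_Sect)

text \<open>The \<open>n\<close>-th power turns direction \<open>x\<close> into the angle
  \<open>2 * pi * x\<close>, so it is a negative real exactly in half-integral directions.\<close>

lemma pt_in_slit:
  fixes x :: real
  assumes "r > 0" shows "pt n r x \<in> slit n \<longleftrightarrow> \<not> ((\<exists>k::int. x = of_int k + 1/2) \<and> r \<ge> 1)"
proof -
  have rn: "r ^ n > 0" "1 \<le> r ^ n \<longleftrightarrow> 1 \<le> r"
    using assms n2 power_less_one_iff[of r n] by (auto simp flip: not_less)
  have "Im (pt n r x ^ n) = 0 \<and> Re (pt n r x ^ n) \<le> -1 \<longleftrightarrow> sin (2 * pi * x) = 0 \<and> r ^ n * cos (2 * pi * x) \<le> -1"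
    using rn assms by (auto simp: pt_power)
  also have "\<dots> \<longleftrightarrow> (\<exists>k::int. x = of_int k + 1/2) \<and> r \<ge> 1"
  proof
    assume L: "sin (2 * pi * x) = 0 \<and> r ^ n * cos (2 * pi * x) \<le> -1"
    then have "cos (2 * pi * x) = 1 \<or> cos (2 * pi * x) = -1"
      using sin_zero_abs_cos_one[of "2 * pi * x"] by linarith
    moreover have "cos (2 * pi * x) < 0" using L rn(1) by (smt (verit) mult_nonneg_nonneg)
    ultimately have c: "cos (2 * pi * x) = -1" by simp
    then obtain k :: int where "2 * pi * x = (2 * of_int k + 1) * pi" using cos_eq_minus1 by auto
    then have "pi * (2 * x) = pi * (2 * of_int k + 1)" by (simp only: mult_ac)
    then have "2 * x = 2 * of_int k + 1" by simp
    then have "x = of_int k + 1/2" by simp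
    then show "(\<exists>k::int. x = of_int k + 1/2) \<and> r \<ge> 1" using L c rn by auto
  next
    assume "(\<exists>k::int. x = of_int k + 1/2) \<and> r \<ge> 1"
    then obtain k :: int where k: "x = of_int k + 1/2" "r \<ge> 1" by blast
    have "2 * pi * x = 2 * pi * of_int k + pi" using k by (simp add: field_simps)
    then have "sin (2 * pi * x) = 0" "cos (2 * pi * x) = -1"
      by (simp_all add: sin_add cos_add sin_int_2pin cos_int_2pin)
    then show "sin (2 * pi * x) = 0 \<and> r ^ n * cos (2 * pi * x) \<le> -1" using rn k by simp
  qed
  finally show ?thesis by (simp only: slit_def mem_Collect_eq)
qed

lemma open_slit: "open (slit n)"
proof -
  have "slit n = - {z. Im (z ^ n) = 0} \<union> - {z. Re (z ^ n) \<le> -1}" by (auto simp: slit_def)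
  moreover have "closed {z::complex. Im (z ^ n) = 0}" "closed {z::complex. Re (z ^ n) \<le> -1}"
    by (intro closed_Collect_eq closed_Collect_le continuous_intros)+
  ultimately show ?thesis by (simp add: open_Un open_Compl)
qed

lemma zero_in_slit: "0 \<in> slit n" using n2 by (simp add: slit_def power_0_left)

text \<open>Scaling \<open>z\<close> by \<open>t\<close> scales \<open>z ^ n\<close> by
  \<open>t ^ n \<le> 1\<close> and cannot push it onto the cut; hence the slit plane is starlike
  about 0.\<close>

lemma connected_slit: "connected (slit n)"
proof -
  have "starlike (slit n)" unfolding starlike_def
  proof (intro bexI[of _ 0] ballI subsetI)
    fix z w assume z: "z \<in> slit n" and "w \<in> closed_segment 0 z"
    then obtain t where t: "0 \<le> t" "t \<le> 1" "w = of_real t * z" by (auto simp: closed_segment_def scaleR_conv_of_real)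
    have wn: "w ^ n = of_real (t ^ n) * z ^ n" by (simp add: t power_mult_distrib)
    have tn: "0 \<le> t ^ n" "t ^ n \<le> 1" using t by (auto simp: power_le_one)
    show "w \<in> slit n" unfolding slit_def mem_Collect_eq
    proof
      assume "Im (w ^ n) = 0 \<and> Re (w ^ n) \<le> -1"
      then have *: "t ^ n * Im (z ^ n) = 0" "t ^ n * Re (z ^ n) \<le> -1" by (auto simp: wn simp flip: of_real_power)
      then have "t ^ n \<noteq> 0" by (metis mult_zero_left neg_0_le_iff_le not_one_le_zero)
      moreover have "Re (z ^ n) \<le> -1" using *(2) tn mult_right_mono_neg[of "t ^ n" 1 "Re (z ^ n)"] mult_nonneg_nonneg[of "t ^ n" "Re (z ^ n)"]
        by (cases "Re (z ^ n) \<ge> 0"; linarith)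
      ultimately show False using z * by (auto simp: slit_def)
    qed
  qed (rule zero_in_slit)
  then show ?thesis by (rule starlike_imp_connected)
qed

lemma wedge_int_slit: "z \<in> wedge n (real j) \<Longrightarrow> z \<in> slit n" "z \<in> wedge n (real j) \<Longrightarrow> inverse z \<in> slit n"
proof -
  assume "z \<in> wedge n (real j)"
  then obtain r y where r: "r > 0" "\<bar>y - real j\<bar> < 1/2" "z = pt n r y" unfolding wedge_iff by blast
  have "y \<noteq> of_int k + 1/2" for k :: int
  proof
    assume "y = of_int k + 1/2"
    then have "\<bar>of_int (k - int j) + 1/2\<bar> < (1/2 :: real)" using r(2) by (simp add: algebra_simps)
    define m where "m = k - int j"
    have "-1 < (of_int m :: real)" "(of_int m :: real) < 0"
      using \<open>\<bar>of_int (k - int j) + 1/2\<bar> < (1/2 :: real)\<close> unfolding abs_less_iff m_def[symmetric] by linarith+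
    then show False using no_int_between[of "-1" m] by simp
  qed
  note * = this
  have "- y \<noteq> of_int k + 1/2" for k :: int using *[of "- k - 1"] by auto
  then show "z \<in> slit n" "inverse z \<in> slit n" using r * by (auto simp: pt_in_slit pt_inverse)
qed

text \<open>Half-integral directions are excluded from modulus 1 on by the one slit condition and up
  to modulus 1 by the other. What remains are the open wedges around the edge directions; this is
  what makes the gluing of two vertex charts closed.\<close>

lemma slit_inverse_wedge:
  assumes z: "z \<noteq> 0" "z \<in> slit n" "inverse z \<in> slit n" shows "\<exists>j<n. z \<in> wedge n (real j)"
proof -
  obtain r x where r: "r > 0" "0 \<le> x" "x < real n" "z = pt n r x" by (rule ex_pt[OF z(1)])
  have nh: "x \<noteq> of_int k + 1/2" for k :: int
  proof (cases "r \<ge> 1")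
    case True then show ?thesis using z(2) r pt_in_slit[of r x] by auto
  next
    case False
    then have "1 / r \<ge> 1" using r by simp
    moreover have "\<not> ((\<exists>k::int. - x = of_int k + 1/2) \<and> 1 / r \<ge> 1)"
      using z(3) r(1) pt_in_slit[of "1 / r" "- x"] unfolding r(4) pt_inverse by simp
    ultimately have "- x \<noteq> of_int (- k - 1) + 1/2" by blast
    then show ?thesis by auto
  qed
  define j0 where "j0 = round x"
  have j0: "\<bar>of_int j0 - x\<bar> \<le> 1/2" unfolding j0_def by (rule of_int_round_abs_le)
  have "\<bar>x - of_int j0\<bar> < 1/2"
  proof -
    have "x \<noteq> of_int j0 + 1/2" "x \<noteq> of_int j0 - 1/2" using nh[of j0] nh[of "j0 - 1"] by auto
    then show ?thesis using j0 by linarith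
  qed
  moreover have "j0 \<ge> 0" "j0 \<le> int n" using j0 r by linarith+
  ultimately show ?thesis
  proof (cases "j0 = int n")
    case True
    \<comment> \<open>Rounding may produce \<open>n\<close>, which is direction 0 after a full
      turn.\<close>
    have "z = pt n r (x - n)" using pt_period[of r x "-1"] r by simp
    moreover have "pt n r (x - n) \<in> wedge n (real 0)"
      by (rule wedgeI) (use \<open>\<bar>x - of_int j0\<bar> < 1/2\<close> True r(1) in auto)
    ultimately show ?thesis using n2 by (intro exI[of _ 0]) auto
  next
    case False
    then have "nat j0 < n" "real (nat j0) = of_int j0" using \<open>j0 \<ge> 0\<close> \<open>j0 \<le> int n\<close> by auto
    moreover from this have "z \<in> wedge n (real (nat j0))"
      unfolding r(4) by (intro wedgeI) (use \<open>\<bar>x - of_int j0\<bar> < 1/2\<close> r(1) in auto)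
    ultimately show ?thesis by blast
  qed
qed

lemma wedge_meet:
  fixes x y :: real
  assumes "z \<in> wedge n x" "z \<in> wedge n y" shows "\<exists>k::int. \<bar>x - y - of_int k * n\<bar> < 1"
proof -
  obtain r x' s y' where r: "r > 0" "\<bar>x' - x\<bar> < 1/2" "z = pt n r x'" "s > 0" "\<bar>y' - y\<bar> < 1/2" "z = pt n s y'"
    using assms unfolding wedge_iff by blast
  then obtain k :: int where "x' = y' + of_int k * n" using pt_eq_D(2)[of r s x' y'] by auto
  then have "\<bar>x - y - of_int k * n\<bar> < 1" using r by linarith
  then show ?thesis by blast
qed

lemma half_wedge_meet:
  assumes "i < n" "j < n" "z \<in> wedge n (real i + 1/2)" "z \<in> wedge n (real j)"
  shows "j = i \<or> j = Suc i mod n"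
proof -
  obtain k :: int where k: "\<bar>real i + 1/2 - real j - of_int k * n\<bar> < 1" using wedge_meet assms by blast
  define m where "m = int i - int j - k * int n"
  have "of_int m = real i - real j - of_int k * n" by (simp add: m_def)
  then have "of_int (-2) < (of_int m :: real)" "of_int m < (of_int 1 :: real)" using k by (auto simp: abs_less_iff)
  then have "m = 0 \<or> m = -1" unfolding of_int_less_iff by auto
  then show ?thesis
  proof
    assume "m = 0"
    then have "int i = int j + k * int n" by (simp add: m_def)
    then have "int i mod int n = int j mod int n" by simp
    then show ?thesis using assms by (simp flip: zmod_int)
  next
    assume "m = -1"
    then have "int (Suc i) = int j + k * int n" by (simp add: m_def)
    then have "int (Suc i) mod int n = int j mod int n" by simp
    then have "int (Suc i mod n) = int (j mod n)" unfolding zmod_int .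
    then show ?thesis using assms by (simp del: of_nat_Suc)
  qed
qed

lemma int_close_eq:
  assumes "i < n" "j < n" "\<bar>real i - real j - of_int k * n\<bar> < 1" shows "i = j"
proof -
  have "\<bar>of_int (int i - int j - k * int n)\<bar> < (1::real)" using assms(3) by simp
  then have e: "int i - int j = k * int n" by linarith
  have "\<bar>k * int n\<bar> < int n" using assms e by linarith
  then have "k = 0" using n2 by (cases "k = 0") (auto simp: abs_mult)
  then show ?thesis using e by simp
qed

lemma wedge_unique: "z \<in> wedge n (real i) \<Longrightarrow> z \<in> wedge n (real j) \<Longrightarrow> i < n \<Longrightarrow> j < n \<Longrightarrow> i = j"
  using wedge_meet[of z "real i" "real j"] int_close_eq by blast

lemma half_wedge_unique:
  "z \<in> wedge n (real i + 1/2) \<Longrightarrow> z \<in> wedge n (real j + 1/2) \<Longrightarrow> i < n \<Longrightarrow> j < n \<Longrightarrow> i = j"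
  using wedge_meet[of z "real i + 1/2" "real j + 1/2"] int_close_eq by auto

lemma ray_not_half_wedge: assumes "r > 0" shows "pt n r (real j) \<notin> wedge n (real i + 1/2)"
proof
  assume "pt n r (real j) \<in> wedge n (real i + 1/2)"
  then obtain s y where s: "s > 0" "\<bar>y - (real i + 1/2)\<bar> < 1/2" "pt n r (real j) = pt n s y" unfolding wedge_iff by blast
  then obtain k :: int where "real j = y + of_int k * n" using pt_eq_D(2)[of r s "real j" y] assms by auto
  define m where "m = int j - k * int n - int i"
  have "of_int m = real j - of_int k * real n - real i" by (simp add: m_def)
  then have "of_int m = y - real i" using \<open>real j = y + _\<close> by simp
  then have "0 < (of_int m :: real)" "(of_int m :: real) < 1"
    using s(2) unfolding abs_less_iff by linarith+
  then show False using no_int_between[of 0 m] by simp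
qed

lemma ray_unique:
  assumes "r > 0" "s > 0" "i < n" "j < n" "pt n r (real i) = pt n s (real j)" shows "i = j"
proof -
  obtain k :: int where "real i = real j + of_int k * n" using pt_eq_D(2) assms by blast
  then show ?thesis using int_close_eq[of i j k] assms by simp
qed

lemma ray_wedge: "r > 0 \<Longrightarrow> pt n r (real j) \<in> wedge n (real j)"
  by (rule wedgeI) auto

lemma direction_cases:
  assumes "z \<noteq> 0"
  obtains (sector) i where "i < n" "z \<in> wedge n (real i + 1/2)"
    | (ray) j r where "j < n" "r > 0" "z = pt n r (real j)"
proof -
  obtain r x where r: "r > 0" "0 \<le> x" "x < real n" "z = pt n r x" by (rule ex_pt[OF assms])
  define i where "i = nat \<lfloor>x\<rfloor>"
  have i: "real i \<le> x" "x < real i + 1" "i < n" using r by (auto simp: i_def) linarith+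
  show ?thesis
  proof (cases "x = real i")
    case True then show ?thesis using ray[of i r] r i by simp
  next
    case False
    then have "z \<in> wedge n (real i + 1/2)"
      unfolding r(4) by (intro wedgeI) (use r(1) i False in linarith)+
    then show ?thesis by (rule sector[OF i(3)])
  qed
qed

lemma wedge_Suc_mod: "wedge n (real (Suc i mod n)) = wedge n (real i + 1)" if "i < n"
proof (cases "Suc i = n")
  case True
  then have "turn n 0 z = turn n (real i + 1) z" for z
    using pt_period[of 1 0 "-1"] True by (simp add: turn_def)
      (metis True of_nat_Suc add.commute minus_add_distrib of_real_1 uminus_add_conv_diff)
  then show ?thesis using True by (simp add: wedge_def)
next
  case False then show ?thesis using that by (simp add: add.commute)
qed

lemma half_wedge_upper:
  assumes "i < n" "z \<in> wedge n (real i + 1/2)" "Im (turn n (real i + 1/2) z) > 0"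
  shows "z \<in> wedge n (real (Suc i mod n))"
proof -
  obtain r y where r: "r > 0" "\<bar>y - (real i + 1/2)\<bar> < 1/2" "z = pt n r y" using assms(2) unfolding wedge_iff by blast
  have "\<not> y - (real i + 1/2) \<le> 0"
  proof
    assume a: "y - (real i + 1/2) \<le> 0"
    show False
    proof (cases "y - (real i + 1/2) = 0")
      case True then show False using assms(3) r by (simp add: turn_pt)
    next
      case False
      then have "Im (pt n r (y - (real i + 1/2))) < 0" using Im_pt_neg[OF r(1)] r(2) a by (auto simp: abs_less_iff)
      then show False using assms(3) r(3) by (simp add: turn_pt)
    qed
  qed
  then have "z \<in> wedge n (real i + 1)" unfolding r(3) by (intro wedgeI) (use r(1,2) in \<open>auto simp: abs_less_iff\<close>)
  then show ?thesis using wedge_Suc_mod assms by simp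
qed

lemma half_wedge_lower:
  assumes "i < n" "z \<in> wedge n (real i + 1/2)" "Im (turn n (real i + 1/2) z) < 0"
  shows "z \<in> wedge n (real i)"
proof -
  obtain r y where r: "r > 0" "\<bar>y - (real i + 1/2)\<bar> < 1/2" "z = pt n r y" using assms(2) unfolding wedge_iff by blast
  have "\<not> y - (real i + 1/2) \<ge> 0"
  proof
    assume a: "y - (real i + 1/2) \<ge> 0"
    show False
    proof (cases "y - (real i + 1/2) = 0")
      case True then show False using assms(3) r by (simp add: turn_pt)
    next
      case False
      then have "Im (pt n r (y - (real i + 1/2))) > 0" using Im_pt_pos[OF r(1)] r(2) a by (auto simp: abs_less_iff)
      then show False using assms(3) r(3) by (simp add: turn_pt)
    qed
  qed
  then show "z \<in> wedge n (real i)" unfolding r(3) by (intro wedgeI) (use r(1,2) in \<open>auto simp: abs_less_iff\<close>)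
qed

lemma wedge_cases:
  assumes j: "j < n" and z: "z \<in> wedge n (real j)"
  obtains (ray) r where "r > 0" "z = pt n r (real j)"
    | (lower) "z \<in> wedge n (real j + 1/2)" "Im (turn n (real j + 1/2) z) < 0"
    | (upper) i where "i < n" "Suc i mod n = j" "z \<in> wedge n (real i + 1/2)" "Im (turn n (real i + 1/2) z) > 0"
proof -
  obtain r y where r: "r > 0" "\<bar>y - real j\<bar> < 1/2" "z = pt n r y" using z unfolding wedge_iff by blast
  consider "y = real j" | "y > real j" | "y < real j" by linarith
  then show ?thesis
  proof cases
    case 1 then show ?thesis using ray r by simp
  next
    case 2
    have "z \<in> wedge n (real j + 1/2)"
      unfolding r(3) by (intro wedgeI) (use r(1,2) 2 in \<open>auto simp: abs_less_iff\<close>)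
    moreover have "Im (turn n (real j + 1/2) z) < 0"
      unfolding r turn_pt by (rule Im_pt_neg) (use r 2 in \<open>auto simp: abs_less_iff\<close>)
    ultimately show ?thesis by (rule lower)
  next
    case 3
    \<comment> \<open>The sector before ray \<open>j\<close> is the cyclically preceding one; for
      \<open>j = 0\<close> the angle is raised by the full turn \<open>n\<close> to fit its
      index.\<close>
    define i where "i = (if j = 0 then n - 1 else j - 1)"
    define y' where "y' = (if j = 0 then y + n else y)"
    have i: "i < n" "Suc i mod n = j" using j n2 by (auto simp: i_def)
    have y': "z = pt n r y'" using r pt_period[of r y 1] by (simp add: y'_def)
    have b: "0 < y' - (real i + 1/2)" "y' - (real i + 1/2) < 1/2"
      using 3 r n2 j by (auto simp: y'_def i_def abs_less_iff of_nat_diff)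
    have "z \<in> wedge n (real i + 1/2)"
      unfolding y' by (intro wedgeI) (use r(1) b in \<open>auto simp: abs_less_iff\<close>)
    moreover have "Im (turn n (real i + 1/2) z) > 0"
      unfolding y' turn_pt by (rule Im_pt_pos) (use r b in auto)
    ultimately show ?thesis using upper i by blast
  qed
qed

text \<open>In the sector coordinate \<open>u\<close> the branch point is 1. The slit of a black
  chart is the real half-line from 1 outwards, that of a white chart the part from 1 inwards; along
  these the logarithm of \<open>u - 1\<close> gets cut.\<close>

lemma half_wedge_slit:
  assumes z: "z \<in> wedge n (real i + 1/2)"
  defines "u \<equiv> turn n (real i + 1/2) z"
  shows "z \<in> slit n \<longleftrightarrow> \<not> (Im u = 0 \<and> Re u \<ge> 1)"
    and "inverse z \<in> slit n \<longleftrightarrow> \<not> (Im u = 0 \<and> Re u \<le> 1)"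
proof -
  obtain r y where r: "r > 0" "\<bar>y - (real i + 1/2)\<bar> < 1/2" "z = pt n r y" using z unfolding wedge_iff by blast
  define d where "d = y - (real i + 1/2)"
  have d: "\<bar>d\<bar> < 1/2" "u = pt n r d" using r by (auto simp: d_def u_def turn_pt)
  have im: "Im u = 0 \<longleftrightarrow> d = 0"
    using Im_pt_pos[of r d] Im_pt_neg[of r d] d r(1) by (cases d "0::real" rule: linorder_cases) auto
  have int: "d = 0" if "d = of_int k" for k :: int
  proof -
    have "\<bar>of_int k\<bar> < (1::real)" using d(1) that by simp
    then have "\<bar>k\<bar> < 1" by (simp flip: of_int_abs)
    then show ?thesis using that by simp
  qed
  have h1: "(\<exists>k::int. y = of_int k + 1/2) \<longleftrightarrow> d = 0"
  proof
    assume "\<exists>k::int. y = of_int k + 1/2"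
    then obtain k :: int where "y = of_int k + 1/2" by blast
    then have "d = of_int (k - int i)" by (simp add: d_def)
    then show "d = 0" by (rule int)
  next
    assume "d = 0" then show "\<exists>k::int. y = of_int k + 1/2" by (intro exI[of _ "int i"]) (simp add: d_def)
  qed
  have h2: "(\<exists>k::int. - y = of_int k + 1/2) \<longleftrightarrow> d = 0"
  proof
    assume "\<exists>k::int. - y = of_int k + 1/2"
    then obtain k :: int where "- y = of_int k + 1/2" by blast
    then have "y = - of_int k - 1/2" by linarith
    then have "d = of_int (- k - 1 - int i)" by (simp add: d_def)
    then show "d = 0" by (rule int)
  next
    assume "d = 0" then show "\<exists>k::int. - y = of_int k + 1/2" by (intro exI[of _ "- int i - 1"]) (simp add: d_def)
  qed
  show "z \<in> slit n \<longleftrightarrow> \<not> (Im u = 0 \<and> Re u \<ge> 1)"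
    using r(1,3) d(2) im h1 by (auto simp: pt_in_slit)
  show "inverse z \<in> slit n \<longleftrightarrow> \<not> (Im u = 0 \<and> Re u \<le> 1)"
    using r(1,3) d(2) im h2 by (auto simp: pt_in_slit pt_inverse)
qed

end

section \<open>Branches of the \<open>M\<close>-th root, numbered by positions\<close>

text \<open>Moving \<open>q\<close> by two passes to the next sheet; the parity of \<open>q\<close> selects along which half of the
  real axis the logarithm is cut.\<close>

definition branch :: "nat \<Rightarrow> nat \<Rightarrow> complex \<Rightarrow> complex" where
  "branch M q c = exp ((Ln ((-1) ^ q * c) + \<i> * of_real pi * of_nat q) / of_nat M)"

lemma exp_pi_nat: "exp (\<i> * of_real pi * of_nat k) = (-1) ^ k"
proof -
  have "exp (\<i> * of_real pi * of_nat k) = exp (of_real pi * \<i>) ^ k"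
    by (subst exp_of_nat_mult[symmetric]) (simp add: mult_ac)
  then show ?thesis by (simp add: exp_pi_i)
qed

lemma branch_power:
  assumes "M > 0" "c \<noteq> 0" shows "branch M q c ^ M = c"
proof -
  have "branch M q c ^ M = exp (Ln ((-1) ^ q * c) + \<i> * of_real pi * of_nat q)"
    using assms by (simp add: branch_def flip: exp_of_nat_mult)
  also have "\<dots> = ((-1) ^ q * c) * (-1) ^ q" unfolding exp_add exp_pi_nat using assms by simp
  also have "\<dots> = c" by (simp flip: power_mult_distrib add: mult_ac)
  finally show ?thesis .
qed

text \<open>The parameter counts half turns around the branch point. By the period of
  \<open>exp\<close> they matter modulo \<open>2 * M\<close>, which is the length of a face
  cycle.\<close>

lemma root_eq_iff:
  fixes x y :: real
  assumes "M > 0"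
  shows "exp ((a + \<i> * of_real pi * of_real x) / of_nat M) = exp ((a + \<i> * of_real pi * of_real y) / of_nat M)
    \<longleftrightarrow> (\<exists>k::int. x = y + 2 * of_nat M * of_int k)"
proof -
  have "(a + \<i> * of_real pi * of_real x) / of_nat M = (a + \<i> * of_real pi * of_real y) / of_nat M + of_real (of_int (2 * k) * pi) * \<i>
      \<longleftrightarrow> x = y + 2 * of_nat M * of_int k" for k :: int
  proof -
    have "(a + \<i> * of_real pi * of_real x) / of_nat M = (a + \<i> * of_real pi * of_real y) / of_nat M + of_real (of_int (2 * k) * pi) * \<i>
      \<longleftrightarrow> \<i> * of_real pi * of_real x = \<i> * of_real pi * of_real (y + 2 * of_nat M * of_int k)"
      using assms by (simp add: field_simps)
    also have "\<dots> \<longleftrightarrow> (of_real x :: complex) = of_real (y + 2 * of_nat M * of_int k)" by simp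
    also have "\<dots> \<longleftrightarrow> x = y + 2 * of_nat M * of_int k" by (rule of_real_eq_iff)
    finally show ?thesis .
  qed
  then show ?thesis unfolding exp_eq by simp
qed

text \<open>Indices of equal parity use the same logarithm, so only the numbers of half turns are
  compared.\<close>

lemma branch_eq_same_parity:
  assumes M: "M > 0" and q: "q < 2 * M" "q' < 2 * M" and par: "even q = even q'"
    and eq: "branch M q c = branch M q' c"
  shows "q = q'"
proof -
  have "(-1::complex) ^ q = (-1) ^ q'" using par by (cases "even q") auto
  then have "\<exists>k::int. real q = real q' + 2 * of_nat M * of_int k"
    using eq root_eq_iff[OF M, of _ "real q" "real q'"] by (simp add: branch_def)
  then obtain k :: int where "real q = real q' + 2 * of_nat M * of_int k" by blast
  then have "of_int (int q) = (of_int (int q' + 2 * int M * k) :: real)" by simp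
  then have k: "int q = int q' + 2 * int M * k" by linarith
  then have "\<bar>2 * int M * k\<bar> < 2 * int M" using q by linarith
  then have "k = 0" using M by (simp add: abs_mult)
  then show ?thesis using k by simp
qed

text \<open>Here the combinatorics of a face cycle becomes analytic: the two logarithms differ by
  half a turn whose sense depends on the side of the real axis, so an odd branch continues into its
  even predecessor above the axis and into its even successor below it.\<close>

lemma branch_eq_opposite_parity:
  assumes M: "M > 0" and q: "q < 2 * M" "q' < 2 * M" and par: "odd q" "even q'" and c: "Im c \<noteq> 0"
  shows "branch M q c = branch M q' c \<longleftrightarrow> (if Im c > 0 then Suc q' = q else q' = Suc q mod (2 * M))"
proof -
  \<comment> \<open>The half turn from \<open>Ln c\<close> to \<open>Ln (- c)\<close>: clockwise
    above the real axis, counterclockwise below it.\<close>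
  define s :: real where "s = (if Im c > 0 then -1 else 1)"
  have "c \<noteq> 0" using c by auto
  have "Ln (- c) = Ln c + \<i> * of_real pi * of_real s"
    using Ln_minus[OF \<open>c \<noteq> 0\<close>] c by (auto simp: s_def)
  then have "branch M q c = exp ((Ln c + \<i> * of_real pi * of_real (real q + s)) / of_nat M)"
    using par by (simp add: branch_def algebra_simps)
  moreover have "branch M q' c = exp ((Ln c + \<i> * of_real pi * of_real (real q')) / of_nat M)"
    using par by (simp add: branch_def)
  ultimately have "branch M q c = branch M q' c \<longleftrightarrow> (\<exists>k::int. real q + s = real q' + 2 * of_nat M * of_int k)"
    by (simp only: root_eq_iff[OF M])
  also have "\<dots> \<longleftrightarrow> (if Im c > 0 then Suc q' = q else q' = Suc q mod (2 * M))"
  proof (cases "Im c > 0")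
    case True
    have "(\<exists>k::int. real q + s = real q' + 2 * of_nat M * of_int k) \<longleftrightarrow> Suc q' = q"
    proof
      assume "\<exists>k::int. real q + s = real q' + 2 * of_nat M * of_int k"
      then obtain k :: int where "(of_int (int q - 1) :: real) = of_int (int q' + 2 * int M * k)" using True by (auto simp: s_def)
      then have k: "int q - 1 = int q' + 2 * int M * k" by linarith
      \<comment> \<open>An odd index is positive, so its predecessor does not wrap around.\<close>
      have "q \<ge> 1" using par by (cases q) auto
      then have "\<bar>2 * int M * k\<bar> < 2 * int M" using q k by linarith
      then have "k = 0" using M by (simp add: abs_mult)
      then show "Suc q' = q" using k by simp
    next
      assume "Suc q' = q"
      then show "\<exists>k::int. real q + s = real q' + 2 * of_nat M * of_int k" using True by (intro exI[of _ 0]) (auto simp: s_def)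
    qed
    then show ?thesis using True by simp
  next
    case False
    have "(\<exists>k::int. real q + s = real q' + 2 * of_nat M * of_int k) \<longleftrightarrow> q' = Suc q mod (2 * M)"
    proof
      assume "\<exists>k::int. real q + s = real q' + 2 * of_nat M * of_int k"
      then obtain k :: int where "(of_int (int q + 1) :: real) = of_int (int q' + 2 * int M * k)" using False by (auto simp: s_def)
      then have k: "int (Suc q) = int q' + 2 * int M * k" by linarith
      then have "int (Suc q) mod (2 * int M) = int q' mod (2 * int M)" by simp
      then have "int (Suc q mod (2 * M)) = int (q' mod (2 * M))" unfolding zmod_int by simp
      then have "Suc q mod (2 * M) = q' mod (2 * M)" by (simp only: of_nat_eq_iff)
      then show "q' = Suc q mod (2 * M)" using q by simp
    next
      assume "q' = Suc q mod (2 * M)"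
      then have "Suc q = q' + 2 * M * (Suc q div (2 * M))" by simp
      then have "real (Suc q) = real (q' + 2 * M * (Suc q div (2 * M)))" by (rule arg_cong)
      then show "\<exists>k::int. real q + s = real q' + 2 * of_nat M * of_int k"
        using False by (intro exI[of _ "int (Suc q div (2 * M))"]) (simp add: s_def)
    qed
    then show ?thesis using False by simp
  qed
  finally show ?thesis .
qed

text \<open>Branches of one parity differ by the \<open>M\<close>-th roots of unity and hence
  exhaust all \<open>M\<close>-th roots.\<close>

lemma ex_branch:
  assumes M: "M > 0" and w: "w \<noteq> 0"
  shows "\<exists>q<2 * M. (odd q \<longleftrightarrow> p) \<and> w = branch M q (w ^ M)"
proof -
  define b where "b = branch M (of_bool p) (w ^ M)"
  have b: "b ^ M = w ^ M" unfolding b_def by (rule branch_power) (use M w in auto)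
  have b0: "b \<noteq> 0" by (simp add: b_def branch_def)
  have "(w / b) ^ M = 1" using b w by (simp add: power_divide)
  then obtain j where j: "j < M" "w / b = exp (2 * of_real pi * \<i> * of_nat j / of_nat M)"
    using complex_roots_unity[of M] M by auto
  define q where "q = of_bool p + 2 * j"
  have "w = b * exp (2 * of_real pi * \<i> * of_nat j / of_nat M)" using j(2) b0 by (simp add: field_simps)
  also have "\<dots> = branch M q (w ^ M)"
    by (cases p) (simp_all add: b_def branch_def q_def add_divide_distrib algebra_simps flip: exp_add)
  finally have "w = branch M q (w ^ M)" .
  moreover have "q < 2 * M" "odd q \<longleftrightarrow> p" using j(1) by (auto simp: q_def)
  ultimately show ?thesis by blast
qed

section \<open>The surface of a cyclic one-factorization\<close>

datatype 'v cell = Vx 'v | Fc nat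

text \<open>An injective holomorphic map has a holomorphic inverse, so each kind of gluing has to be
  examined from one side only.\<close>

lemma glue_sym:
  assumes S: "open S" "F holomorphic_on S" and P: "\<And>x y. P x y \<longleftrightarrow> x \<in> S \<and> y = F x"
    and inj: "\<And>x x' y. P x y \<Longrightarrow> P x' y \<Longrightarrow> x = x'"
  shows "\<exists>S F. open S \<and> F holomorphic_on S \<and> (\<forall>y x. P x y \<longleftrightarrow> y \<in> S \<and> x = F y)"
proof -
  have F: "inj_on F S"
  proof (rule inj_onI)
    fix x x' assume "x \<in> S" "x' \<in> S" "F x = F x'"
    then show "x = x'" using P by (intro inj[of x "F x"]) simp_all
  qed
  obtain g where g: "g holomorphic_on F ` S" "\<And>x. x \<in> S \<Longrightarrow> g (F x) = x"
    using holomorphic_has_inverse[OF S(2,1) F] by metis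
  have "open (F ` S)" by (rule open_mapping_thm3[OF S(2,1) F])
  moreover have "P x y \<longleftrightarrow> y \<in> F ` S \<and> x = g y" for x y using P g(2) by auto
  ultimately show ?thesis using g(1) by blast
qed

context cyclic_factorization
begin

lemma M_pos: "0 < M" using card_blacks_ge_2 by simp

text \<open>A numbering of the vertices, by which the points of the surface fit into
  \<open>nat \<times> complex\<close>.\<close>

definition enc :: "'v \<Rightarrow> nat" where "enc = to_nat_on V"

lemma enc_inj: "v \<in> V \<Longrightarrow> w \<in> V \<Longrightarrow> enc v = enc w \<longleftrightarrow> v = w"
  unfolding enc_def using countable_finite[OF fin] by (rule to_nat_on_inj)

text \<open>The covering of the Riemann sphere in the chart at \<open>v\<close>. At a white vertex
  \<open>inverse 0 = 0\<close> stands in for infinity, so the value 0 occurs exactly at the vertex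
  itself.\<close>

definition dir :: "'v \<Rightarrow> complex \<Rightarrow> complex" where
  "dir v z = (if black v then z else inverse z)"

text \<open>A root of the sector coordinate minus its branch point 1; the sheet is chosen by the
  position of \<open>v\<close> on the cycle of face \<open>i\<close>.\<close>

definition face_pt :: "nat \<Rightarrow> 'v \<Rightarrow> complex \<Rightarrow> complex" where
  "face_pt i v d = branch M (pos i v) (turn n (real i + 1/2) d - 1)"

text \<open>Edges are named by their black ends, so that the charts at both ends give an edge point
  the same name.\<close>

definition black_end :: "nat \<Rightarrow> 'v \<Rightarrow> 'v" where
  "black_end j v = (if black v then v else \<mu> j v)"

abbreviation sector :: "nat \<Rightarrow> complex set" where "sector i \<equiv> wedge n (real i + 1/2)"

abbreviation sector_dom :: "'v \<Rightarrow> nat \<Rightarrow> complex set" where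
  "sector_dom v i \<equiv> {z \<in> slit n. dir v z \<in> sector i}"

text \<open>Points of face \<open>i\<close> have first component \<open>2 i + 1\<close>; points of the graph have an even first
  component, which encodes the vertex or the black end of the edge.\<close>

definition chart_map :: "'v cell \<Rightarrow> complex \<Rightarrow> point" where
  "chart_map a z = (case a of Fc i \<Rightarrow> (2 * i + 1, z)
     | Vx v \<Rightarrow> if z = 0 then (2 * enc v, 0)
         else if \<exists>i<n. dir v z \<in> sector i
           then (let i = THE i. i < n \<and> dir v z \<in> sector i in (2 * i + 1, face_pt i v (dir v z)))
         else (2 * enc (black_end (THE j. j < n \<and> dir v z \<in> wedge n (real j)) v), dir v z))"

text \<open>The \<open>M\<close>-fold cover of the sector branched over 1, in which \<open>w\<close>
  lies over \<open>1 + w ^ M\<close>.\<close>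

definition face_dom :: "complex set" where "face_dom = {w. 1 + w ^ M \<in> Sect n}"

definition chart_dom :: "'v cell \<Rightarrow> complex set" where
  "chart_dom a = (case a of Vx v \<Rightarrow> slit n | Fc i \<Rightarrow> face_dom)"

definition cells :: "'v cell set" where "cells = Vx ` V \<union> Fc ` {..<n}"

lemma chart_dom_simps [simp]: "chart_dom (Vx v) = slit n" "chart_dom (Fc i) = face_dom" by (simp_all add: chart_dom_def)

lemma dir_eq_0 [simp]: "dir v z = 0 \<longleftrightarrow> z = 0" by (simp add: dir_def)

lemma dir_0 [simp]: "dir v 0 = 0" by (simp add: dir_def)

lemma dir_dir [simp]: "dir v (dir v z) = z" by (simp add: dir_def)

lemma dir_inj: "black v = black w \<Longrightarrow> dir v z = dir w z' \<Longrightarrow> z = z'"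
  by (simp add: dir_def split: if_splits)

lemma map_Fc [simp]: "chart_map (Fc i) z = (2 * i + 1, z)" by (simp add: chart_map_def)

lemma map_zero [simp]: "chart_map (Vx v) 0 = (2 * enc v, 0)" by (simp add: chart_map_def)

lemma map_sector:
  assumes i: "i < n" and d: "dir v z \<in> sector i"
  shows "chart_map (Vx v) z = (2 * i + 1, face_pt i v (dir v z))"
proof -
  have "z \<noteq> 0" using d zero_notin_wedge[OF n2, of "real i + 1/2"] by auto
  moreover have "(THE i. i < n \<and> dir v z \<in> sector i) = i"
    by (rule the_equality) (use assms half_wedge_unique[OF n2] in blast)+
  ultimately show ?thesis using assms by (auto simp: chart_map_def)
qed

lemma map_ray:
  assumes j: "j < n" "r > 0" and d: "dir v z = pt n r (real j)"
  shows "chart_map (Vx v) z = (2 * enc (black_end j v), dir v z)"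
proof -
  have "dir v z \<noteq> 0" using d j by simp
  then have "z \<noteq> 0" by simp
  moreover have "\<not> (\<exists>i<n. dir v z \<in> sector i)" unfolding d using ray_not_half_wedge[OF n2 j(2)] by blast
  moreover have "(THE j. j < n \<and> dir v z \<in> wedge n (real j)) = j"
  proof (rule the_equality)
    show "j < n \<and> dir v z \<in> wedge n (real j)" unfolding d using j ray_wedge[OF n2] by blast
    then show "j' = j" if "j' < n \<and> dir v z \<in> wedge n (real j')" for j'
      using that wedge_unique[OF n2] by blast
  qed
  ultimately show ?thesis by (auto simp: chart_map_def)
qed

lemma dir_cases:
  obtains (zero) "z = 0"
    | (sector) i where "i < n" "dir v z \<in> sector i"
    | (ray) j r where "j < n" "r > 0" "dir v z = pt n r (real j)"
proof (cases "z = 0")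
  case False
  then have "dir v z \<noteq> 0" by simp
  then show ?thesis by (rule direction_cases[OF n2]) (use that in auto)
qed (rule zero)

text \<open>The parity of the position equals the colour of \<open>v\<close>, so the logarithm
  inside \<open>branch\<close> is cut exactly along the half-line that the slit removes.\<close>

lemma dir_slit_not_cut:
  assumes v: "v \<in> V" and i: "i < n" and z: "z \<in> slit n" and d: "dir v z \<in> sector i"
  shows "(-1) ^ pos i v * (turn n (real i + 1/2) (dir v z) - 1) \<notin> \<real>\<^sub>\<le>\<^sub>0"
proof (cases "black v")
  case True
  then have "odd (pos i v)" using odd_pos[OF i v] by simp
  then show ?thesis using half_wedge_slit(1)[OF n2 d] z True by (auto simp: complex_nonpos_Reals_iff dir_def)
next
  case False
  then have "even (pos i v)" using odd_pos[OF i v] by simp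
  then show ?thesis using half_wedge_slit(2)[OF n2 d] z False by (auto simp: complex_nonpos_Reals_iff dir_def)
qed

lemma face_pt_power:
  assumes "v \<in> V" "i < n" "z \<in> slit n" "dir v z \<in> sector i"
  shows "face_pt i v (dir v z) ^ M = turn n (real i + 1/2) (dir v z) - 1"
proof -
  have "turn n (real i + 1/2) (dir v z) - 1 \<noteq> 0"
    using dir_slit_not_cut[OF assms] by (auto simp: complex_nonpos_Reals_iff)
  then show ?thesis unfolding face_pt_def by (rule branch_power[OF M_pos])
qed

lemma face_pt_dom:
  assumes "v \<in> V" "i < n" "z \<in> slit n" "dir v z \<in> sector i"
  shows "face_pt i v (dir v z) \<in> face_dom"
  using assms(4) by (simp add: face_dom_def face_pt_power[OF assms] wedge_def)

lemma face_pt_holomorphic: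
  assumes "v \<in> V" "i < n"
  shows "open (sector_dom v i)"
    and "(\<lambda>z. face_pt i v (dir v z)) holomorphic_on (sector_dom v i)"
proof -
  have "(sector_dom v i) = slit n \<inter> wedge n (if black v then real i + 1/2 else - (real i + 1/2))"
    by (auto simp: dir_def wedge_inverse[OF n2])
  then show "open (sector_dom v i)"
    by (simp add: open_Int open_slit[OF n2] open_wedge[OF n2])
  have "dir v holomorphic_on (sector_dom v i)"
  proof (cases "black v")
    case True then show ?thesis by (simp add: dir_def[abs_def] holomorphic_on_ident)
  next
    case False
    have "z \<noteq> 0" if "z \<in> (sector_dom v i)" for z
      using that zero_notin_wedge[OF n2, of "real i + 1/2"] by auto
    then have "inverse holomorphic_on (sector_dom v i)" by (intro holomorphic_intros) auto
    then show ?thesis using False by (simp add: dir_def[abs_def])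
  qed
  then show "(\<lambda>z. face_pt i v (dir v z)) holomorphic_on (sector_dom v i)"
    unfolding face_pt_def branch_def
    using dir_slit_not_cut[OF assms] M_pos
    by (intro holomorphic_intros) (auto simp: turn_def intro!: holomorphic_intros)
qed

section \<open>Gluing relations between the charts\<close>

text \<open>Parity of the first component rules out the vertex and its edges, which leaves the
  sector on which the chart is given by \<open>face_pt\<close>.\<close>

lemma glue_vertex_face:
  assumes "v \<in> V" "i < n"
  shows "z \<in> slit n \<and> w \<in> face_dom \<and> chart_map (Vx v) z = chart_map (Fc i) w \<longleftrightarrow>
    z \<in> (sector_dom v i) \<and> w = face_pt i v (dir v z)"
proof
  assume L: "z \<in> slit n \<and> w \<in> face_dom \<and> chart_map (Vx v) z = chart_map (Fc i) w"
  show "z \<in> (sector_dom v i) \<and> w = face_pt i v (dir v z)"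
  proof (cases rule: dir_cases[where v = v and z = z])
    case zero
    then have "2 * enc v = 2 * i + 1" using L by simp
    then show ?thesis by presburger
  next
    case (sector i')
    then show ?thesis using L map_sector[OF sector] by auto
  next
    case (ray j r)
    then have "2 * enc (black_end j v) = 2 * i + 1" using L map_ray[OF ray] by simp
    then show ?thesis by presburger
  qed
next
  assume "z \<in> (sector_dom v i) \<and> w = face_pt i v (dir v z)"
  then show "z \<in> slit n \<and> w \<in> face_dom \<and> chart_map (Vx v) z = chart_map (Fc i) w"
    using map_sector[OF assms(2)] face_pt_dom[OF assms] by auto
qed

lemma turn_inj: "turn n x z = turn n x z' \<Longrightarrow> z = z'"
  by (metis turn_inverse)

lemma black_end_mem: "j < n \<Longrightarrow> v \<in> V \<Longrightarrow> black_end j v \<in> V"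
  by (simp add: black_end_def mem)

lemma double_odd_ne: "2 * a \<noteq> 2 * b + (1::nat)" "2 * b + (1::nat) \<noteq> 2 * a" by presburger+

text \<open>On a face, \<open>M\<close>-th powers recover the direction, and sheets of one parity
  are told apart by their positions, hence by their vertices. On an edge, the black end together
  with the colour determines either end.\<close>

lemma glue_same_colour:
  assumes v: "v \<in> V" "w \<in> V" "black v = black w" and z: "z \<in> slit n" "z' \<in> slit n"
    and eq: "chart_map (Vx v) z = chart_map (Vx w) z'"
  shows "v = w \<and> z = z'"
proof (cases rule: dir_cases[where v = v and z = z])
  case zero
  show ?thesis
  proof (cases rule: dir_cases[where v = w and z = z'])
    case zero then show ?thesis using \<open>z = 0\<close> eq enc_inj v by simp
  next
    case (sector i) then show ?thesis using eq zero map_sector[OF sector] double_odd_ne by simp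
  next
    case (ray j r) then show ?thesis using eq zero map_ray[OF ray] by simp
  qed
next
  case (sector i)
  note zi = map_sector[OF sector]
  show ?thesis
  proof (cases rule: dir_cases[where v = w and z = z'])
    case zero then show ?thesis using eq zi double_odd_ne by simp
  next
    case (sector i')
    have ii: "i' = i" and fp: "face_pt i v (dir v z) = face_pt i w (dir w z')"
      using eq zi map_sector[OF sector] by auto
    have d: "dir v z \<in> wedge n (real i + 1/2)" "dir w z' \<in> wedge n (real i + 1/2)" "i < n"
      using sector \<open>dir v z \<in> _\<close> ii by auto
    have "turn n (real i + 1/2) (dir v z) - 1 = turn n (real i + 1/2) (dir w z') - 1"
      using fp face_pt_power[OF v(1) d(3) z(1) d(1)] face_pt_power[OF v(2) d(3) z(2) d(2)] by simp
    then have dd: "dir v z = dir w z'" using turn_inj by auto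
    then have "z = z'" using dir_inj v by blast
    moreover have "pos i v = pos i w"
      by (rule branch_eq_same_parity[OF M_pos])
        (use fp pos_less[OF d(3)] odd_pos[OF d(3)] v in \<open>auto simp: face_pt_def dd\<close>)
    ultimately show ?thesis using pos_inj d v by blast
  next
    case (ray j r) then show ?thesis using eq zi map_ray[OF ray] double_odd_ne by simp
  qed
next
  case (ray j r)
  note zr = map_ray[OF ray] ray
  show ?thesis
  proof (cases rule: dir_cases[where v = w and z = z'])
    case zero then show ?thesis using eq zr by simp
  next
    case (sector i') then show ?thesis using eq zr map_sector[OF sector] double_odd_ne by simp
  next
    case (ray j' r')
    have e: "enc (black_end j v) = enc (black_end j' w)" and d: "dir v z = dir w z'" using eq zr map_ray[OF ray] by auto
    have "j = j'" using ray_unique[OF n2, of r r' j j'] d zr ray by simp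
    then have "black_end j v = black_end j w" using e enc_inj black_end_mem v ray by auto
    then have "v = w" using v invol[OF ray(1)] \<open>j = j'\<close> by (metis black_end_def)
    then show ?thesis using dir_inj d by blast
  qed
qed

text \<open>In the half of sector \<open>i\<close> next to ray \<open>i\<close> the black sheet
  continues into the following position, the neighbour along matching \<open>i\<close>; in the other
  half it continues into the preceding one, the neighbour along \<open>Suc i mod n\<close>. Such
  halves on both sides of a ray, with the ray itself, form the wedge around an edge.\<close>

lemma glue_opposite:
  assumes v: "v \<in> V" "black v" "w \<in> V" "\<not> black w" and z: "z \<in> slit n" "z' \<in> slit n"
  shows "chart_map (Vx v) z = chart_map (Vx w) z' \<longleftrightarrow>
    (\<exists>j<n. w = \<mu> j v \<and> z \<in> wedge n (real j) \<and> z' = inverse z)" (is "?L \<longleftrightarrow> ?R")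
proof
  assume ?R
  then obtain j where j: "j < n" "w = \<mu> j v" "z \<in> wedge n (real j)" "z' = inverse z" by blast
  have d: "dir v z = z" "dir w z' = z" using v j by (auto simp: dir_def)
  have vb: "v \<in> blacks" using v by (simp add: blacks_def)
  show ?L
  proof (cases rule: wedge_cases[OF n2 j(1,3)])
    case (1 r)
    then show ?thesis using map_ray[OF j(1), of r v z] map_ray[OF j(1), of r w z'] d v j invol
      by (simp add: black_end_def)
  next
    case 2
    let ?c = "turn n (real j + 1/2) z - 1"
    have p: "pos j v < 2 * M" "pos j w < 2 * M" "odd (pos j v)" "even (pos j w)"
      using pos_less[OF j(1)] odd_pos[OF j(1)] v by auto
    have "branch M (pos j v) ?c = branch M (pos j w) ?c"
      using branch_eq_opposite_parity[OF M_pos p, of ?c] 2 pos_match(1)[OF j(1) vb] j(2) by simp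
    then show ?thesis
      using map_sector[OF j(1), of v z] map_sector[OF j(1), of w z'] d 2 by (simp add: face_pt_def)
  next
    case (3 i)
    let ?c = "turn n (real i + 1/2) z - 1"
    have p: "pos i v < 2 * M" "pos i w < 2 * M" "odd (pos i v)" "even (pos i w)"
      using pos_less[OF 3(1)] odd_pos[OF 3(1)] v by auto
    have "branch M (pos i v) ?c = branch M (pos i w) ?c"
      using branch_eq_opposite_parity[OF M_pos p, of ?c] 3 pos_match(2)[OF 3(1) vb] j(2) by simp
    then show ?thesis
      using map_sector[OF 3(1), of v z] map_sector[OF 3(1), of w z'] d 3 by (simp add: face_pt_def)
  qed
next
  assume eq: ?L
  have d: "dir v z = z" "dir w z' = inverse z'" using v by (auto simp: dir_def)
  show ?R
  proof (cases rule: dir_cases[where v = v and z = z])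
    case zero
    show ?thesis
    proof (cases rule: dir_cases[where v = w and z = z'])
      case zero then show ?thesis using \<open>z = 0\<close> eq enc_inj v by auto
    next
      case (sector i) then show ?thesis using eq zero map_sector[OF sector] double_odd_ne by simp
    next
      case (ray j r) then show ?thesis using eq zero map_ray[OF ray] by simp
    qed
  next
    case (sector i)
    note zi = map_sector[OF sector]
    show ?thesis
    proof (cases rule: dir_cases[where v = w and z = z'])
      case zero then show ?thesis using eq zi double_odd_ne by simp
    next
      case (sector i')
      have ii: "i' = i" and fp: "face_pt i v (dir v z) = face_pt i w (dir w z')"
        using eq zi map_sector[OF sector] by auto
      have dd: "dir v z \<in> wedge n (real i + 1/2)" "dir w z' \<in> wedge n (real i + 1/2)" and i: "i < n"
        using sector \<open>dir v z \<in> _\<close> ii by auto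
      have "turn n (real i + 1/2) (dir v z) - 1 = turn n (real i + 1/2) (dir w z') - 1"
        using fp face_pt_power[OF v(1) i z(1) dd(1)] face_pt_power[OF v(3) i z(2) dd(2)] by simp
      then have zz: "z = inverse z'" using turn_inj d by auto
      then have z': "z' = inverse z" by simp
      let ?c = "turn n (real i + 1/2) z - 1"
      \<comment> \<open>A real sector coordinate would lie on one of the two slits.\<close>
      have im: "Im ?c \<noteq> 0" using half_wedge_slit[OF n2, of z i] dd(1) d z z' by auto
      have "branch M (pos i v) ?c = branch M (pos i w) ?c" using fp d zz by (simp add: face_pt_def)
      moreover have "pos i v < 2 * M" "pos i w < 2 * M" "odd (pos i v)" "even (pos i w)"
        using pos_less[OF i] odd_pos[OF i] v by auto
      ultimately have *: "if Im ?c > 0 then Suc (pos i w) = pos i v else pos i w = Suc (pos i v) mod (2 * M)"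
        using branch_eq_opposite_parity[OF M_pos _ _ _ _ im, of "pos i v" "pos i w"] by blast
      have vb: "v \<in> blacks" using v by (simp add: blacks_def)
      show ?thesis
      proof (cases "Im ?c > 0")
        case True
        then have "pos i w = pos i (\<mu> (Suc i mod n) v)" using * pos_match(2)[OF i vb] by simp
        then have "w = \<mu> (Suc i mod n) v" using pos_inj[OF i v(3)] mem[OF Suc_mod_less v(1)] by blast
        moreover have "z \<in> wedge n (real (Suc i mod n))"
          using half_wedge_upper[OF n2 i, of z] dd(1) d True by simp
        ultimately show ?thesis using Suc_mod_less z' by blast
      next
        case False
        then have "pos i w = pos i (\<mu> i v)" using * pos_match(1)[OF i vb] by simp
        then have "w = \<mu> i v" using pos_inj[OF i v(3)] mem[OF i v(1)] by blast
        moreover have "z \<in> wedge n (real i)"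
          using half_wedge_lower[OF n2 i, of z] dd(1) d False im by simp
        ultimately show ?thesis using i z' by blast
      qed
    next
      case (ray j r) then show ?thesis using eq zi map_ray[OF ray] double_odd_ne by simp
    qed
  next
    case (ray j r)
    note zr = map_ray[OF ray] ray
    show ?thesis
    proof (cases rule: dir_cases[where v = w and z = z'])
      case zero then show ?thesis using eq zr by simp
    next
      case (sector i') then show ?thesis using eq zr map_sector[OF sector] double_odd_ne by simp
    next
      case (ray j' r')
      have e: "enc (black_end j v) = enc (black_end j' w)" and dd: "dir v z = dir w z'" using eq zr map_ray[OF ray] by auto
      have "j = j'" using ray_unique[OF n2, of r r' j j'] dd zr ray by simp
      then have "black_end j v = black_end j w" using e enc_inj black_end_mem v ray by auto
      then have "w = \<mu> j v" using v invol[OF ray(1), of w] \<open>j = j'\<close> by (simp add: black_end_def)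
      moreover have "z \<in> wedge n (real j)" using zr d ray_wedge[OF n2] by simp
      ultimately show ?thesis using zr dd d by (metis inverse_inverse_eq)
    qed
  qed
qed

text \<open>By \<open>proper\<close> at most one colour joins two given vertices, so the overlap is
  a single wedge.\<close>

lemma glue_opposite_ex:
  assumes v: "v \<in> V" "black v" "w \<in> V" "\<not> black w"
  shows "\<exists>S F. open S \<and> F holomorphic_on S \<and>
    (\<forall>x y. x \<in> slit n \<and> y \<in> slit n \<and> chart_map (Vx v) x = chart_map (Vx w) y \<longleftrightarrow> x \<in> S \<and> y = F x)"
proof (cases "\<exists>j<n. w = \<mu> j v")
  case True
  then obtain j where j: "j < n" "w = \<mu> j v" by blast
  have "open (wedge n (real j))" by (rule open_wedge[OF n2])
  moreover have "inverse holomorphic_on wedge n (real j)"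
    using zero_notin_wedge[OF n2, of "real j"] by (intro holomorphic_intros) auto
  moreover have "x \<in> slit n \<and> y \<in> slit n \<and> chart_map (Vx v) x = chart_map (Vx w) y \<longleftrightarrow>
      x \<in> wedge n (real j) \<and> y = inverse x" for x y
  proof
    assume L: "x \<in> slit n \<and> y \<in> slit n \<and> chart_map (Vx v) x = chart_map (Vx w) y"
    then obtain j' where j': "j' < n" "w = \<mu> j' v" "x \<in> wedge n (real j')" "y = inverse x"
      using glue_opposite[OF v, of x y] by blast
    have "\<mu> j' v = \<mu> j v" using j'(2) j(2) by simp
    then have "j' = j" by (rule proper[OF j'(1) j(1) v(1)])
    then show "x \<in> wedge n (real j) \<and> y = inverse x" using j'(3,4) by simp
  next
    assume R: "x \<in> wedge n (real j) \<and> y = inverse x"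
    then have "x \<in> slit n" "y \<in> slit n" using wedge_int_slit[OF n2] by auto
    then show "x \<in> slit n \<and> y \<in> slit n \<and> chart_map (Vx v) x = chart_map (Vx w) y"
      using glue_opposite[OF v, of x y] R j by blast
  qed
  ultimately show ?thesis by blast
next
  case False
  then have "\<not> (x \<in> slit n \<and> y \<in> slit n \<and> chart_map (Vx v) x = chart_map (Vx w) y)" for x y
    using glue_opposite[OF v, of x y] by blast
  then show ?thesis by (intro exI[of _ "{}"] exI[of _ id]) auto
qed

lemma chart_map_inj:
  assumes "a \<in> cells" "x \<in> chart_dom a" "y \<in> chart_dom a" "chart_map a x = chart_map a y" shows "x = y"
proof (cases a)
  case (Vx v)
  then have "v \<in> V" using assms(1) by (auto simp: cells_def)
  then show ?thesis using glue_same_colour[of v v x y] assms(2-4) Vx by simp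
next
  case (Fc i) then show ?thesis using assms(4) by simp
qed

lemma glue_cells:
  assumes a: "a \<in> cells" and b: "b \<in> cells"
  shows "\<exists>S F. open S \<and> F holomorphic_on S \<and>
    (\<forall>x y. x \<in> chart_dom a \<and> y \<in> chart_dom b \<and> chart_map a x = chart_map b y \<longleftrightarrow> x \<in> S \<and> y = F x)"
proof -
  have sym: ?thesis if "\<exists>S F. open S \<and> F holomorphic_on S \<and>
    (\<forall>y x. y \<in> chart_dom b \<and> x \<in> chart_dom a \<and> chart_map b y = chart_map a x \<longleftrightarrow> y \<in> S \<and> x = F y)"
  proof -
    obtain S F where S: "open S" "F holomorphic_on S"
      and SF: "\<And>y x. y \<in> chart_dom b \<and> x \<in> chart_dom a \<and> chart_map b y = chart_map a x \<longleftrightarrow> y \<in> S \<and> x = F y"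
      using \<open>\<exists>S F. _\<close> by blast
    have "\<exists>S F. open S \<and> F holomorphic_on S \<and>
       (\<forall>x y. (y \<in> chart_dom b \<and> x \<in> chart_dom a \<and> chart_map b y = chart_map a x) \<longleftrightarrow> x \<in> S \<and> y = F x)"
    proof (rule glue_sym[OF S SF])
      fix y y' x
      assume "y \<in> chart_dom b \<and> x \<in> chart_dom a \<and> chart_map b y = chart_map a x"
        "y' \<in> chart_dom b \<and> x \<in> chart_dom a \<and> chart_map b y' = chart_map a x"
      then show "y = y'" using chart_map_inj[OF b, of y y'] by simp
    qed
    then show ?thesis by (metis (no_types, lifting))
  qed
  show ?thesis
  proof (cases a; cases b)
    fix v w assume ab: "a = Vx v" "b = Vx w"
    then have vw: "v \<in> V" "w \<in> V" using a b by (auto simp: cells_def)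
    consider "v = w" | "v \<noteq> w" "black v = black w" | "black v" "\<not> black w" | "\<not> black v" "black w" by blast
    then show ?thesis
    proof cases
      case 1
      have "(x \<in> chart_dom a \<and> y \<in> chart_dom b \<and> chart_map a x = chart_map b y) \<longleftrightarrow> x \<in> slit n \<and> y = x" for x y
        using chart_map_inj[OF a, of x y] 1 ab by auto
      then show ?thesis using open_slit[OF n2] holomorphic_on_ident by blast
    next
      case 2
      have "\<not> (x \<in> chart_dom a \<and> y \<in> chart_dom b \<and> chart_map a x = chart_map b y)" for x y
        using glue_same_colour[OF vw 2(2), of x y] 2(1) ab by auto
      then show ?thesis by (intro exI[of _ "{}"] exI[of _ id]) auto
    next
      case 3
      show ?thesis using glue_opposite_ex[OF vw(1) 3(1) vw(2) 3(2)] ab by simp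
    next
      case 4
      show ?thesis by (rule sym) (use glue_opposite_ex[OF vw(2) 4(2) vw(1) 4(1)] ab in simp)
    qed
  next
    fix v i assume ab: "a = Vx v" "b = Fc i"
    then have vi: "v \<in> V" "i < n" using a b by (auto simp: cells_def)
    show ?thesis unfolding ab chart_dom_simps using glue_vertex_face[OF vi] face_pt_holomorphic[OF vi] by blast
  next
    fix v i assume ab: "b = Vx v" "a = Fc i"
    then have vi: "v \<in> V" "i < n" using a b by (auto simp: cells_def)
    show ?thesis
      by (rule sym, unfold ab chart_dom_simps) (use glue_vertex_face[OF vi] face_pt_holomorphic[OF vi] in blast)
  next
    fix i j assume ab: "a = Fc i" "b = Fc j"
    show ?thesis
    proof (cases "i = j")
      case True
      have "open face_dom"
      proof -
        have "open ((\<lambda>w. 1 + w ^ M) -` Sect n)"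
          by (intro open_vimage open_Sect[OF n2] continuous_intros)
        then show ?thesis by (simp add: face_dom_def vimage_def)
      qed
      moreover have "(x \<in> chart_dom a \<and> y \<in> chart_dom b \<and> chart_map a x = chart_map b y) \<longleftrightarrow> x \<in> face_dom \<and> y = x" for x y
        using ab True by auto
      ultimately show ?thesis using holomorphic_on_ident by blast
    next
      case False
      then have "\<not> (x \<in> chart_dom a \<and> y \<in> chart_dom b \<and> chart_map a x = chart_map b y)" for x y using ab by simp
      then show ?thesis by (intro exI[of _ "{}"] exI[of _ id]) auto
    qed
  qed
qed

text \<open>The relation \<open>x * y = 1\<close> survives in the limit, so \<open>x\<close> and its
  inverse avoid the slits and \<open>x\<close> lies in some open wedge. The sequence enters this
  wedge, which must therefore be the one belonging to the edge.\<close>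

lemma closed_glue_opposite:
  assumes v: "v \<in> V" "black v" "w \<in> V" "\<not> black w" and x: "x \<in> slit n" and y: "y \<in> slit n"
    and XY: "\<And>k::nat. X k \<in> slit n \<and> Y k \<in> slit n \<and> chart_map (Vx v) (X k) = chart_map (Vx w) (Y k)"
    and lim: "X \<longlonglongrightarrow> x" "Y \<longlonglongrightarrow> y"
  shows "chart_map (Vx v) x = chart_map (Vx w) y"
proof -
  have R: "\<exists>j<n. w = \<mu> j v \<and> X k \<in> wedge n (real j) \<and> Y k = inverse (X k)" for k
    using glue_opposite[OF v, of "X k" "Y k"] XY[of k] by blast
  obtain j where j: "j < n" "w = \<mu> j v" using R[of 0] by blast
  have Xj: "X k \<in> wedge n (real j)" "Y k = inverse (X k)" for k
  proof -
    obtain j' where j': "j' < n" "w = \<mu> j' v" "X k \<in> wedge n (real j')" "Y k = inverse (X k)" using R[of k] by blast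
    have "\<mu> j' v = \<mu> j v" using j'(2) j(2) by simp
    then have "j' = j" by (rule proper[OF j'(1) j(1) v(1)])
    then show "X k \<in> wedge n (real j)" "Y k = inverse (X k)" using j' by auto
  qed
  have "X k * Y k = 1" for k
  proof -
    have "X k \<noteq> 0" using Xj(1)[of k] zero_notin_wedge[OF n2, of "real j"] by metis
    then show ?thesis by (simp add: Xj(2))
  qed
  then have "(\<lambda>k. X k * Y k) \<longlonglongrightarrow> 1" by simp
  moreover have "(\<lambda>k. X k * Y k) \<longlonglongrightarrow> x * y" by (intro tendsto_mult lim)
  ultimately have xy: "x * y = 1" using LIMSEQ_unique by blast
  then have "x \<noteq> 0" and yx: "y = inverse x" by (auto simp: inverse_unique)
  then obtain j' where j': "j' < n" "x \<in> wedge n (real j')"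
    using slit_inverse_wedge[OF n2, of x] x y by blast
  have "eventually (\<lambda>k. X k \<in> wedge n (real j')) sequentially"
    by (rule topological_tendstoD[OF lim(1) open_wedge[OF n2] j'(2)])
  then obtain k where "X k \<in> wedge n (real j')" by (auto simp: eventually_sequentially)
  then have "j' = j" using wedge_unique[OF n2 _ Xj(1)] j j' by blast
  then show ?thesis using glue_opposite[OF v x y] j j' yx by blast
qed

text \<open>The map to the sphere extends over the whole face as \<open>1 + w ^ M\<close>. The limit
  direction is thus determined by \<open>y\<close> and still lies in the open sector, where
  \<open>face_pt\<close> is continuous.\<close>

lemma closed_glue_vertex_face:
  assumes v: "v \<in> V" "i < n" and x: "x \<in> slit n" and y: "y \<in> face_dom"
    and XY: "\<And>k::nat. X k \<in> slit n \<and> Y k \<in> face_dom \<and> chart_map (Vx v) (X k) = chart_map (Fc i) (Y k)"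
    and lim: "X \<longlonglongrightarrow> x" "Y \<longlonglongrightarrow> y"
  shows "chart_map (Vx v) x = chart_map (Fc i) y"
proof -
  let ?S = "(sector_dom v i)" and ?t = "real i + 1/2"
  have R: "X k \<in> ?S" "Y k = face_pt i v (dir v (X k))" for k
    using glue_vertex_face[OF v, of "X k" "Y k"] XY[of k] by auto
  have "turn n ?t (dir v (X k)) = 1 + Y k ^ M" for k
    using R[of k] face_pt_power[OF v, of "X k"] by simp
  then have dX: "dir v (X k) = pt n 1 ?t * (1 + Y k ^ M)" for k using turn_inverse by metis
  define d where "d = pt n 1 ?t * (1 + y ^ M)"
  have "turn n ?t d = 1 + y ^ M"
    using pt_mult[of n 1 ?t 1 "- ?t"] by (simp add: d_def turn_def mult_ac)
  then have d: "d \<in> sector i" using y by (simp add: wedge_def face_dom_def)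
  then have d0: "d \<noteq> 0" using zero_notin_wedge[OF n2] by metis
  have "(\<lambda>k. dir v (X k)) \<longlonglongrightarrow> d" unfolding dX d_def by (intro tendsto_intros lim)
  then have "(\<lambda>k. dir v (dir v (X k))) \<longlonglongrightarrow> dir v d"
    using d0 tendsto_inverse[of "\<lambda>k. dir v (X k)" d sequentially] by (cases "black v") (simp_all add: dir_def)
  then have "x = dir v d" using LIMSEQ_unique lim(1) by simp
  then have xS: "x \<in> ?S" using x d by simp
  have "continuous_on ?S (\<lambda>z. face_pt i v (dir v z))"
    using face_pt_holomorphic(2)[OF v] by (rule holomorphic_on_imp_continuous_on)
  then have "(\<lambda>k. face_pt i v (dir v (X k))) \<longlonglongrightarrow> face_pt i v (dir v x)"
    using R(1) xS lim(1) unfolding continuous_on_sequentially o_def by blast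
  moreover have "Y = (\<lambda>k. face_pt i v (dir v (X k)))" using R(2) by auto
  ultimately have "y = face_pt i v (dir v x)" using LIMSEQ_unique lim(2) by blast
  then show ?thesis using glue_vertex_face[OF v, of x y] xS by blast
qed

sublocale surf: holomorphic_gluing cells chart_dom chart_map
proof
  show "finite cells" using fin by (simp add: cells_def)
  fix a assume a: "a \<in> cells"
  show "inj_on (chart_map a) (chart_dom a)" using chart_map_inj[OF a] by (rule inj_onI)
  \<comment> \<open>Gluing a chart with itself shows that its domain is open.\<close>
  obtain S F where "open S" "\<And>x y. x \<in> chart_dom a \<and> y \<in> chart_dom a \<and> chart_map a x = chart_map a y \<longleftrightarrow> x \<in> S \<and> y = F x"
    using glue_cells[OF a a] by blast
  moreover from this have "chart_dom a = S" by blast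
  ultimately show "open (chart_dom a)" by simp
  fix b assume b: "b \<in> cells"
  show "\<exists>S F. open S \<and> F holomorphic_on S \<and>
    (\<forall>x y. (x \<in> chart_dom a \<and> y \<in> chart_dom b \<and> chart_map a x = chart_map b y) = (x \<in> S \<and> y = F x))"
    by (rule glue_cells[OF a b])
  fix x y and X Y :: "nat \<Rightarrow> complex"
  assume xy: "x \<in> chart_dom a" "y \<in> chart_dom b" and XY: "\<And>k. X k \<in> chart_dom a \<and> Y k \<in> chart_dom b \<and> chart_map a (X k) = chart_map b (Y k)"
    and lim: "X \<longlonglongrightarrow> x" "Y \<longlonglongrightarrow> y"
  show "chart_map a x = chart_map b y"
  proof (cases a; cases b)
    fix v w assume ab: "a = Vx v" "b = Vx w"
    then have vw: "v \<in> V" "w \<in> V" using a b by (auto simp: cells_def)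
    consider "black v = black w" | "black v" "\<not> black w" | "\<not> black v" "black w" by blast
    then show ?thesis
    proof cases
      case 1
      have *: "v = w \<and> X k = Y k" for k using glue_same_colour[OF vw 1] XY[of k] ab by auto
      then have "X = Y" by auto
      then have "x = y" using lim LIMSEQ_unique by blast
      then show ?thesis using * ab by simp
    next
      case 2
      then show ?thesis using closed_glue_opposite[OF vw(1) 2(1) vw(2) 2(2), of x y X Y] xy XY lim ab by simp
    next
      case 3
      have "chart_map (Vx w) y = chart_map (Vx v) x"
        using closed_glue_opposite[OF vw(2) 3(2) vw(1) 3(1), of y x Y X] xy XY lim ab by auto
      then show ?thesis using ab by simp
    qed
  next
    fix v i assume ab: "a = Vx v" "b = Fc i"
    then have "v \<in> V" "i < n" using a b by (auto simp: cells_def)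
    then show ?thesis using closed_glue_vertex_face[of v i x y X Y] xy XY lim ab by simp
  next
    fix v i assume ab: "b = Vx v" "a = Fc i"
    then have "v \<in> V" "i < n" using a b by (auto simp: cells_def)
    then have "chart_map (Vx v) y = chart_map (Fc i) x"
      using closed_glue_vertex_face[of v i y x Y X] xy XY lim ab by simp
    then show ?thesis using ab by simp
  next
    fix i j assume ab: "a = Fc i" "b = Fc j"
    then have *: "i = j \<and> X k = Y k" for k using XY[of k] by simp
    then have "X = Y" by auto
      then have "x = y" using lim LIMSEQ_unique by blast
    then show ?thesis using * ab by simp
  qed
qed

abbreviation "Surf \<equiv> surf.glued"

lemma cellsI [intro]: "v \<in> V \<Longrightarrow> Vx v \<in> cells" "i < n \<Longrightarrow> Fc i \<in> cells"
  by (auto simp: cells_def)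

section \<open>Points of the surface and connectedness\<close>

text \<open>The branches whose parity belongs to the colour \<open>p\<close> exhaust all
  \<open>M\<close>-th roots, so some position of this parity yields \<open>w\<close> itself; the
  hypothesis on \<open>1 + w ^ M\<close> keeps the point off the slit of that colour.\<close>

lemma vertex_over_face_pt:
  assumes i: "i < n" and w: "w \<in> face_dom"
    and u: "if p then \<not> (Im (1 + w ^ M) = 0 \<and> Re (1 + w ^ M) \<ge> 1) else \<not> (Im (1 + w ^ M) = 0 \<and> Re (1 + w ^ M) \<le> 1)"
  shows "\<exists>v\<in>V. black v = p \<and> (\<exists>z\<in>slit n. dir v z = pt n 1 (real i + 1/2) * (1 + w ^ M) \<and> chart_map (Vx v) z = (2 * i + 1, w))"
proof -
  define d where "d = pt n 1 (real i + 1/2) * (1 + w ^ M)"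
  have td: "turn n (real i + 1/2) d = 1 + w ^ M"
    using pt_mult[of n 1 "real i + 1/2" 1 "- (real i + 1/2)"] by (simp add: d_def turn_def mult_ac)
  then have d: "d \<in> sector i" using w by (simp add: wedge_def face_dom_def)
  have "w \<noteq> 0" using u M_pos by (auto simp: power_0_left split: if_splits)
  then obtain q where q: "q < 2 * M" "odd q \<longleftrightarrow> p" "w = branch M q (w ^ M)" using ex_branch[OF M_pos] by blast
  define v where "v = cyc_vertex i q"
  have v: "v \<in> V" "black v = p" "pos i v = q"
    using cyc_vertex_mem[OF i, of q] pos_cyc_vertex[OF i q(1)] q(2) by (auto simp: v_def)
  define z where "z = dir v d"
  have dz: "dir v z = d" by (simp add: z_def)
  have "z \<in> slit n" using half_wedge_slit[OF n2 d] u v(2) unfolding td by (simp add: z_def dir_def split: if_splits)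
  moreover have "chart_map (Vx v) z = (2 * i + 1, w)"
    using map_sector[OF i, of v z] d q(3) by (simp add: dz face_pt_def td v(3))
  ultimately show ?thesis using v dz unfolding d_def[symmetric] by blast
qed

lemma ray_both_charts:
  assumes b: "b \<in> blacks" and j: "j < n" and r: "r > 0"
  shows "chart_map (Vx b) (pt n r (real j)) = (2 * enc b, pt n r (real j))"
    and "chart_map (Vx (\<mu> j b)) (pt n (1 / r) (- real j)) = (2 * enc b, pt n r (real j))"
    and "pt n r (real j) \<in> slit n" "pt n (1 / r) (- real j) \<in> slit n"
proof -
  have bV: "b \<in> V" "black b" using b by (auto simp: blacks_def)
  show "chart_map (Vx b) (pt n r (real j)) = (2 * enc b, pt n r (real j))"
    using map_ray[OF j r, of b "pt n r (real j)"] bV by (simp add: dir_def black_end_def)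
  have "inverse (pt n (1 / r) (- real j)) = pt n r (real j)" by (simp add: pt_inverse)
  then show "chart_map (Vx (\<mu> j b)) (pt n (1 / r) (- real j)) = (2 * enc b, pt n r (real j))"
    using map_ray[OF j r, of "\<mu> j b" "pt n (1 / r) (- real j)"] bV j
    by (simp add: dir_def black_end_def colour invol)
  show "pt n r (real j) \<in> slit n" "pt n (1 / r) (- real j) \<in> slit n"
    using wedge_int_slit[OF n2 ray_wedge[OF n2 r, of j]] by (simp_all add: pt_inverse)
qed

lemma points_cases:
  assumes "p \<in> surf.points"
  obtains (vertex) v where "v \<in> V" "p = (2 * enc v, 0)"
    | (edge) b j r where "b \<in> blacks" "j < n" "r > 0" "p = (2 * enc b, pt n r (real j))"
    | (face) i w where "i < n" "w \<in> face_dom" "p = (2 * i + 1, w)"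
proof -
  obtain a z where a: "a \<in> cells" "z \<in> chart_dom a" "p = chart_map a z" using assms by (auto simp: surf.points_def)
  show ?thesis
  proof (cases a)
    case (Fc i) then show ?thesis using a face[of i z] by (auto simp: cells_def)
  next
    case (Vx v)
    then have v: "v \<in> V" "z \<in> slit n" "p = chart_map (Vx v) z" using a by (auto simp: cells_def)
    show ?thesis
    proof (cases rule: dir_cases[where v = v and z = z])
      case zero then show ?thesis using vertex v by simp
    next
      case (sector i) then show ?thesis using face[of i] map_sector[OF sector] face_pt_dom[OF v(1) _ v(2), of i] v by simp
    next
      case (ray j r)
      have "black_end j v \<in> blacks" using v ray mem colour by (auto simp: black_end_def blacks_def)
      then show ?thesis using edge[of "black_end j v" j r] ray map_ray[OF ray] v by simp
    qed
  qed
qed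

text \<open>Scaling \<open>w\<close> by \<open>t\<close> replaces \<open>1 + w ^ M\<close> by a
  convex combination of it with 1, so convexity of the sector makes the face starlike about its
  branch point.\<close>

lemma connected_face_dom: "connected face_dom"
proof -
  have "starlike face_dom" unfolding starlike_def
  proof (intro bexI[of _ 0] ballI subsetI)
    fix z w assume z: "z \<in> face_dom" and "w \<in> closed_segment 0 z"
    then obtain t where t: "0 \<le> t" "t \<le> 1" "w = of_real t * z" by (auto simp: closed_segment_def scaleR_conv_of_real)
    have tM: "0 \<le> t ^ M" "t ^ M \<le> 1" using t by (auto simp: power_le_one)
    have "1 + w ^ M = (1 - t ^ M) *\<^sub>R 1 + t ^ M *\<^sub>R (1 + z ^ M)"
      by (simp add: t(3) power_mult_distrib scaleR_conv_of_real algebra_simps)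
    also have "\<dots> \<in> Sect n"
      using convexD[OF convex_Sect[OF n2], of 1 "1 + z ^ M" "1 - t ^ M" "t ^ M"] tM z of_real_Sect[OF n2, of 1]
      by (simp add: face_dom_def)
    finally show "w \<in> face_dom" by (simp add: face_dom_def)
  next
    show "0 \<in> face_dom" using of_real_Sect[OF n2, of 1] M_pos by (simp add: face_dom_def power_0_left)
  qed
  then show ?thesis by (rule starlike_imp_connected)
qed

lemma vertex_meets_face:
  assumes v: "v \<in> V" and i: "i < n"
  shows "chart_map (Vx v) ` chart_dom (Vx v) \<inter> chart_map (Fc i) ` chart_dom (Fc i) \<noteq> {}"
proof -
  \<comment> \<open>On the central ray a black chart reaches only moduli below 1 and a white chart,
    measured by \<open>dir\<close>, only those above 1.\<close>
  define r :: real where "r = (if black v then 1/2 else 2)"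
  have r: "r > 0" by (simp add: r_def)
  define d where "d = pt n r (real i + 1/2)"
  have td: "turn n (real i + 1/2) d = of_real r" by (simp add: d_def turn_pt)
  have d: "d \<in> sector i" unfolding d_def by (rule wedgeI[OF n2 r]) simp
  define z where "z = dir v d"
  have dz: "dir v z = d" by (simp add: z_def)
  have z: "z \<in> slit n"
    using half_wedge_slit[OF n2 d] unfolding td by (simp add: z_def dir_def r_def)
  have "chart_map (Vx v) z = chart_map (Fc i) (face_pt i v d)" "face_pt i v d \<in> face_dom"
    using map_sector[OF i, of v z] face_pt_dom[OF v i z] d by (simp_all add: dz)
  then show ?thesis using z by (metis IntI chart_dom_simps empty_iff imageI)
qed

text \<open>Chart images are connected and every vertex chart meets every face, so a clopen set
  contains all of them or none.\<close>

lemma connected_Surf: "connected_space Surf"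
  unfolding connected_space_clopen_in
proof (intro allI impI, elim conjE)
  fix T assume T: "openin Surf T" "closedin Surf T"
  have dich: "chart_map a ` chart_dom a \<subseteq> T \<or> disjnt (chart_map a ` chart_dom a) T" if a: "a \<in> cells" for a
  proof (rule connectedin_clopen_cases[OF surf.connectedin_chart_image[OF a] T(2,1)])
    show "connected (chart_dom a)" using connected_face_dom connected_slit[OF n2] by (cases a) auto
  qed
  have vf: "chart_map (Vx v) ` chart_dom (Vx v) \<subseteq> T \<longleftrightarrow> chart_map (Fc i) ` chart_dom (Fc i) \<subseteq> T" if "v \<in> V" "i < n" for v i
    using dich[of "Vx v"] dich[of "Fc i"] vertex_meets_face[OF that] that unfolding disjnt_def by blast
  obtain v where v: "v \<in> V" using nonempty by blast
  have n0: "0 < n" using n2 by simp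
  have all: "chart_map a ` chart_dom a \<subseteq> T \<longleftrightarrow> chart_map (Fc 0) ` chart_dom (Fc 0) \<subseteq> T" if a: "a \<in> cells" for a
  proof (cases a)
    case (Vx w) then show ?thesis using vf[of w 0] a n0 by (auto simp only: cells_def)
  next
    case (Fc i)
    then have "i < n" using a by (auto simp: cells_def)
    then show ?thesis using vf[OF v, of i] vf[OF v n0] Fc by (simp only:)
  qed
  show "T = {} \<or> T = topspace Surf"
  proof (cases "chart_map (Fc 0) ` chart_dom (Fc 0) \<subseteq> T")
    case True
    then have "surf.points \<subseteq> T" unfolding surf.points_def using all by (intro UN_least) blast
    then show ?thesis using openin_subset[OF T(1)] by auto
  next
    case False
    then have "disjnt (chart_map a ` chart_dom a) T" if "a \<in> cells" for a using dich[OF that] all[OF that] by blast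
    then have "disjnt surf.points T" unfolding surf.points_def disjnt_def by blast
    then show ?thesis using openin_subset[OF T(1)] unfolding surf.topspace_glued disjnt_def by blast
  qed
qed

section \<open>Compactness\<close>

text \<open>The cores are compact pieces of the chart domains that still cover the surface.\<close>

definition vertex_core :: "complex set" where
  "vertex_core = {z. norm z \<le> 1 \<and> 1/4 \<le> norm (z ^ n + 1)}"

definition face_core :: "complex set" where
  "face_core = {w. 1 + w ^ M \<in> (\<lambda>x. exp (Ln x / of_nat n)) ` cball 1 (1/2)}"

lemma vertex_core: "compact vertex_core" "vertex_core \<subseteq> slit n"
proof -
  have "vertex_core = cball 0 1 \<inter> {z. 1/4 \<le> norm (z ^ n + 1)}" by (auto simp: vertex_core_def)
  moreover have "closed {z::complex. 1/4 \<le> norm (z ^ n + 1)}" by (intro closed_Collect_le continuous_intros)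
  ultimately show "compact vertex_core" by (simp add: compact_Int_closed)
  show "vertex_core \<subseteq> slit n"
  proof
    fix z assume z: "z \<in> vertex_core"
    then have "norm (z ^ n) \<le> 1" by (simp add: vertex_core_def norm_power power_le_one)
    then have *: "\<bar>Re (z ^ n)\<bar> \<le> 1" using abs_Re_le_cmod order_trans by blast
    show "z \<in> slit n" unfolding slit_def mem_Collect_eq
    proof
      assume "Im (z ^ n) = 0 \<and> Re (z ^ n) \<le> -1"
      then have "z ^ n = -1" using * by (auto simp: complex_eq_iff)
      then show False using z by (simp add: vertex_core_def)
    qed
  qed
qed

lemma cball_not_nonpos: "(x :: complex) \<in> cball 1 (1/2) \<Longrightarrow> x \<notin> \<real>\<^sub>\<le>\<^sub>0"
proof -
  assume "x \<in> cball 1 (1/2)"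
  then have "\<bar>Re (1 - x)\<bar> \<le> 1/2" using abs_Re_le_cmod[of "1 - x"] by (simp add: dist_norm)
  then have "Re x > 0" by (simp add: abs_if split: if_splits)
  then show ?thesis by (simp add: complex_nonpos_Reals_iff)
qed

lemma principal_root_Sect:
  assumes "x \<notin> \<real>\<^sub>\<le>\<^sub>0" shows "exp (Ln x / of_nat n) \<in> Sect n"
  unfolding Sect_iff[OF n2]
proof (intro exI conjI)
  have x0: "x \<noteq> 0" using assms by auto
  define d where "d = Im (Ln x) / (2 * pi)"
  have "\<bar>Im (Ln x)\<bar> < pi"
    using Im_Ln_less_pi[OF assms] mpi_less_Im_Ln[OF x0] by (simp add: abs_less_iff)
  then show "\<bar>d\<bar> < 1/2" by (simp add: d_def abs_mult field_simps)
  have "2 * pi * d / n = Im (Ln x) / n" by (simp add: d_def)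
  moreover have "Ln x / of_nat n = of_real (Re (Ln x) / n) + \<i> * of_real (Im (Ln x) / n)"
    by (simp add: complex_eq_iff)
  ultimately show "exp (Ln x / of_nat n) = pt n (exp (Re (Ln x) / n)) d"
    by (simp only: pt_def rcis_def cis_conv_exp exp_add exp_of_real)
qed simp

text \<open>Arguments in the sector are below \<open>pi / n\<close> in modulus, so those of
  \<open>n\<close>-th powers stay below \<open>pi\<close> and the principal logarithm recovers
  them.\<close>

lemma Sect_principal_root:
  assumes "u \<in> Sect n" shows "exp (Ln (u ^ n) / of_nat n) = u"
proof -
  obtain r d where r: "r > 0" "\<bar>d\<bar> < 1/2" "u = pt n r d" using assms unfolding Sect_iff[OF n2] by blast
  have "u = exp (of_real (ln r) + \<i> * of_real (2 * pi * d / n))"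
    using r(1) by (simp add: r(3) pt_def rcis_def cis_conv_exp exp_add exp_of_real)
  then have "u = exp ((of_real (n * ln r) + \<i> * of_real (2 * pi * d)) / of_nat n)"
    using n2 by (simp add: add_divide_distrib)
  then obtain a where a: "u = exp (a / of_nat n)" "a = of_real (n * ln r) + \<i> * of_real (2 * pi * d)" by blast
  have "u ^ n = exp a" using n2 by (simp add: a(1) flip: exp_of_nat_mult)
  moreover have "Ln (exp a) = a"
  proof (rule Ln_exp)
    have "\<bar>2 * pi * d\<bar> < pi" using r(2) by (simp add: abs_mult)
    then show "- pi < Im a" "Im a \<le> pi" by (auto simp: a(2) abs_less_iff)
  qed
  ultimately show ?thesis using a(1) by simp
qed

text \<open>The principal roots of a disc that avoids the cut form a compact subset of the open
  sector. Its preimage under \<open>1 + w ^ M\<close> is closed, and bounded because this polynomial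
  tends to infinity.\<close>

lemma face_core: "compact face_core" "face_core \<subseteq> face_dom"
proof -
  define R where "R = (\<lambda>x. exp (Ln x / of_nat n)) ` cball (1::complex) (1/2)"
  have "compact R" unfolding R_def
  proof (rule compact_continuous_image)
    show "continuous_on (cball 1 (1/2)) (\<lambda>x. exp (Ln x / complex_of_nat n))"
      using n2 cball_not_nonpos by (intro continuous_intros) auto
  qed simp
  then have "closed R" "bounded R" by (auto intro: compact_imp_closed compact_imp_bounded)
  then obtain B where B: "\<And>u. u \<in> R \<Longrightarrow> norm u \<le> B" by (auto simp: bounded_iff)
  have fc: "face_core = (\<lambda>w. 1 + w ^ M) -` R" by (auto simp: face_core_def R_def)
  have "closed face_core" unfolding fc by (intro closed_vimage \<open>closed R\<close> continuous_intros)
  moreover have "bounded face_core"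
  proof (rule boundedI)
    fix w assume "w \<in> face_core"
    then have "norm (1 + w ^ M) \<le> B" using B fc by auto
    then have "norm w ^ M \<le> B + 1" using norm_triangle_ineq4[of "1 + w ^ M" 1] by (simp add: norm_power)
    moreover have "norm w \<le> 1 \<or> norm w \<le> norm w ^ M" using self_le_power[of "norm w" M] M_pos by linarith
    ultimately show "norm w \<le> max 1 (B + 1)" by linarith
  qed
  ultimately show "compact face_core" by (simp add: compact_eq_bounded_closed)
  show "face_core \<subseteq> face_dom"
    using principal_root_Sect[OF cball_not_nonpos] by (auto simp: face_core_def face_dom_def)
qed

definition core :: "'v cell \<Rightarrow> complex set" where
  "core a = (case a of Vx v \<Rightarrow> vertex_core | Fc i \<Rightarrow> face_core)"

lemma pt_half_power: "pt n 1 (real i + 1/2) ^ n = -1"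
proof -
  have "2 * pi * (real i + 1/2) = 2 * pi * real i + pi" by (simp add: algebra_simps)
  then have "cis (2 * pi * (real i + 1/2)) = -1"
    using cos_int_2pin[of "int i"] sin_int_2pin[of "int i"] by (simp add: complex_eq_iff sin_add cos_add)
  then show ?thesis by (simp add: pt_power[OF n2] rcis_def)
qed

text \<open>Near the branch point, that is for \<open>u ^ n\<close> near 1, the face chart is used;
  elsewhere a black chart for \<open>norm u \<le> 1\<close> and a white one for
  \<open>norm u > 1\<close>. Passing to the white coordinate divides \<open>u ^ n - 1\<close> by
  \<open>u ^ n\<close>, which is why vertex cores use 1/4 where face cores use 1/2.\<close>

lemma points_covered_by_cores: "surf.points \<subseteq> (\<Union>a\<in>cells. chart_map a ` core a)"
proof
  fix p assume "p \<in> surf.points"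
  then show "p \<in> (\<Union>a\<in>cells. chart_map a ` core a)"
  proof (cases rule: points_cases)
    case (vertex v)
    have "0 \<in> vertex_core" using n2 by (simp add: vertex_core_def power_0_left)
    moreover have "p = chart_map (Vx v) 0" using vertex by simp
    ultimately have "p \<in> chart_map (Vx v) ` core (Vx v)" by (simp only: core_def cell.case imageI)
    then show ?thesis using vertex by blast
  next
    case (edge b j r)
    have pw: "pt n s (real j) ^ n = of_real (s ^ n)" "pt n s (- real j) ^ n = of_real (s ^ n)" for s
      using cos_int_2pin[of "int j"] sin_int_2pin[of "int j"]
      by (simp_all add: pt_power[OF n2] rcis_def complex_eq_iff)
    have ge: "1/4 \<le> norm (of_real (s ^ n) + 1 :: complex)" if "s > 0" for s :: real
    proof -
      have "norm (of_real (s ^ n) + 1 :: complex) = \<bar>s ^ n + 1\<bar>" by (metis norm_of_real of_real_1 of_real_add)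
      then show ?thesis using zero_less_power[OF that, of n] by linarith
    qed
    have b: "b \<in> V" "\<mu> j b \<in> V" using edge mem by (auto simp: blacks_def)
    show ?thesis
    proof (cases "r \<le> 1")
      case True
      then have "pt n r (real j) \<in> core (Vx b)" using edge(3) ge by (simp add: core_def vertex_core_def pw)
      moreover have "p = chart_map (Vx b) (pt n r (real j))" using ray_both_charts(1)[OF edge(1-3)] edge(4) by simp
      ultimately show ?thesis using b(1) by blast
    next
      case False
      then have "pt n (1 / r) (- real j) \<in> core (Vx (\<mu> j b))"
        using edge(3) ge[of "1 / r"] by (simp add: core_def vertex_core_def pw)
      moreover have "p = chart_map (Vx (\<mu> j b)) (pt n (1 / r) (- real j))"
        using ray_both_charts(2)[OF edge(1-3)] edge(4) by simp
      ultimately show ?thesis using b(2) by blast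
    qed
  next
    case (face i w)
    define u where "u = 1 + w ^ M"
    have u: "u \<in> Sect n" using face by (simp add: face_dom_def u_def)
    have un: "(pt n 1 (real i + 1/2) * u) ^ n = - (u ^ n)" by (simp add: power_mult_distrib pt_half_power)
    have nd: "norm (pt n 1 (real i + 1/2) * u) = norm u" by (simp add: norm_mult)
    consider "norm (u ^ n - 1) \<le> 1/2" | "norm (u ^ n - 1) > 1/2" "norm u \<le> 1" | "norm (u ^ n - 1) > 1/2" "norm u > 1" by linarith
    then show ?thesis
    proof cases
      case 1
      then have "u ^ n \<in> cball 1 (1/2)" by (simp add: dist_norm norm_minus_commute)
      then have "w \<in> core (Fc i)"
        using Sect_principal_root[OF u] by (auto simp: core_def face_core_def u_def intro!: rev_image_eqI[of "(1 + w ^ M) ^ n"])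
      moreover have "p = chart_map (Fc i) w" using face by simp
      ultimately show ?thesis using face(1) by blast
    next
      case 2
      have "\<not> (Im u = 0 \<and> Re u \<ge> 1)"
      proof
        assume a: "Im u = 0 \<and> Re u \<ge> 1"
        then have "u = 1" using 2(2) complex_Re_le_cmod[of u] by (auto simp: complex_eq_iff)
        then show False using 2(1) by simp
      qed
      then obtain v z where v: "v \<in> V" "black v" "dir v z = pt n 1 (real i + 1/2) * u" "chart_map (Vx v) z = (2 * i + 1, w)"
        using vertex_over_face_pt[OF face(1,2), of True] unfolding u_def by auto
      have z: "z = pt n 1 (real i + 1/2) * u" using v by (simp add: dir_def)
      have "z ^ n + 1 = - (u ^ n - 1)" unfolding z un by simp
      then have "norm (z ^ n + 1) = norm (u ^ n - 1)" by (simp only: norm_minus_cancel)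
      then have "z \<in> core (Vx v)" using 2 by (simp add: core_def vertex_core_def z nd)
      then show ?thesis
        unfolding face(3) v(4)[symmetric] using v(1) by (intro UN_I[of "Vx v"] imageI) auto
    next
      case 3
      have "\<not> (Im u = 0 \<and> Re u \<le> 1)"
      proof
        assume a: "Im u = 0 \<and> Re u \<le> 1"
        then have "u = of_real (Re u)" "Re u > 0" using real_Sect[OF n2 u] by auto
        then have "norm u = Re u" by (metis abs_of_pos norm_of_real)
        then show False using 3 a by simp
      qed
      then obtain v z where v: "v \<in> V" "\<not> black v" "dir v z = pt n 1 (real i + 1/2) * u" "chart_map (Vx v) z = (2 * i + 1, w)"
        using vertex_over_face_pt[OF face(1,2), of False] unfolding u_def by auto
      have z: "z = inverse (pt n 1 (real i + 1/2) * u)" using v(2,3) by (metis dir_def inverse_inverse_eq)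
      have nz: "norm z \<le> 1" unfolding z norm_inverse nd using 3(2) by (simp add: inverse_le_1_iff)
      have u0: "u ^ n \<noteq> 0" using 3(2) by auto
      define s where "s = norm (u ^ n)"
      have s: "s \<ge> 1" using 3(2) by (simp add: s_def norm_power one_le_power)
      have "z ^ n = inverse (- (u ^ n))" unfolding z power_inverse un ..
      then have "z ^ n + 1 = (u ^ n - 1) / u ^ n" using u0 by (simp add: field_simps)
      then have eq: "norm (z ^ n + 1) = norm (u ^ n - 1) / s" by (simp add: norm_divide s_def)
      \<comment> \<open>For \<open>s \<le> 2\<close> the left side is at most 1/2; for larger
        \<open>s\<close> it is already below \<open>s - 1\<close>.\<close>
      have "s / 4 \<le> norm (u ^ n - 1)"
      proof (cases "s \<le> 2")
        case False
        have "s \<le> norm (u ^ n - 1) + 1" using norm_triangle_ineq[of "u ^ n - 1" 1] by (simp add: s_def)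
        then show ?thesis using False by linarith
      qed (use 3(1) in linarith)
      then have "1/4 \<le> norm (u ^ n - 1) / s" using s by (simp add: field_simps)
      then have "1/4 \<le> norm (z ^ n + 1)" unfolding eq .
      then have "z \<in> core (Vx v)" using nz by (simp add: core_def vertex_core_def)
      then show ?thesis
        unfolding face(3) v(4)[symmetric] using v(1) by (intro UN_I[of "Vx v"] imageI) auto
    qed
  qed
qed

lemma orientable_Surf: "orientable_surface Surf"
proof (rule surf.orientable_surface_glued)
  obtain b where "b \<in> blacks" using ex_black by blast
  then have "chart_map (Vx b) 0 \<in> surf.points"
    unfolding surf.points_def using zero_in_slit[OF n2] by (intro UN_I[of "Vx b"] imageI) (auto simp: blacks_def)
  then show "surf.points \<noteq> {}" by blast
  show "compact_space Surf"
  proof (rule surf.compact_space_glued[of core])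
    show "compact (core a) \<and> core a \<subseteq> chart_dom a" for a
      using vertex_core face_core by (cases a) (simp_all add: core_def)
  qed (rule points_covered_by_cores)
qed (rule connected_Surf)

end

section \<open>The embedded graph and its faces\<close>

context cyclic_factorization
begin

definition place :: "'v \<Rightarrow> point" where "place v = (2 * enc v, 0)"

text \<open>The substitution \<open>t / (1 - t)\<close> stretches the half-open unit interval to the
  whole ray from 0; \<open>t = 1\<close> is the white end over infinity.\<close>

definition arc :: "'v \<Rightarrow> nat \<Rightarrow> real \<Rightarrow> point" where
  "arc b j t = (if t < 1 then (2 * enc b, pt n (t / (1 - t)) (real j)) else (2 * enc (\<mu> j b), 0))"

text \<open>An edge is an unordered pair. Its black end and its colour are determined by it, so the
  choice has only one possible outcome.\<close>

definition edge_arc :: "'v set \<Rightarrow> real \<Rightarrow> point" where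
  "edge_arc e = (let (b, j) = SOME (b, j). b \<in> blacks \<and> j < n \<and> e = {b, \<mu> j b} in arc b j)"

lemma edge_rep_unique:
  assumes "b \<in> blacks" "j < n" "b' \<in> blacks" "j' < n" "{b, \<mu> j b} = {b', \<mu> j' b'}"
  shows "b = b' \<and> j = j'"
proof -
  have "black b" "black b'" "\<not> black (\<mu> j b)" "\<not> black (\<mu> j' b')" "b \<in> V"
    using assms colour by (auto simp: blacks_def)
  then have "b = b'" "\<mu> j b = \<mu> j' b'" using assms(5) by (auto simp: doubleton_eq_iff)
  then show ?thesis using proper assms \<open>b \<in> V\<close> by blast
qed

lemma edge_arc: "b \<in> blacks \<Longrightarrow> j < n \<Longrightarrow> edge_arc {b, \<mu> j b} = arc b j"
proof -
  assume b: "b \<in> blacks" "j < n"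
  have "(SOME (b', j'). b' \<in> blacks \<and> j' < n \<and> {b, \<mu> j b} = {b', \<mu> j' b'}) = (b, j)"
  proof (rule some_equality)
    show "x = (b, j)" if "case x of (b', j') \<Rightarrow> b' \<in> blacks \<and> j' < n \<and> {b, \<mu> j b} = {b', \<mu> j' b'}" for x
      using that edge_rep_unique[OF b, of "fst x" "snd x"] by (cases x) auto
  qed (use b in auto)
  then show ?thesis by (simp add: edge_arc_def)
qed

lemma edge_black_rep:
  assumes "v \<in> V" "j < n" obtains b where "b \<in> blacks" "{v, \<mu> j v} = {b, \<mu> j b}"
proof (cases "black v")
  case True then show ?thesis using that[of v] assms by (simp add: blacks_def)
next
  case False then show ?thesis using that[of "\<mu> j v"] assms by (simp add: blacks_def mem colour invol insert_commute)
qed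

lemma arc_ends: "arc b j 0 = place b" "arc b j 1 = place (\<mu> j b)"
  by (simp_all add: arc_def place_def pt_def)

lemma arc_interior:
  "arc b j ` {0<..<1} = {(2 * enc b, pt n r (real j)) | r. r > 0}"
proof (intro equalityI subsetI)
  fix p assume "p \<in> arc b j ` {0<..<1}"
  then obtain t where "0 < t" "t < 1" "p = arc b j t" by auto
  then show "p \<in> {(2 * enc b, pt n r (real j)) | r. r > 0}" by (auto simp: arc_def intro!: exI[of _ "t / (1 - t)"])
next
  fix p assume "p \<in> {(2 * enc b, pt n r (real j)) | r. r > 0}"
  then obtain r where r: "r > 0" "p = (2 * enc b, pt n r (real j))" by blast
  have "r / (1 + r) / (1 - r / (1 + r)) = r" "r / (1 + r) < 1" "0 < r / (1 + r)"
    using r(1) by (auto simp: field_simps)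
  then show "p \<in> arc b j ` {0<..<1}" using r by (intro image_eqI[of _ _ "r / (1 + r)"]) (auto simp: arc_def)
qed

lemma arc_image:
  "arc b j ` {0..1} = {place b, place (\<mu> j b)} \<union> {(2 * enc b, pt n r (real j)) | r. r > 0}"
proof -
  have "{0..1::real} = {0<..<1} \<union> {0, 1}" by auto
  then have "arc b j ` {0..1} = arc b j ` {0<..<1} \<union> {arc b j 0, arc b j 1}" by (simp only: image_Un image_insert image_empty)
  then show ?thesis unfolding arc_interior by (auto simp: arc_def place_def)
qed

text \<open>Without its white end the arc lies in the black chart, without its black end in the
  white one, where inversion exchanges \<open>t\<close> with \<open>1 - t\<close> and negates the
  direction. The two pieces are what continuity is pasted from.\<close>

lemma arc_charts:
  assumes b: "b \<in> blacks" and j: "j < n"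
  shows "0 \<le> t \<Longrightarrow> t < 1 \<Longrightarrow> arc b j t = chart_map (Vx b) (pt n (t / (1 - t)) (real j)) \<and> pt n (t / (1 - t)) (real j) \<in> slit n"
    and "0 < t \<Longrightarrow> t \<le> 1 \<Longrightarrow> arc b j t = chart_map (Vx (\<mu> j b)) (pt n ((1 - t) / t) (- real j)) \<and> pt n ((1 - t) / t) (- real j) \<in> slit n"
proof -
  assume t: "0 \<le> t" "t < 1"
  show "arc b j t = chart_map (Vx b) (pt n (t / (1 - t)) (real j)) \<and> pt n (t / (1 - t)) (real j) \<in> slit n"
  proof (cases "t = 0")
    case True
    have "pt n (0 / (1 - 0)) (real j) = 0" by simp
    then show ?thesis using True zero_in_slit[OF n2] by (simp add: arc_def del: pt_eq_0)
  next
    case False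
    then show ?thesis using ray_both_charts(1,3)[OF b j, of "t / (1 - t)"] t by (simp add: arc_def)
  qed
next
  assume t: "0 < t" "t \<le> 1"
  show "arc b j t = chart_map (Vx (\<mu> j b)) (pt n ((1 - t) / t) (- real j)) \<and> pt n ((1 - t) / t) (- real j) \<in> slit n"
  proof (cases "t = 1")
    case True
    have "pt n ((1 - 1) / 1) (- real j) = 0" by simp
    then show ?thesis using True zero_in_slit[OF n2] by (simp add: arc_def del: pt_eq_0)
  next
    case False
    then have "t / (1 - t) > 0" "1 / (t / (1 - t)) = (1 - t) / t" using t by auto
    then show ?thesis using ray_both_charts(2,4)[OF b j, of "t / (1 - t)"] t False by (simp add: arc_def)
  qed
qed

lemma continuous_pt [continuous_intros]:
  "continuous_on S f \<Longrightarrow> continuous_on S g \<Longrightarrow> continuous_on S (\<lambda>t. pt n (f t) (g t))"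
  unfolding pt_def rcis_def by (cases "n = 0") (auto intro!: continuous_intros)

lemma pathin_arc:
  assumes b: "b \<in> blacks" and j: "j < n"
  shows "pathin Surf (arc b j)"
  unfolding pathin_def
proof -
  define f where "f i = (if i then (\<lambda>t. chart_map (Vx b) (pt n (t / (1 - t)) (real j)))
     else (\<lambda>t. chart_map (Vx (\<mu> j b)) (pt n ((1 - t) / t) (- real j))))" for i
  define T :: "bool \<Rightarrow> real set" where "T i = (if i then {0..<1} else {0<..1})" for i
  have bV: "b \<in> V" "\<mu> j b \<in> V" using b j mem by (auto simp: blacks_def)
  show "continuous_map (top_of_set {0..1}) Surf (arc b j)"
  proof (rule pasting_lemma[where I = UNIV and T = T and f = f])
    fix i :: bool
    show "openin (top_of_set {0..1}) (T i)"
    proof (cases i)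
      case True
      then show ?thesis unfolding T_def openin_open by (intro exI[of _ "{..<1}"]) auto
    next
      case False
      then show ?thesis unfolding T_def openin_open by (intro exI[of _ "{0<..}"]) auto
    qed
    have sub: "subtopology (top_of_set {0..1}) (T i) = top_of_set (T i)"
    proof -
      have "{0..1} \<inter> T i = T i" by (cases i) (auto simp: T_def)
      then show ?thesis by (simp add: subtopology_subtopology)
    qed
    show "continuous_map (subtopology (top_of_set {0..1}) (T i)) Surf (f i)"
    proof (cases i)
      case True
      have "continuous_map (top_of_set {0..<1}) Surf (\<lambda>t. chart_map (Vx b) (pt n (t / (1 - t)) (real j)))"
      proof (rule surf.continuous_into_glued[OF cellsI(1)[OF bV(1)]])
        show "continuous_on {0..<1} (\<lambda>t. pt n (t / (1 - t)) (real j))" by (intro continuous_intros) auto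
        show "(\<lambda>t. pt n (t / (1 - t)) (real j)) ` {0..<1} \<subseteq> chart_dom (Vx b)" using arc_charts(1)[OF b j] by auto
      qed
      then show ?thesis unfolding sub unfolding f_def T_def using True by simp
    next
      case False
      have "continuous_map (top_of_set {0<..1}) Surf (\<lambda>t. chart_map (Vx (\<mu> j b)) (pt n ((1 - t) / t) (- real j)))"
      proof (rule surf.continuous_into_glued[OF cellsI(1)[OF bV(2)]])
        show "continuous_on {0<..1} (\<lambda>t. pt n ((1 - t) / t) (- real j))" by (intro continuous_intros) auto
        show "(\<lambda>t. pt n ((1 - t) / t) (- real j)) ` {0<..1} \<subseteq> chart_dom (Vx (\<mu> j b))" using arc_charts(2)[OF b j] by auto
      qed
      then show ?thesis unfolding sub unfolding f_def T_def using False by simp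
    qed
  next
    have eq: "f i t = arc b j t" if "t \<in> T i" for i t
      using that arc_charts[OF b j, of t] by (cases i) (auto simp: f_def T_def)
    show "f i x = f i' x" if "x \<in> topspace (top_of_set {0..1}) \<inter> T i \<inter> T i'" for i i' x
      using that eq by auto
    show "\<exists>i. i \<in> UNIV \<and> x \<in> T i \<and> arc b j x = f i x" if "x \<in> topspace (top_of_set {0..1})" for x
    proof -
      have x: "x \<in> T (x < 1)" using that by (auto simp: T_def)
      then show ?thesis using eq[OF x] by (intro exI[of _ "x < 1"]) simp
    qed
  qed
qed

lemma inj_on_arc:
  assumes b: "b \<in> blacks" and j: "j < n"
  shows "inj_on (arc b j) {0..1}"
proof (rule linorder_inj_onI)
  fix s t :: real assume st: "s < t" "s \<in> {0..1}" "t \<in> {0..1}"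
  have bV: "b \<in> V" "\<mu> j b \<in> V" "b \<noteq> \<mu> j b" using b j mem colour[OF j, of b] by (auto simp: blacks_def)
  show "arc b j s \<noteq> arc b j t"
  proof (cases "t < 1")
    case True
    show ?thesis
    proof
      assume "arc b j s = arc b j t"
      then have "pt n (s / (1 - s)) (real j) = pt n (t / (1 - t)) (real j)" using st True by (simp add: arc_def)
      from arg_cong[OF this, of norm] have "s / (1 - s) = t / (1 - t)" using st True by simp
      then show False using st True by (simp add: field_simps)
    qed
  next
    case False
    then show ?thesis using st bV by (simp add: arc_def enc_inj)
  qed
qed auto

lemma place_inj: "inj_on place V"
  by (rule inj_onI) (simp add: place_def enc_inj)

lemma vertex_chart_point: "v \<in> V \<Longrightarrow> place v = chart_map (Vx v) 0" by (simp add: place_def)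

lemma graph_embedding_Surf: "graph_embedding V edges Surf place edge_arc"
  unfolding graph_embedding_def
proof (intro conjI ballI impI)
  show "place ` V \<subseteq> topspace Surf"
  proof
    fix p assume "p \<in> place ` V"
    then obtain v where v: "v \<in> V" "p = chart_map (Vx v) 0" using vertex_chart_point by auto
    then show "p \<in> topspace Surf"
      unfolding surf.topspace_glued surf.points_def using zero_in_slit[OF n2]
      by (intro UN_I[of "Vx v"]) (auto simp del: map_zero)
  qed
  show "inj_on place V" by (rule place_inj)
next
  fix e assume "e \<in> edges"
  then obtain v j where "v \<in> V" "j < n" "e = {v, \<mu> j v}" by (auto simp: edges_def)
  then obtain b where b: "b \<in> blacks" "j < n" "e = {b, \<mu> j b}" using edge_black_rep by metis
  have ea: "edge_arc e = arc b j" using edge_arc b by simp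
  show "pathin Surf (edge_arc e)" unfolding ea by (rule pathin_arc[OF b(1,2)])
  show "inj_on (edge_arc e) {0..1}" unfolding ea by (rule inj_on_arc[OF b(1,2)])
  have "place ` e = {place b, place (\<mu> j b)}" using b(3) by simp
  then show "{edge_arc e 0, edge_arc e 1} = place ` e" unfolding ea arc_ends by simp
  show "edge_arc e ` {0<..<1} \<inter> place ` V = {}" unfolding ea arc_interior by (auto simp: place_def)
  fix e' assume "e' \<in> edges" and ne: "e \<noteq> e'"
  then obtain v' j' where "v' \<in> V" "j' < n" "e' = {v', \<mu> j' v'}" by (auto simp: edges_def)
  then obtain b' where b': "b' \<in> blacks" "j' < n" "e' = {b', \<mu> j' b'}" using edge_black_rep by metis
  have ea': "edge_arc e' = arc b' j'" using edge_arc b' by simp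
  show "edge_arc e ` {0<..<1} \<inter> edge_arc e' ` {0<..<1} = {}"
  proof (rule ccontr)
    assume "edge_arc e ` {0<..<1} \<inter> edge_arc e' ` {0<..<1} \<noteq> {}"
    then obtain r r' where r: "r > 0" "r' > 0" "enc b = enc b'" "pt n r (real j) = pt n r' (real j')"
      unfolding ea ea' arc_interior by auto
    have "b = b'" using r(3) enc_inj b b' by (auto simp: blacks_def)
    moreover have "j = j'" by (rule ray_unique[OF n2 r(1,2) b(2) b'(2) r(4)])
    ultimately show False using ne b b' by simp
  qed
qed

section \<open>Faces and their frontiers\<close>

definition rays :: "nat set \<Rightarrow> point set" where
  "rays J = {(2 * enc b, pt n r (real j)) | b r j. b \<in> blacks \<and> r > 0 \<and> j \<in> J}"

text \<open>A set \<open>J\<close> of colours is allowed so that the statement serves both the whole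
  graph and the boundary of a face, which consists of two consecutive colours.\<close>

lemma graph_image_coloured:
  assumes J: "J \<subseteq> {..<n}"
  shows "graph_image V {{v, \<mu> j v} | v j. v \<in> V \<and> j \<in> J} place edge_arc = place ` V \<union> rays J"
proof -
  have "{{v, \<mu> j v} | v j. v \<in> V \<and> j \<in> J} = {{b, \<mu> j b} | b j. b \<in> blacks \<and> j \<in> J}"
  proof (intro equalityI subsetI)
    fix e assume "e \<in> {{v, \<mu> j v} | v j. v \<in> V \<and> j \<in> J}"
    then obtain v j where v: "v \<in> V" "j \<in> J" "e = {v, \<mu> j v}" by blast
    then obtain b where "b \<in> blacks" "e = {b, \<mu> j b}" using edge_black_rep[of v j] J by auto
    then show "e \<in> {{b, \<mu> j b} | b j. b \<in> blacks \<and> j \<in> J}" using v(2) by blast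
  next
    fix e assume "e \<in> {{b, \<mu> j b} | b j. b \<in> blacks \<and> j \<in> J}"
    then show "e \<in> {{v, \<mu> j v} | v j. v \<in> V \<and> j \<in> J}" by (auto simp: blacks_def)
  qed
  moreover have "(\<Union>e\<in>{{b, \<mu> j b} | b j. b \<in> blacks \<and> j \<in> J}. edge_arc e ` {0..1})
      = (\<Union>b\<in>blacks. \<Union>j\<in>J. edge_arc {b, \<mu> j b} ` {0..1})" by blast
  moreover have "\<dots> = (\<Union>b\<in>blacks. \<Union>j\<in>J. {place b, place (\<mu> j b)} \<union> {(2 * enc b, pt n r (real j)) | r. r > 0})"
    using J by (intro SUP_cong refl) (simp add: edge_arc arc_image subset_iff)
  moreover have "place ` V \<union> \<dots> = place ` V \<union> rays J"
  proof -
    have "place b \<in> place ` V" "place (\<mu> j b) \<in> place ` V" if "b \<in> blacks" "j \<in> J" for b j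
      using that J mem by (auto simp: blacks_def)
    then show ?thesis unfolding rays_def by blast
  qed
  ultimately show ?thesis unfolding graph_image_def by simp
qed

lemma graph_image_edges: "graph_image V edges place edge_arc = {p \<in> surf.points. even (fst p)}"
proof -
  have "edges = {{v, \<mu> j v} | v j. v \<in> V \<and> j \<in> {..<n}}" by (auto simp: edges_def)
  then have "graph_image V edges place edge_arc = place ` V \<union> rays {..<n}"
    using graph_image_coloured[of "{..<n}"] by simp
  also have "\<dots> = {p \<in> surf.points. even (fst p)}"
  proof (intro equalityI subsetI)
    fix p assume "p \<in> place ` V \<union> rays {..<n}"
    then show "p \<in> {p \<in> surf.points. even (fst p)}"
    proof
      assume "p \<in> place ` V"
      then show ?thesis using graph_embedding_Surf by (auto simp: graph_embedding_def place_def)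
    next
      assume "p \<in> rays {..<n}"
      then obtain b r j where b: "b \<in> blacks" "r > 0" "j < n" "p = (2 * enc b, pt n r (real j))" by (auto simp: rays_def)
      then have "p = chart_map (Vx b) (pt n r (real j))" "pt n r (real j) \<in> chart_dom (Vx b)" "Vx b \<in> cells"
        using ray_both_charts[OF b(1,3,2)] by (auto simp: blacks_def)
      then have "p \<in> surf.points" unfolding surf.points_def by blast
      then show ?thesis using b by simp
    qed
  next
    fix p assume p: "p \<in> {p \<in> surf.points. even (fst p)}"
    then have "p \<in> surf.points" by simp
    then show "p \<in> place ` V \<union> rays {..<n}"
      by (cases rule: points_cases) (use p in \<open>auto simp: place_def rays_def\<close>)
  qed
  finally show ?thesis .
qed

definition face :: "nat \<Rightarrow> point set" where "face i = chart_map (Fc i) ` face_dom"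

lemma face_eq: "face i = {(2 * i + 1, w) | w. w \<in> face_dom}" by (auto simp: face_def)

lemma openin_face: "i < n \<Longrightarrow> openin Surf (face i)"
  unfolding face_def using surf.openin_chart_image[of "Fc i" face_dom] surf.open_D[of "Fc i"] by auto

lemma complement_graph: "topspace Surf - graph_image V edges place edge_arc = (\<Union>i<n. face i)"
proof (intro equalityI subsetI)
  fix p assume "p \<in> topspace Surf - graph_image V edges place edge_arc"
  then have p: "p \<in> surf.points" "odd (fst p)" by (auto simp: graph_image_edges)
  show "p \<in> (\<Union>i<n. face i)" using p(1)
    by (cases rule: points_cases) (use p(2) in \<open>auto simp: face_eq\<close>)
next
  fix p assume "p \<in> (\<Union>i<n. face i)"
  then obtain i where i: "i < n" "p \<in> face i" by blast
  then have "p \<in> surf.points" using openin_subset[OF openin_face] by auto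
  then show "p \<in> topspace Surf - graph_image V edges place edge_arc"
    using i by (auto simp: graph_image_edges face_eq)
qed

text \<open>The sets \<open>face i\<close> are open, pairwise disjoint and connected, and they fill
  the complement of the graph; each is therefore clopen there and a full component.\<close>

lemma faces_Surf:
  assumes F: "F \<in> faces V edges Surf place edge_arc"
  shows "\<exists>i<n. F = face i"
proof -
  define Y where "Y = subtopology Surf (\<Union>i<n. face i)"
  have FY: "F \<in> connected_components_of Y" using F unfolding faces_def complement_graph Y_def .
  have sub: "face i \<subseteq> surf.points" if "i < n" for i using openin_subset[OF openin_face[OF that]] by simp
  have tY: "topspace Y = (\<Union>i<n. face i)" unfolding Y_def using sub by auto
  obtain p where "p \<in> F" using nonempty_connected_components_of[OF FY] by blast
  then obtain i where i: "i < n" "p \<in> face i"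
    using connected_components_of_subset[OF FY] tY by blast
  have op: "openin Y (face i)" if "i < n" for i
    using openin_subtopology_Int2[OF openin_face[OF that], of "\<Union>i<n. face i"] that
    unfolding Y_def by (metis Int_absorb1 UN_upper lessThan_iff)
  have "closedin Y (face i)"
  proof -
    have "topspace Y - face i = (\<Union>j\<in>{..<n} - {i}. face j)" unfolding tY using i by (auto simp: face_eq)
    moreover have "openin Y (\<Union>j\<in>{..<n} - {i}. face j)" using op by (intro openin_Union) auto
    ultimately show ?thesis using sub[OF i(1)] i tY by (simp add: closedin_def) blast
  qed
  then have "F \<subseteq> face i"
    using connectedin_clopen_cases[OF connectedin_connected_components_of[OF FY] _ op[OF i(1)]] i(2) \<open>p \<in> F\<close>
    by (auto simp: disjnt_def)
  moreover have "connectedin Y (face i)"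
    unfolding Y_def connectedin_subtopology
    using surf.connectedin_chart_image[of "Fc i"] connected_face_dom i(1) by (auto simp: face_def)
  then have "face i \<subseteq> F"
    using connected_components_of_maximal[OF FY] i(2) \<open>p \<in> F\<close> by (auto simp: disjnt_def)
  ultimately show ?thesis using i(1) by blast
qed

lemma face_in_vertex_chart:
  assumes v: "v \<in> V" and i: "i < n"
  shows "{z \<in> chart_dom (Vx v). chart_map (Vx v) z \<in> face i} = (sector_dom v i)"
  using glue_vertex_face[OF assms] unfolding face_def by (auto simp: image_iff simp del: map_Fc)

lemma vertex_in_closure:
  assumes v: "v \<in> V" and i: "i < n"
  shows "0 \<in> closure (sector_dom v i)"
  unfolding closure_sequential
proof (intro exI conjI allI)
  \<comment> \<open>The sequence runs along the central ray of the sector, mirrored at white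
    vertices by inversion. This ray carries a branch point at modulus 1, and the moduli
    \<open>1 / (k + 2)\<close> stay below it.\<close>
  define s where "s = (if black v then 1 else -1 :: real)"
  define X where "X k = pt n (1 / real (Suc (Suc k))) (s * (real i + 1/2))" for k
  show "X k \<in> (sector_dom v i)" for k
  proof -
    have pos: "1 / real (Suc (Suc k)) > 0" "\<not> 1 / real (Suc (Suc k)) \<ge> 1" by auto
    have "X k \<in> slit n" using pt_in_slit[OF n2 pos(1)] pos(2) by (simp add: X_def)
    moreover have "\<exists>r>0. dir v (X k) = pt n r (real i + 1/2)"
    proof (cases "black v")
      case True
      then show ?thesis using pos(1)
        by (intro exI[of _ "1 / real (Suc (Suc k))"]) (simp add: X_def s_def dir_def del: of_nat_Suc)
    next
      case False then show ?thesis
        by (intro exI[of _ "real (Suc (Suc k))"]) (simp add: X_def s_def dir_def pt_inverse add.commute[of "1/2"] del: of_nat_Suc)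
    qed
    then have "dir v (X k) \<in> sector i" using wedgeI[OF n2, of _ "real i + 1/2" "real i + 1/2"] by auto
    ultimately show ?thesis by simp
  qed
  have "(\<lambda>k. norm (X k)) \<longlonglongrightarrow> 0"
    using LIMSEQ_Suc[OF LIMSEQ_inverse_real_of_nat] by (simp add: X_def inverse_eq_divide)
  then show "X \<longlonglongrightarrow> 0" by (simp add: tendsto_norm_zero_iff)
qed

text \<open>A point of a bounding ray is approached at constant modulus by turning into the sector,
  counterclockwise from ray \<open>i\<close> and clockwise from the next one.\<close>

lemma ray_in_closure:
  assumes i: "i < n" and r: "r > 0" and j: "j \<in> {i, Suc i mod n}"
  shows "pt n r (real j) \<in> closure (slit n \<inter> sector i)"
proof -
  \<comment> \<open>The second ray is counted as \<open>i + 1\<close> without reduction modulo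
    \<open>n\<close>, which keeps it next to the sector on the line of directions.\<close>
  define x where "x = (if j = i then real i else real i + 1)"
  define s where "s = (if j = i then 1 else -1 :: real)"
  have "pt n r (real j) = pt n r x"
  proof (cases "j = i")
    case False
    then have jj: "j = Suc i mod n" using j by simp
    show ?thesis
    proof (cases "Suc i = n")
      case True
      then have "j = 0" "x = 0 + of_int 1 * real n" using jj False True by (auto simp: x_def)
      then show ?thesis using pt_period[OF n2, of r 0 1] by simp
    next
      case False
      then have "j = Suc i" using jj i by simp
      then show ?thesis by (simp add: x_def add.commute)
    qed
  qed (simp add: x_def)
  moreover have "pt n r x \<in> closure (slit n \<inter> sector i)"
    unfolding closure_sequential
  proof (intro exI conjI allI)
    define d where "d k = 1 / real (Suc (Suc (Suc k)))" for k
    have d: "0 < d k" "d k < 1/2" for k by (auto simp: d_def)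
    show "pt n r (x + s * d k) \<in> slit n \<inter> sector i" for k
    proof
      have "pt n r (x + s * d k) \<in> wedge n (real (if j = i then i else Suc i))"
        by (rule wedgeI[OF n2 r]) (use d[of k] in \<open>auto simp: x_def s_def abs_less_iff\<close>)
      then show "pt n r (x + s * d k) \<in> slit n" by (rule wedge_int_slit(1)[OF n2])
      show "pt n r (x + s * d k) \<in> sector i"
        by (rule wedgeI[OF n2 r]) (use d[of k] in \<open>auto simp: x_def s_def abs_less_iff\<close>)
    qed
    have "d \<longlonglongrightarrow> 0"
      using LIMSEQ_Suc[OF LIMSEQ_Suc[OF LIMSEQ_inverse_real_of_nat]] by (simp add: d_def[abs_def] inverse_eq_divide)
    then have "(\<lambda>k. x + s * d k) \<longlonglongrightarrow> x + s * 0" by (intro tendsto_intros)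
    then have lim: "(\<lambda>k. x + s * d k) \<longlonglongrightarrow> x" by simp
    have "continuous_on UNIV (\<lambda>y. pt n r y)" by (intro continuous_intros)
    then show "(\<lambda>k. pt n r (x + s * d k)) \<longlonglongrightarrow> pt n r x"
      using lim unfolding continuous_on_sequentially o_def by blast
  qed
  ultimately show ?thesis by simp
qed

text \<open>If an edge point of colour \<open>j\<close> lies in the closure, the open wedge around
  ray \<open>j\<close> meets sector \<open>i\<close>, and this forces \<open>j\<close> to be one of
  its two bounding rays. Points of other faces are separated from face \<open>i\<close> because
  faces are open and disjoint.\<close>

lemma frontier_face:
  assumes i: "i < n"
  shows "Surf frontier_of (face i) = place ` V \<union> rays {i, Suc i mod n}"
  unfolding frontier_of_openin[OF openin_face[OF i]]
proof (intro equalityI subsetI)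
  fix p assume p: "p \<in> Surf closure_of (face i) - face i"
  then have "p \<in> surf.points" using closure_of_subset_topspace by (metis DiffD1 subsetD surf.topspace_glued)
  then show "p \<in> place ` V \<union> rays {i, Suc i mod n}"
  proof (cases rule: points_cases)
    case (vertex v) then show ?thesis by (auto simp: place_def)
  next
    case (edge b j r)
    have b: "b \<in> V" "black b" using edge by (auto simp: blacks_def)
    have cl: "chart_map (Vx b) (pt n r (real j)) \<in> Surf closure_of (face i)"
      using p edge(4) ray_both_charts(1)[OF edge(1-3)] by simp
    have d: "pt n r (real j) \<in> chart_dom (Vx b)" using ray_both_charts(3)[OF edge(1-3)] by simp
    have "pt n r (real j) \<in> closure (sector_dom b i)"
      using cl unfolding surf.closure_of_chart_iff[OF cellsI(1)[OF b(1)] d] face_in_vertex_chart[OF b(1) i] .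
    moreover have "pt n r (real j) \<in> wedge n (real j)" by (rule ray_wedge[OF n2 edge(3)])
    ultimately have "wedge n (real j) \<inter> (sector_dom b i) \<noteq> {}"
      using open_Int_closure_eq_empty[OF open_wedge[OF n2, of "real j"], of "(sector_dom b i)"] by auto
    then obtain z where "z \<in> wedge n (real j)" "dir b z \<in> sector i" by blast
    then have "j = i \<or> j = Suc i mod n" using half_wedge_meet[OF n2 i edge(2), of z] b by (simp add: dir_def)
    then show ?thesis using edge by (auto simp: rays_def)
  next
    case (face j w)
    have "p \<in> face j" using face by (auto simp: face_eq)
    moreover have "openin Surf (face j)" by (rule openin_face[OF face(1)])
    moreover have "\<forall>T. p \<in> T \<and> openin Surf T \<longrightarrow> (\<exists>y. y \<in> face i \<and> y \<in> T)"
      using p by (simp add: in_closure_of)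
    ultimately obtain y where "y \<in> face i" "y \<in> face j" by blast
    then have "i = j" by (auto simp: face_eq)
    then show ?thesis using p \<open>p \<in> face j\<close> by simp
  qed
next
  fix p assume p: "p \<in> place ` V \<union> rays {i, Suc i mod n}"
  then have "even (fst p)" by (auto simp: place_def rays_def)
  then have "p \<notin> face i" by (auto simp: face_eq)
  moreover have "p \<in> Surf closure_of (face i)"
    using p
  proof
    assume "p \<in> place ` V"
    then obtain v where v: "v \<in> V" "p = chart_map (Vx v) 0" using vertex_chart_point by auto
    have "0 \<in> chart_dom (Vx v)" using zero_in_slit[OF n2] by simp
    then show ?thesis unfolding v(2) surf.closure_of_chart_iff[OF cellsI(1)[OF v(1)] \<open>0 \<in> chart_dom (Vx v)\<close>]
      using vertex_in_closure[OF v(1) i] face_in_vertex_chart[OF v(1) i] by simp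
  next
    assume "p \<in> rays {i, Suc i mod n}"
    then obtain b r j where b: "b \<in> blacks" "r > 0" "j \<in> {i, Suc i mod n}" "p = (2 * enc b, pt n r (real j))"
      by (auto simp: rays_def)
    have bV: "b \<in> V" "black b" using b by (auto simp: blacks_def)
    have j: "j < n" using b(3) i Suc_mod_less by auto
    have pc: "p = chart_map (Vx b) (pt n r (real j))" and d: "pt n r (real j) \<in> chart_dom (Vx b)"
      using ray_both_charts[OF b(1) j b(2)] b(4) by auto
    have "slit n \<inter> sector i = {z \<in> chart_dom (Vx b). chart_map (Vx b) z \<in> face i}"
      unfolding face_in_vertex_chart[OF bV(1) i] using bV(2) by (auto simp: dir_def)
    then show ?thesis unfolding pc surf.closure_of_chart_iff[OF cellsI(1)[OF bV(1)] d]
      using ray_in_closure[OF i b(2,3)] by simp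
  qed
  ultimately show "p \<in> Surf closure_of (face i) - face i" by blast
qed

lemma hamiltonian_embedding_Surf: "hamiltonian_embedding V edges Surf place edge_arc"
  unfolding hamiltonian_embedding_def
proof (intro conjI ballI)
  show "graph_embedding V edges Surf place edge_arc" by (rule graph_embedding_Surf)
  fix F assume "F \<in> faces V edges Surf place edge_arc"
  then obtain i where i: "i < n" "F = face i" using faces_Surf by blast
  have "Surf frontier_of F = graph_image V (face_edges i) place edge_arc"
    unfolding i(2) frontier_face[OF i(1)] face_edges_def
    using graph_image_coloured[of "{i, Suc i mod n}"] i(1) Suc_mod_less by simp
  then show "\<exists>vs. hamiltonian_cycle V edges vs \<and>
      Surf frontier_of F = graph_image (set vs) (cycle_edges vs) place edge_arc"
    using hamiltonian_face_cycle[OF i(1)] cycle_edges_face_cycle[OF i(1)] by metis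
qed

end

theorem theorem3p1:
  fixes k n :: nat
  assumes "k \<ge> 1" and "n = 2 ^ k"
  shows "\<exists>(X :: point topology) p \<gamma>.
           orientable_surface X \<and>
           hamiltonian_embedding (hypercube_verts n) (hypercube_edges n) X p \<gamma>"
proof -
  obtain k' where "k = Suc k'" using assms(1) by (cases k) auto
  then obtain black \<mu> where f: "hypercube_factorization n black \<mu>"
    using hypercube_factorization_exists assms(2) by blast
  interpret cyclic_factorization "hypercube_verts n" black \<mu> n
    using f by (simp add: hypercube_factorization_def)
  show ?thesis
    using orientable_Surf hamiltonian_embedding_Surf unfolding hypercube_edges_eq[OF f] by blast
qed

end
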